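(* For $?\in\{\mathrm{I},\mathrm{II}\}$ and a positive integer $X$, let $\mu_{?,X}$ be the measure on $\mathscr{S}_?$ corresponding (via the Riesz representation theorem) to the positive linear functional on $C_c(\mathscr{S}_?)$ \[\phi_{?,X}(f)=\frac{1}{C_?\sqrt X}\sum_{\substack{K\text{ pure cubic of Type }?\\|\Delta(K)|\le X}}f(\operatorname{sh}(K)),\] i.e. $\mu_{?,X}=\frac{1}{C_?\sqrt X}\sum_K\delta_{\operatorname{sh}(K)}$. Then $\mu_{?,X}$ converges weakly to $\mu_?$: for every continuous compactly supported function $f$ on $\mathscr{S}_?$, \[\lim_{X\to\infty}\int f\,d\mu_{?,X}=\int f\,d\mu_?.\]
   Context: $C=\prod_p(1-3/p^2+2/p^3)$ over all primes, $C_{\mathrm{I}}=2C\sqrt3/15$, $C_{\mathrm{II}}=C\sqrt3/10$. A pure cubic field is $K=\mathbf{Q}(m^{1/3})$, $m$ a positive non-cube integer; it can be written uniquely as $\mathbf{Q}((ab^2)^{1/3})$ with $a,b$ coprime squarefree positive integers, $a>b$; its ratio is $r_K=a/b$. With $m=ab^2$, $K$ is of Type II if $3\nmid m$ and $r_K\equiv\pm1\pmod9$, Type I otherwise. The sum runs over isomorphism classes of such fields; $\Delta(K)$ is the discriminant. $\mathscr{S}_{\mathrm{I}}=\{iy:y\ge1\}$, $\mathscr{S}_{\mathrm{II}}=\{(1+iy)/3:y\ge1\}$, each with measure $\mu_?=dy/y$. The shape $\operatorname{sh}(K)$ taken in $\mathscr{S}_?$ is $i\,r_K^{1/3}$ for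 Type I and $(1+i\,r_K^{1/3})/3$ for Type II. *)

theory Defs
  imports
    "HOL-Analysis.Analysis"
    "HOL-Algebra.Algebraic_Closure_Type"
    "HOL-Algebra.Generated_Fields"
    "HOL-Algebra.QuotRing"
    "HOL-Computational_Algebra.Squarefree"
    "HOL-Number_Theory.Cong"
    "Jordan_Normal_Form.Determinant"
begin

abbreviation real_ring :: "real ring" where
  "real_ring \<equiv> ring_of_type_algebra"

abbreviation complex_ring :: "complex ring" where
  "complex_ring \<equiv> ring_of_type_algebra"

abbreviation as_field :: "real set \<Rightarrow> real ring" where
  "as_field K \<equiv> real_ring\<lparr>carrier := K\<rparr>"

definition Q_adjoin :: "real \<Rightarrow> real set" where
  "Q_adjoin \<alpha> = generate_field real_ring {\<alpha>}"

definition ring_of_integers :: "real set \<Rightarrow> real set" where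
  "ring_of_integers K = {x \<in> K. algebraic_int x}"

text \<open>Homomorphisms are normalised by \<^const>\<open>extensional\<close> outside \<open>K\<close>,
  so that every embedding of \<open>K\<close> into the complex numbers is counted once.\<close>

definition embeddings :: "real set \<Rightarrow> (real \<Rightarrow> complex) set" where
  "embeddings K = Ring.ring_hom (as_field K) complex_ring \<inter> extensional K"

definition field_trace :: "real set \<Rightarrow> real \<Rightarrow> complex" where
  "field_trace K x = (\<Sum>\<sigma>\<in>embeddings K. \<sigma> x)"

definition integral_basis :: "real set \<Rightarrow> real list \<Rightarrow> bool" where
  "integral_basis K \<omega> \<longleftrightarrow>
     bij_betw (\<lambda>c :: int list. \<Sum>i<length \<omega>. of_int (c ! i) * \<omega> ! i)
       {c. length c = length \<omega>} (ring_of_integers K)"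

definition discriminant :: "real set \<Rightarrow> int" where
  "discriminant K = (THE d. \<exists>\<omega>. integral_basis K \<omega> \<and>
     of_int d = Determinant.det
       (Matrix.mat (length \<omega>) (length \<omega>) (\<lambda>(i, j). field_trace K (\<omega> ! i * \<omega> ! j))))"

text \<open>Every pure cubic field is isomorphic to the one generated by the real cube root of its
  radicand, so subfields of the real numbers represent all isomorphism classes.\<close>

definition pure_cubic_fields :: "real set set" where
  "pure_cubic_fields =
     {Q_adjoin (root 3 (real m)) | m :: nat. m > 0 \<and> \<not> (\<exists>n :: nat. m = n ^ 3)}"

definition field_iso :: "real set rel" where
  "field_iso = {(K, L). K \<in> pure_cubic_fields \<and> L \<in> pure_cubic_fields \<and> as_field K \<simeq> as_field L}"

definition pure_params :: "real set \<Rightarrow> nat \<times> nat" where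
  "pure_params K = (THE (a, b). 0 < b \<and> b < a \<and> coprime a b \<and> squarefree a \<and> squarefree b \<and>
     K = Q_adjoin (root 3 (real (a * b\<^sup>2))))"

definition radicand :: "real set \<Rightarrow> nat" where
  "radicand K = (case pure_params K of (a, b) \<Rightarrow> a * b\<^sup>2)"

definition ratio :: "real set \<Rightarrow> rat" where
  "ratio K = (case pure_params K of (a, b) \<Rightarrow> of_nat a / of_nat b)"

text \<open>Congruence of rational numbers: the difference is \<open>n\<close> times a fraction whose
  denominator is prime to \<open>n\<close>.\<close>

definition rat_cong :: "rat \<Rightarrow> rat \<Rightarrow> int \<Rightarrow> bool" where
  "rat_cong x y n \<longleftrightarrow>
     (\<exists>c d :: int. d \<noteq> 0 \<and> coprime d n \<and> x - y = of_int n * (of_int c / of_int d))"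

datatype cubic_type = TypeI | TypeII

definition type_of_field :: "real set \<Rightarrow> cubic_type" where
  "type_of_field K =
     (if \<not> 3 dvd radicand K \<and> (rat_cong (ratio K) 1 9 \<or> rat_cong (ratio K) (- 1) 9)
      then TypeII else TypeI)"

fun ray_point :: "cubic_type \<Rightarrow> real \<Rightarrow> complex" where
  "ray_point TypeI y = \<i> * of_real y"
| "ray_point TypeII y = (1 + \<i> * of_real y) / 3"

definition shape_space :: "cubic_type \<Rightarrow> complex set" where
  "shape_space t = ray_point t ` {1..}"

definition shape :: "real set \<Rightarrow> complex" where
  "shape K = ray_point (type_of_field K) (root 3 (of_rat (ratio K)))"

definition iso_classes :: "cubic_type \<Rightarrow> nat \<Rightarrow> real set set set" where
  "iso_classes t N =
     {K \<in> pure_cubic_fields. type_of_field K = t \<and> \<bar>discriminant K\<bar> \<le> int N} // field_iso"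

text \<open>The common value of \<^const>\<open>shape\<close> on an isomorphism class.\<close>

definition class_shape :: "real set set \<Rightarrow> complex" where
  "class_shape c = the_elem (shape ` c)"

definition density_const :: real where
  "density_const =
     prodinf (\<lambda>p :: nat. if Factorial_Ring.prime p then 1 - 3 / real p ^ 2 + 2 / real p ^ 3 else 1)"

fun type_const :: "cubic_type \<Rightarrow> real" where
  "type_const TypeI = 2 * density_const * sqrt 3 / 15"
| "type_const TypeII = density_const * sqrt 3 / 10"

definition shape_borel :: "cubic_type \<Rightarrow> complex measure" where
  "shape_borel t = restrict_space borel (shape_space t)"

text \<open>The measure \<open>dy / y\<close>, transported to the ray along its parametrisation.\<close>

definition shape_measure :: "cubic_type \<Rightarrow> complex measure" where
  "shape_measure t =
     distr (density (restrict_space lborel {1..}) (\<lambda>y. ennreal (1 / y))) (shape_borel t) (ray_point t)"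

text \<open>Functions on the ray are represented by functions on the plane, whose values off the
  ray are irrelevant.  The ray contains its end point, so a compactly supported function
  need not vanish there.\<close>

definition Cc :: "cubic_type \<Rightarrow> (complex \<Rightarrow> real) set" where
  "Cc t = {f. continuous_on (shape_space t) f \<and>
     (\<exists>S. compact S \<and> S \<subseteq> shape_space t \<and> (\<forall>z \<in> shape_space t - S. f z = 0))}"

definition shape_functional :: "cubic_type \<Rightarrow> nat \<Rightarrow> (complex \<Rightarrow> real) \<Rightarrow> real" where
  "shape_functional t N f =
     1 / (type_const t * sqrt (real N)) * (\<Sum>c\<in>iso_classes t N. f (class_shape c))"

text \<open>Pushing forward the counting measure on the isomorphism classes gives the sum of the
  Dirac measures at their shapes.\<close>

definition empirical_measure :: "cubic_type \<Rightarrow> nat \<Rightarrow> complex measure" where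
  "empirical_measure t N =
     scale_measure (ennreal (1 / (type_const t * sqrt (real N))))
       (distr (count_space (iso_classes t N)) (shape_borel t) class_shape)"

end

theory Submission
  imports Defs "Jordan_Normal_Form.Char_Poly" "HOL-Real_Asymp.Real_Asymp"
begin

text \<open>
  A pure cubic field is determined by its pair \<open>(a, b)\<close>, and by Dedekind its discriminant is
  \<open>-27 a\<^sup>2 b\<^sup>2\<close> for Type I and \<open>-3 a\<^sup>2 b\<^sup>2\<close> for Type II.  Since \<open>r\<^sub>K = a / b\<close>, the
  functional is a sum of \<open>f\<close> over the pairs of coprime squarefree integers that lie in the hyperbolic
  sector \<open>u v \<le> T\<^sup>2\<close>, \<open>u > v > 0\<close>, with weight depending on \<open>u / v\<close> only.

  For the conditions at the primes up to \<open>z\<close>, which are periodic, such a sum is a Riemann sum over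
  finitely many residue classes; the number of classes is a product over primes by the Chinese
  remainder theorem.  The pairs violating a condition at some prime \<open>p > z\<close> number only
  \<open>O(T\<^sup>2 / z)\<close>.  Letting \<open>T \<rightarrow> \<infinity>\<close> and then \<open>z \<rightarrow> \<infinity>\<close> gives the
  Euler product, times \<open>4/5\<close> or \<open>1/5\<close> from the condition at \<open>3\<close>.  The substitution
  \<open>u = y\<^sup>3 v\<close> turns the area element on the sector into \<open>dy / y\<close>.
\<close>

section \<open>Closure of the algebraic integers\<close>

text \<open>The sector has a cusp: for \<open>v\<close> near 0, \<open>u v \<le> 1\<close> leaves
  \<open>u\<close> unbounded. Compact support of \<open>f\<close> cuts it off, since
  \<open>u / v \<le> R^3\<close> forces \<open>v \<le> 1\<close> and \<open>u \<le> R^3\<close>;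
  Riemann sums and the crude count of bad pairs in a square of side \<open>O(T)\<close> depend on
  this. The scale is \<open>T^4 = N / 27\<close> for Type I and \<open>T^4 = N / 3\<close> for Type
  II, so that the discriminant bound reads \<open>a b \<le> T^2\<close>. Integrating out
  \<open>v\<close> contributes the factor \<open>3/2\<close>, whence
  \<open>C_I = (4/5) (3/2) C / sqrt 27\<close> and \<open>C_II = (1/5) (3/2) C / sqrt 3\<close>. The
  shares are 48 and 12 out of 60 admissible residue pairs modulo 9.

  Dedekind's formula is proved from the definition of \<open>discriminant\<close>, a trace
  determinant over an arbitrary integral basis. This rests on closure of the algebraic integers
  under ring operations and on congruences that confine the coordinates of an integer of the field.
  Isomorphism classes of these real fields are singletons, because a real number has only one real
  cube root.\<close>

text \<open>The vector \<open>v\<close> is an eigenvector of the integer matrix \<open>A\<close>, so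
  \<open>x\<close> is a root of its characteristic polynomial, which is monic with integer
  coefficients.\<close>

lemma algebraic_int_eigenvalue:
  fixes x :: "'a :: field_char_0" and v :: "nat \<Rightarrow> 'a"
  assumes eig: "\<And>i. i < n \<Longrightarrow> x * v i = (\<Sum>j<n. of_int (A i j) * v j)"
    and "i0 < n" "v i0 \<noteq> 0"
  shows "algebraic_int x"
proof -
  define M :: "int mat" where "M = Matrix.mat n n (\<lambda>(i, j). A i j)"
  have M: "M \<in> carrier_mat n n" by (simp add: M_def)
  have M': "map_mat (of_int :: int \<Rightarrow> 'a) M \<in> carrier_mat n n" using M by simp
  have "eigenvector (map_mat (of_int :: int \<Rightarrow> 'a) M) (Matrix.vec n v) x"
    unfolding eigenvector_def
  proof (intro conjI)
    show "Matrix.vec n v \<noteq> 0\<^sub>v (dim_row (map_mat (of_int :: int \<Rightarrow> 'a) M))"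
    proof
      assume *: "Matrix.vec n v = 0\<^sub>v (dim_row (map_mat (of_int :: int \<Rightarrow> 'a) M))"
      have "Matrix.vec n v $ i0 = v i0" using assms by simp
      with * assms M show False by simp
    qed
    show "map_mat of_int M *\<^sub>v Matrix.vec n v = x \<cdot>\<^sub>v Matrix.vec n v"
      by (rule eq_vecI)
        (auto simp: M_def eig scalar_prod_def lessThan_atLeast0 intro!: sum.cong)
  qed (use M in auto)
  hence "eigenvalue (map_mat (of_int :: int \<Rightarrow> 'a) M) x" unfolding eigenvalue_def by blast
  hence "poly (map_poly of_int (char_poly M)) x = 0"
    unfolding eigenvalue_root_char_poly[OF M'] of_int_hom.char_poly_hom[OF M] .
  moreover have "Polynomial.lead_coeff (char_poly M) = 1" using degree_monic_char_poly[OF M] by simp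
  ultimately show ?thesis unfolding algebraic_int_altdef_ipoly by blast
qed

text \<open>The index set is arbitrary, so that monomials in two variables can be indexed by
  pairs.\<close>

definition int_span :: "'b set \<Rightarrow> ('b \<Rightarrow> 'a :: comm_ring_1) \<Rightarrow> 'a set" where
  "int_span I v = {(\<Sum>i\<in>I. of_int (c i) * v i) | c. True}"

lemma int_spanI: "y = (\<Sum>i\<in>I. of_int (c i) * v i) \<Longrightarrow> y \<in> int_span I v"
  unfolding int_span_def by blast

lemma int_span_base:
  assumes "finite I" "i \<in> I" shows "v i \<in> int_span I v"
  by (rule int_spanI[where c = "\<lambda>j. if j = i then 1 else 0"])
    (use assms in \<open>simp add: if_distrib[of of_int] if_distrib[of "\<lambda>x. x * _"] cong: if_cong\<close>)

lemma int_span_add: "y \<in> int_span I v \<Longrightarrow> z \<in> int_span I v \<Longrightarrow> y + z \<in> int_span I v"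
  unfolding int_span_def
  by clarsimp (rule exI, subst sum.distrib[symmetric], subst distrib_right[symmetric],
      subst of_int_add[symmetric], rule refl)

lemma int_span_scale: "y \<in> int_span I v \<Longrightarrow> of_int k * y \<in> int_span I v"
  unfolding int_span_def
  by clarsimp (rule exI, subst sum_distrib_left, subst mult.assoc[symmetric],
      subst of_int_mult[symmetric], rule refl)

lemma int_span_sum:
  assumes "finite J" "\<And>j. j \<in> J \<Longrightarrow> f j \<in> int_span I v"
  shows "(\<Sum>j\<in>J. f j) \<in> int_span I v"
  using assms
proof (induction J rule: finite_induct)
  case empty
  show ?case by (rule int_spanI[where c = "\<lambda>_. 0"]) simp
qed (auto intro: int_span_add)

lemma int_span_mult:
  assumes "\<And>i. i \<in> I \<Longrightarrow> x * v i \<in> int_span I v" "finite I" "y \<in> int_span I v"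
  shows "x * y \<in> int_span I v"
proof -
  obtain c where y: "y = (\<Sum>i\<in>I. of_int (c i) * v i)" using assms(3) unfolding int_span_def by blast
  have "x * y = (\<Sum>i\<in>I. of_int (c i) * (x * v i))"
    by (simp add: y sum_distrib_left mult_ac)
  also have "\<dots> \<in> int_span I v" by (intro int_span_sum int_span_scale assms)
  finally show ?thesis .
qed

text \<open>Writing each \<open>x * v i\<close> in terms of the generators gives an integer matrix
  with eigenvector \<open>v\<close>; this is the integrality criterion by finitely generated
  modules.\<close>

lemma algebraic_int_stable_span:
  fixes x :: "'a :: field_char_0"
  assumes "finite I" "i0 \<in> I" "v i0 \<noteq> 0"
    and span: "\<And>i. i \<in> I \<Longrightarrow> x * v i \<in> int_span I v"
  shows "algebraic_int x"
proof -
  obtain h where h: "bij_betw h {..<card I} I"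
    using ex_bij_betw_nat_finite[OF assms(1)] by (auto simp: lessThan_atLeast0)
  have "\<forall>i\<in>I. \<exists>c. x * v i = (\<Sum>j\<in>I. of_int (c j) * v j)"
    using span unfolding int_span_def by blast
  then obtain C where C: "\<And>i. i \<in> I \<Longrightarrow> x * v i = (\<Sum>j\<in>I. of_int (C i j) * v j)" by metis
  obtain k where k: "k < card I" "h k = i0" using h assms(2) unfolding bij_betw_def by (metis imageE lessThan_iff)
  show ?thesis
  proof (rule algebraic_int_eigenvalue[of "card I" x "v \<circ> h" "\<lambda>i j. C (h i) (h j)" k])
    fix i assume "i < card I"
    hence "h i \<in> I" using h by (auto simp: bij_betw_def)
    thus "x * (v \<circ> h) i = (\<Sum>j<card I. of_int (C (h i) (h j)) * (v \<circ> h) j)"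
      using C[of "h i"] sum.reindex_bij_betw[OF h, of "\<lambda>j. of_int (C (h i) j) * v j"] by simp
  qed (use k assms in auto)
qed

lemma algebraic_int_power_span:
  fixes x :: "'a :: field_char_0"
  assumes "algebraic_int x"
  obtains n c where "n > 0" "x ^ n = (\<Sum>i<n. of_int (c i) * x ^ i)"
proof -
  obtain p where p: "poly (map_poly of_int p) x = 0" "Polynomial.lead_coeff p = 1"
    using assms unfolding algebraic_int_altdef_ipoly by blast
  define n where "n = Polynomial.degree p"
  \<comment> \<open>A monic constant polynomial is 1 and has no root. Positivity of \<open>n\<close>
    later puts 1 among the monomials.\<close>
  have "n > 0"
  proof (rule ccontr)
    assume "\<not> n > 0"
    hence "Polynomial.degree p = 0" by (simp add: n_def)
    then obtain a where "p = [:a:]" by (rule degree_eq_zeroE)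
    with p show False by simp
  qed
  have "0 = (\<Sum>i\<le>n. of_int (Polynomial.coeff p i) * x ^ i)"
    using p(1) by (simp add: poly_altdef degree_map_poly coeff_map_poly n_def)
  also have "\<dots> = (\<Sum>i<n. of_int (Polynomial.coeff p i) * x ^ i) + x ^ n"
    using p(2) by (simp add: lessThan_Suc_atMost[symmetric] n_def)
  finally have "x ^ n = (\<Sum>i<n. of_int (- Polynomial.coeff p i) * x ^ i)"
    by (simp add: sum_negf eq_neg_iff_add_eq_0 add.commute)
  with \<open>n > 0\<close> show thesis by (rule that)
qed

text \<open>The monomials \<open>x^i y^j\<close> with \<open>i < n\<close> and \<open>j < m\<close>
  span a module stable under \<open>x\<close> and under \<open>y\<close>, hence under
  \<open>x + y\<close> and \<open>x * y\<close>.\<close>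

lemma algebraic_int_add_mult:
  fixes x y :: "'a :: field_char_0"
  assumes "algebraic_int x" "algebraic_int y"
  shows "algebraic_int (x + y)" "algebraic_int (x * y)"
proof -
  obtain n c where n: "n > 0" "x ^ n = (\<Sum>i<n. of_int (c i) * x ^ i)"
    using algebraic_int_power_span[OF assms(1)] .
  obtain m d where m: "m > 0" "y ^ m = (\<Sum>i<m. of_int (d i) * y ^ i)"
    using algebraic_int_power_span[OF assms(2)] .
  define I where "I = {..<n} \<times> {..<m}"
  define v where "v = (\<lambda>(i, j). x ^ i * y ^ j)"
  have fin: "finite I" by (simp add: I_def)
  have X: "x * v ij \<in> int_span I v" if "ij \<in> I" for ij
  proof -
    obtain i j where ij: "ij = (i, j)" "i < n" "j < m" using \<open>ij \<in> I\<close> by (auto simp: I_def)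
    show ?thesis
    proof (cases "Suc i = n")
      case False
      hence "v (Suc i, j) \<in> int_span I v" using ij by (intro int_span_base) (auto simp: I_def)
      thus ?thesis by (simp add: ij v_def mult_ac)
    next
      case True
      \<comment> \<open>At the top exponent the monic relation replaces \<open>x^n\<close> by lower
        powers.\<close>
      have "x * v ij = x ^ n * y ^ j" using True by (auto simp: ij v_def)
      also have "\<dots> = (\<Sum>k<n. of_int (c k) * v (k, j))" by (simp add: n(2) sum_distrib_right sum_distrib_left v_def mult_ac)
      also have "\<dots> \<in> int_span I v"
        using ij by (intro int_span_sum int_span_scale int_span_base) (auto simp: I_def)
      finally show ?thesis .
    qed
  qed
  have Y: "y * v ij \<in> int_span I v" if "ij \<in> I" for ij
  proof -
    obtain i j where ij: "ij = (i, j)" "i < n" "j < m" using \<open>ij \<in> I\<close> by (auto simp: I_def)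
    show ?thesis
    proof (cases "Suc j = m")
      case False
      hence "v (i, Suc j) \<in> int_span I v" using ij by (intro int_span_base) (auto simp: I_def)
      thus ?thesis by (simp add: ij v_def mult_ac)
    next
      case True
      have "y * v ij = x ^ i * y ^ m" using True by (auto simp: ij v_def)
      also have "\<dots> = (\<Sum>k<m. of_int (d k) * v (i, k))" by (simp add: m(2) sum_distrib_left v_def mult_ac)
      also have "\<dots> \<in> int_span I v"
        using ij by (intro int_span_sum int_span_scale int_span_base) (auto simp: I_def)
      finally show ?thesis .
    qed
  qed
  have 0: "(0, 0) \<in> I" "v (0, 0) \<noteq> 0" using n m by (auto simp: I_def v_def)
  show "algebraic_int (x + y)"
    using X Y by (intro algebraic_int_stable_span[of I "(0, 0)" v] fin 0) (simp add: distrib_right int_span_add)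
  show "algebraic_int (x * y)"
    using X int_span_mult[OF X fin Y]
    by (intro algebraic_int_stable_span[of I "(0, 0)" v] fin 0) (simp add: mult.assoc)
qed

lemmas algebraic_int_add [intro] = algebraic_int_add_mult(1)
lemmas algebraic_int_mult [intro] = algebraic_int_add_mult(2)

lemma algebraic_int_power [intro]:
  fixes x :: "'a :: field_char_0"
  shows "algebraic_int x \<Longrightarrow> algebraic_int (x ^ n)"
  by (induction n) auto

section \<open>Pure cubic fields and their parameters\<close>

lemma real_ring_simps [simp]:
  "carrier ring_of_type_algebra = UNIV" "x \<otimes>\<^bsub>ring_of_type_algebra\<^esub> y = x * y"
  "\<one>\<^bsub>ring_of_type_algebra\<^esub> = 1" "\<zero>\<^bsub>ring_of_type_algebra\<^esub> = 0"
  "x \<oplus>\<^bsub>ring_of_type_algebra\<^esub> y = x + y"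
  by (simp_all add: ring_of_type_algebra_def)

lemma real_ring_uminus [simp]: "\<ominus>\<^bsub>real_ring\<^esub> x = - x"
proof -
  interpret R: ring real_ring by (rule ring_from_type_algebra)
  show ?thesis using R.minus_equality[of "- x" x] by simp
qed

lemma real_ring_inv [simp]: "x \<noteq> 0 \<Longrightarrow> inv\<^bsub>real_ring\<^esub> x = inverse x"
proof -
  assume "x \<noteq> 0"
  interpret R: cring real_ring by (rule cring_from_type_algebra)
  show ?thesis using R.comm_inv_char[of x "inverse x"] \<open>x \<noteq> 0\<close> by simp
qed

section \<open>The subfield generated by one real number\<close>

lemma Q_adjoin_self: "x \<in> Q_adjoin x"
  unfolding Q_adjoin_def by (rule generate_field.incl) simp

lemma Q_adjoin_closed:
  shows Q_adjoin_1: "1 \<in> Q_adjoin t"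
    and Q_adjoin_add: "x \<in> Q_adjoin t \<Longrightarrow> y \<in> Q_adjoin t \<Longrightarrow> x + y \<in> Q_adjoin t"
    and Q_adjoin_mult: "x \<in> Q_adjoin t \<Longrightarrow> y \<in> Q_adjoin t \<Longrightarrow> x * y \<in> Q_adjoin t"
    and Q_adjoin_uminus: "x \<in> Q_adjoin t \<Longrightarrow> - x \<in> Q_adjoin t"
  unfolding Q_adjoin_def
  using generate_field.one[of real_ring] generate_field.eng_add[of x real_ring _ y]
    generate_field.eng_mult[of x real_ring _ y] generate_field.a_inv[of x real_ring] by simp_all

lemma Q_adjoin_0: "0 \<in> Q_adjoin t"
  using Q_adjoin_add[OF Q_adjoin_1 Q_adjoin_uminus[OF Q_adjoin_1]] by simp

lemma Q_adjoin_inverse: "x \<in> Q_adjoin t \<Longrightarrow> inverse x \<in> Q_adjoin t"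
  using generate_field.m_inv[of x real_ring "{t}"] Q_adjoin_0[of t]
  unfolding Q_adjoin_def by (cases "x = 0") simp_all

lemma Q_adjoin_of_rat: "of_rat q \<in> Q_adjoin t"
proof -
  have nat: "of_nat n \<in> Q_adjoin t" for n
    by (induction n) (auto intro: Q_adjoin_0 Q_adjoin_add Q_adjoin_1)
  have int: "of_int n \<in> Q_adjoin t" for n
    by (cases n rule: int_cases2) (use nat Q_adjoin_uminus in auto)
  obtain k d where "q = of_int k / of_int d" by (cases q) (auto simp: Fract_of_int_quotient)
  thus ?thesis using Q_adjoin_mult[OF int[of k] Q_adjoin_inverse[OF int[of d]]]
    by (simp add: of_rat_divide) (simp add: divide_inverse)
qed

lemma Q_adjoin_least:
  assumes "t \<in> S" "1 \<in> S" "\<And>x y. x \<in> S \<Longrightarrow> y \<in> S \<Longrightarrow> x + y \<in> S"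
    "\<And>x y. x \<in> S \<Longrightarrow> y \<in> S \<Longrightarrow> x * y \<in> S" "\<And>x. x \<in> S \<Longrightarrow> - x \<in> S"
    "\<And>x. x \<in> S \<Longrightarrow> x \<noteq> 0 \<Longrightarrow> inverse x \<in> S"
  shows "Q_adjoin t \<subseteq> S"
proof
  fix x assume "x \<in> Q_adjoin t"
  thus "x \<in> S" unfolding Q_adjoin_def
    by (induction rule: generate_field.induct) (use assms in auto)
qed

lemma Q_adjoin_subset: "s \<in> Q_adjoin t \<Longrightarrow> Q_adjoin s \<subseteq> Q_adjoin t"
  by (rule Q_adjoin_least) (auto intro: Q_adjoin_closed Q_adjoin_inverse)

text \<open>Lets the cube part of a radicand be dropped.\<close>

lemma Q_adjoin_scale:
  assumes "c \<noteq> 0" shows "Q_adjoin (of_rat c * t) = Q_adjoin t"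
proof
  show "Q_adjoin (of_rat c * t) \<subseteq> Q_adjoin t"
    by (intro Q_adjoin_subset Q_adjoin_mult Q_adjoin_self Q_adjoin_of_rat)
  have "t = of_rat (inverse c) * (of_rat c * t)" using assms by (simp add: of_rat_inverse)
  also have "\<dots> \<in> Q_adjoin (of_rat c * t)" by (intro Q_adjoin_mult Q_adjoin_self Q_adjoin_of_rat)
  finally show "Q_adjoin t \<subseteq> Q_adjoin (of_rat c * t)" by (rule Q_adjoin_subset)
qed

text \<open>The target is any field of characteristic zero: embeddings go to the complex numbers,
  isomorphisms between the fields are viewed as maps to the reals.\<close>

lemma ring_hom_of_rat:
  fixes h :: "real \<Rightarrow> 'a :: field_char_0"
  assumes h: "h \<in> Ring.ring_hom (as_field (Q_adjoin t)) ring_of_type_algebra"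
  shows "h (of_rat q) = of_rat q"
proof -
  have add: "h (x + y) = h x + h y" if "x \<in> Q_adjoin t" "y \<in> Q_adjoin t" for x y
    using ring_hom_add[OF h] that by simp
  have mult: "h (x * y) = h x * h y" if "x \<in> Q_adjoin t" "y \<in> Q_adjoin t" for x y
    using ring_hom_mult[OF h] that by simp
  have one: "h 1 = 1" using ring_hom_one[OF h] by simp
  have zero: "h 0 = 0" using add[OF Q_adjoin_0 Q_adjoin_0] by simp
  have nat: "h (of_nat n) = of_nat n" for n
  proof (induction n)
    case (Suc n)
    have "h (1 + of_nat n) = 1 + of_nat n"
      using add[OF Q_adjoin_1 Q_adjoin_of_rat[of "of_nat n"]] one Suc by (simp add: of_rat_of_nat_eq)
    thus ?case by simp
  qed (simp add: zero)
  have int: "h (of_int n) = of_int n" for n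
  proof (cases n rule: int_cases2)
    case (nonpos k)
    have "h (- of_nat k) + h (of_nat k) = 0"
      using add[OF Q_adjoin_of_rat[of "- of_nat k"] Q_adjoin_of_rat[of "of_nat k"]] zero
      by (simp add: of_rat_minus)
    hence "h (- of_nat k) = - of_nat k" by (simp add: nat eq_neg_iff_add_eq_0)
    thus ?thesis unfolding nonpos by simp
  qed (use nat in auto)
  obtain k d where q: "q = of_int k / of_int d" "d \<noteq> 0"
    by (cases q) (auto simp: Fract_of_int_quotient)
  have "of_int d \<in> Q_adjoin t" using Q_adjoin_of_rat[of "of_int d" t] by simp
  hence "h (of_rat q * of_int d) = h (of_rat q) * h (of_int d)" by (rule mult[OF Q_adjoin_of_rat])
  moreover have "of_rat q * of_int d = (of_int k :: real)" unfolding q(1) using q(2) by (simp add: of_rat_divide)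
  ultimately have "of_int k = h (of_rat q) * of_int d" unfolding int by (simp only: int)
  hence "h (of_rat q) = of_int k / of_int d" using q(2) by (simp add: eq_divide_eq)
  thus ?thesis unfolding q(1) by (simp add: of_rat_divide)
qed

section \<open>Cubefree decomposition of the radicand\<close>

text \<open>At a prime the exponents of \<open>a\<close> and \<open>b\<close> are (0,0), (1,0) or
  (0,1), so the exponent of \<open>a b^2\<close> modulo 3 determines them, and cubes do not change
  it. Pairs in either order are covered, which serves for a field written with swapped parameters
  and for the pair (1,1) of a perfect cube.\<close>

lemma cubefree_decomp_unique:
  fixes a b c d u v :: nat
  assumes "coprime a b" "squarefree a" "squarefree b" "coprime c d" "squarefree c" "squarefree d"
    and "u > 0" "v > 0" and eq: "a * b\<^sup>2 * u ^ 3 = c * d\<^sup>2 * v ^ 3"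
  shows "a = c \<and> b = d"
proof -
  have nz: "a \<noteq> 0" "b \<noteq> 0" "c \<noteq> 0" "d \<noteq> 0" using assms(2,3,5,6) not_squarefree_0 by metis+
  have *: "multiplicity p a = multiplicity p c \<and> multiplicity p b = multiplicity p d"
    if p: "Factorial_Ring.prime p" for p
  proof -
    have 1: "multiplicity p a \<le> 1" "multiplicity p b \<le> 1" "multiplicity p c \<le> 1" "multiplicity p d \<le> 1"
      using assms(2,3,5,6) nz p by (auto simp: squarefree_factorial_semiring'')
    have 2: "multiplicity p a = 0 \<or> multiplicity p b = 0" "multiplicity p c = 0 \<or> multiplicity p d = 0"
      using assms(1,4) p by (meson coprime_common_divisor not_dvd_imp_multiplicity_0 not_prime_unit)+
    have "multiplicity p (a * b\<^sup>2 * u ^ 3) = multiplicity p a + 2 * multiplicity p b + 3 * multiplicity p u"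
      using p nz \<open>u > 0\<close>
      by (simp add: prime_elem_multiplicity_mult_distrib prime_elem_multiplicity_power_distrib)
    moreover have "multiplicity p (c * d\<^sup>2 * v ^ 3) = multiplicity p c + 2 * multiplicity p d + 3 * multiplicity p v"
      using p nz \<open>v > 0\<close>
      by (simp add: prime_elem_multiplicity_mult_distrib prime_elem_multiplicity_power_distrib)
    ultimately have e: "multiplicity p a + 2 * multiplicity p b + 3 * multiplicity p u =
        multiplicity p c + 2 * multiplicity p d + 3 * multiplicity p v" using eq by simp
    have mod3: "(A + 2 * B + 3 * U) mod 3 = (A + 2 * B) mod 3" for A B U :: nat by presburger
    have digits: "A = C \<and> B = D"
      if "(A + 2 * B) mod 3 = (C + 2 * D) mod 3" "A \<le> 1" "B \<le> 1" "C \<le> 1" "D \<le> 1"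
        "A = 0 \<or> B = 0" "C = 0 \<or> D = 0" for A B C D :: nat
      using that by (auto simp: le_Suc_eq)
    show ?thesis using arg_cong[OF e, of "\<lambda>x. x mod 3"] 1 2 unfolding mod3 by (intro digits)
  qed
  have "a = c" by (rule multiplicity_eq_nat) (use nz * in blast)+
  moreover have "b = d" by (rule multiplicity_eq_nat) (use nz * in blast)+
  ultimately show ?thesis ..
qed

text \<open>Removing the largest cube divisor leaves a cubefree \<open>k\<close>. In the
  decomposition \<open>k = a b^2\<close> with \<open>a\<close> squarefree, a square dividing
  \<open>b\<close> or a common divisor of \<open>a\<close> and \<open>b\<close> would produce a cube
  dividing \<open>k\<close>.\<close>

lemma cubefree_decomp_exists:
  fixes m :: nat
  assumes "m > 0"
  obtains a b c :: nat where "coprime a b" "squarefree a" "squarefree b" "c > 0" "m = a * b\<^sup>2 * c ^ 3"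
proof -
  define C where "C = {c. c ^ 3 dvd m}"
  have "C \<subseteq> {..m}"
  proof
    fix x assume "x \<in> C"
    hence "x ^ 3 \<le> m" "x \<noteq> 0" using assms by (auto simp: C_def dvd_imp_le intro!: Nat.gr0I)
    moreover have "x ^ 1 \<le> x ^ 3" using \<open>x \<noteq> 0\<close> by (intro power_increasing) auto
    ultimately show "x \<in> {..m}" by simp
  qed
  hence fin: "finite C" by (rule finite_subset) simp
  have "1 \<in> C" by (simp add: C_def)
  define c where "c = Max C"
  have cC: "c \<in> C" unfolding c_def using fin \<open>1 \<in> C\<close> by (intro Max_in) auto
  have c0: "c > 0" using Max_ge[OF fin \<open>1 \<in> C\<close>] by (simp add: c_def)
  obtain k where k: "m = c ^ 3 * k" using cC by (auto simp: C_def)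
  have nocube: "p = 1" if "p ^ 3 dvd k" for p :: nat
  proof -
    have "(c * p) ^ 3 dvd m" using that by (simp add: k power_mult_distrib mult_dvd_mono)
    hence "c * p \<le> c" unfolding c_def using fin by (intro Max_ge) (auto simp: C_def)
    moreover have "p \<noteq> 0" using that assms k by (intro notI) simp
    ultimately show ?thesis using c0 by simp
  qed
  define a where "a = squarefree_part k"
  define b where "b = square_part k"
  have kab: "k = a * b\<^sup>2" unfolding a_def b_def by (rule squarefree_decompose)
  show thesis
  proof (rule that[of a b c])
    show "squarefree a" by (simp add: a_def)
    show "squarefree b"
    proof (rule squarefreeI)
      fix x assume "x\<^sup>2 dvd b"
      hence "(x\<^sup>2)\<^sup>2 dvd k" unfolding kab by (intro dvd_mult dvd_power_same)
      hence "x ^ 3 dvd k" by (rule dvd_trans[rotated]) (simp add: le_imp_power_dvd flip: power_mult)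
      thus "x dvd 1" using nocube[of x] by simp
    qed
    show "coprime a b"
    proof (rule coprimeI)
      fix x assume "x dvd a" "x dvd b"
      hence "x * x\<^sup>2 dvd k" unfolding kab by (intro mult_dvd_mono dvd_power_same)
      hence "x ^ 3 dvd k" by (simp add: power3_eq_cube power2_eq_square mult.assoc)
      thus "x dvd 1" using nocube[of x] by simp
    qed
  qed (use c0 k kab in auto)
qed

text \<open>One identity serves the real field, with \<open>w = 1\<close>, and its complex
  conjugates, with \<open>w\<close> a cube root of unity.\<close>

lemma pure_cubic_mult:
  fixes a b s t w x y z x' y' z' :: "'a :: comm_ring_1"
  assumes st: "s * t = a * b" "s\<^sup>2 = b * t" "t\<^sup>2 = a * s" and w: "w ^ 3 = 1"
  shows "(x + w * y * s + w\<^sup>2 * z * t) * (x' + w * y' * s + w\<^sup>2 * z' * t) =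
    x * x' + a * b * (y * z' + z * y') + w * (x * y' + y * x' + a * z * z') * s
      + w\<^sup>2 * (x * z' + z * x' + b * y * y') * t"
proof -
  have w4: "w ^ 4 = w" using w by (simp add: power4_eq_xxxx power3_eq_cube)
  have "(x + w * y * s + w\<^sup>2 * z * t) * (x' + w * y' * s + w\<^sup>2 * z' * t) =
      x * x' + (y * z' + z * y') * w ^ 3 * (s * t) + (x * y' + y * x') * w * s + (x * z' + z * x') * w\<^sup>2 * t
      + y * y' * w\<^sup>2 * s\<^sup>2 + z * z' * w ^ 4 * t\<^sup>2"
    by (simp add: algebra_simps power2_eq_square power3_eq_cube power4_eq_xxxx)
  thus ?thesis unfolding st w w4 by (simp add: algebra_simps)
qed

section \<open>Arithmetic of one pure cubic field in the basis 1, \<alpha>, \<beta>\<close>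

locale cubic_pair =
  fixes a b :: nat
  assumes b_pos: "0 < b" and b_less_a: "b < a" and coprime: "coprime a b"
    and squarefree_a: "squarefree a" and squarefree_b: "squarefree b"
begin

definition \<alpha> :: real where "\<alpha> = root 3 (real (a * b\<^sup>2))"
text \<open>Taken as third basis element instead of the square of \<open>\<alpha>\<close>, which is
  \<open>b * \<beta>\<close>: with \<open>\<beta>\<close> the lattice has index 1 or 3 in the ring
  of integers, and swapping \<open>a\<close> and \<open>b\<close> swaps the two roots.\<close>

definition \<beta> :: real where "\<beta> = root 3 (real (a\<^sup>2 * b))"

abbreviation K :: "real set" where "K \<equiv> Q_adjoin \<alpha>"

lemma a_pos: "0 < a" using b_pos b_less_a by simp

lemma params_nonzero [simp]: "a \<noteq> 0" "b \<noteq> 0" using a_pos b_pos by auto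

lemma alpha_cube: "\<alpha> ^ 3 = real a * real b ^ 2"
  by (simp add: \<alpha>_def)

lemma beta_cube: "\<beta> ^ 3 = real a ^ 2 * real b"
  by (simp add: \<beta>_def)

lemma alpha_beta: "\<alpha> * \<beta> = real a * real b"
proof -
  have "\<alpha> * \<beta> = root 3 ((real a * real b) ^ 3)"
    unfolding \<alpha>_def \<beta>_def real_root_mult[symmetric]
    by (intro arg_cong[where f = "root 3"]) (simp add: power2_eq_square power3_eq_cube)
  thus ?thesis by (simp add: real_root_power_cancel)
qed

lemma alpha_nz: "\<alpha> \<noteq> 0" and beta_nz: "\<beta> \<noteq> 0"
  using alpha_beta by auto

lemma alpha_sq: "\<alpha>\<^sup>2 = real b * \<beta>"
proof -
  have "\<alpha> * \<alpha>\<^sup>2 = \<alpha> * (real b * \<beta>)"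
    using alpha_cube alpha_beta by (simp add: power2_eq_square power3_eq_cube algebra_simps)
  thus ?thesis using alpha_nz by simp
qed

lemma beta_sq: "\<beta>\<^sup>2 = real a * \<alpha>"
proof -
  have "\<beta> * \<beta>\<^sup>2 = \<beta> * (real a * \<alpha>)"
    using beta_cube alpha_beta by (simp add: power2_eq_square power3_eq_cube algebra_simps)
  thus ?thesis using beta_nz by simp
qed

text \<open>A cube has the decomposition (1,1), and \<open>b < a\<close> excludes
  \<open>a = b = 1\<close>.\<close>

lemma not_cube:
  fixes u v :: nat
  assumes "v > 0" "u > 0" shows "a * b\<^sup>2 * u ^ 3 \<noteq> v ^ 3"
  using cubefree_decomp_unique[of a b 1 1 u v] assms coprime squarefree_a squarefree_b b_less_a b_pos
  by auto

lemma alpha_irrational: "\<alpha> \<notin> \<rat>"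
proof
  assume "\<alpha> \<in> \<rat>"
  moreover have "algebraic_int \<alpha>" unfolding \<alpha>_def by (intro algebraic_int_nth_root_real) auto
  ultimately have "\<alpha> \<in> \<int>" by (intro rational_algebraic_int_is_int)
  moreover have "\<alpha> > 0" unfolding \<alpha>_def using a_pos b_pos by simp
  ultimately obtain n :: nat where n: "\<alpha> = real n" "n > 0"
    by (metis Ints_cases of_int_0_less_iff of_nat_nat order_less_imp_le zero_less_nat_eq of_int_of_nat_eq)
  have "real (n ^ 3) = real (a * b\<^sup>2 * 1 ^ 3)" using alpha_cube n by simp
  hence "n ^ 3 = a * b\<^sup>2 * 1 ^ 3" by (simp only: of_nat_eq_iff)
  thus False using not_cube[of n 1] n by simp
qed

text \<open>A solution with \<open>z \<noteq> 0\<close> would give the rational value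
  \<open>b y / z\<close> for \<open>\<alpha>\<close>. Linear independence, nonvanishing of norms and
  the classification of elements with rational cube all reduce to this equation.\<close>

lemma rat_cubes:
  fixes y z :: rat
  assumes "of_nat a * z ^ 3 = of_nat b * y ^ 3"
  shows "y = 0" "z = 0"
proof -
  show "z = 0"
  proof (rule ccontr)
    assume z: "z \<noteq> 0"
    have "real_of_rat (of_nat a * z ^ 3) = real_of_rat (of_nat b * y ^ 3)" using assms by simp
    hence *: "real a * of_rat z ^ 3 = real b * of_rat y ^ 3"
      by (simp add: of_rat_mult of_rat_power)
    have "\<alpha> ^ 3 = (real b * of_rat y / of_rat z) ^ 3"
      using z alpha_cube * by (simp add: field_simps power2_eq_square power3_eq_cube)
    hence "\<alpha> = real b * of_rat y / of_rat z" by (metis odd_numeral odd_real_root_power_cancel)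
    thus False using alpha_irrational by simp
  qed
  thus "y = 0" using assms by simp
qed

definition el :: "rat \<Rightarrow> rat \<Rightarrow> rat \<Rightarrow> real" where
  "el x y z = of_rat x + of_rat y * \<alpha> + of_rat z * \<beta>"

lemma el_add: "el x y z + el x' y' z' = el (x + x') (y + y') (z + z')"
  by (simp add: el_def of_rat_add algebra_simps)

lemma el_uminus: "- el x y z = el (- x) (- y) (- z)"
  by (simp add: el_def of_rat_minus algebra_simps)

lemma el_mult: "el x y z * el x' y' z' =
  el (x * x' + of_nat (a * b) * (y * z' + z * y')) (x * y' + y * x' + of_nat a * z * z')
    (x * z' + z * x' + of_nat b * y * y')"
  using pure_cubic_mult[OF alpha_beta alpha_sq beta_sq, of 1 "of_rat x" "of_rat y" "of_rat z" "of_rat x'" "of_rat y'" "of_rat z'"]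
  by (simp add: el_def of_rat_add of_rat_mult)

lemma el_eq_0:
  assumes "el x y z = 0" shows "x = 0 \<and> y = 0 \<and> z = 0"
proof -
  have rat: "s = 0" if "of_rat r + of_rat s * \<alpha> = 0" for r s
  proof (rule ccontr)
    assume "s \<noteq> 0"
    hence "\<alpha> = - of_rat r / of_rat s" using that by (simp add: field_simps)
    thus False using alpha_irrational by simp
  qed
  have z: "z = 0"
  proof (rule ccontr)
    assume z: "z \<noteq> 0"
    \<comment> \<open>Multiplying the relation by \<open>z * \<alpha>\<close> and subtracting
      \<open>b * y\<close> times it cancels \<open>\<beta>\<close>; irrationality of
      \<open>\<alpha>\<close> then makes both remaining coefficients vanish, which leads to
      \<open>a z^3 = b y^3\<close>.\<close>
    have "of_rat z * (of_rat x * \<alpha> + of_rat y * (real b * \<beta>) + of_rat z * (real a * real b))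
      - of_rat y * real b * (of_rat x + of_rat y * \<alpha> + of_rat z * \<beta>)
      = of_rat z * \<alpha> * el x y z - of_rat y * real b * el x y z"
      unfolding alpha_sq[symmetric] alpha_beta[symmetric] el_def
      by (simp add: algebra_simps power2_eq_square)
    also have "\<dots> = 0" using assms by simp
    finally have "of_rat (z\<^sup>2 * of_nat a * of_nat b - x * y * of_nat b)
      + of_rat (x * z - of_nat b * y\<^sup>2) * \<alpha> = 0"
      by (simp add: of_rat_diff of_rat_mult of_rat_power algebra_simps power2_eq_square)
    moreover from rat[OF this] have 1: "x * z = of_nat b * y\<^sup>2" by simp
    ultimately have "z\<^sup>2 * of_nat a * of_nat b = x * y * of_nat b" by simp
    hence 2: "of_nat a * z\<^sup>2 = x * y" by (simp add: mult.commute)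
    have "of_nat a * z ^ 3 = x * z * y" using 2 by (simp add: power2_eq_square power3_eq_cube mult_ac)
    also have "\<dots> = of_nat b * y ^ 3" unfolding 1 by (simp add: power2_eq_square power3_eq_cube)
    finally show False using rat_cubes z by blast
  qed
  with assms rat[of x y] have y: "y = 0" by (simp add: el_def)
  with z assms show ?thesis by (simp add: el_def)
qed

lemma el_eq_iff [simp]: "el x y z = el x' y' z' \<longleftrightarrow> x = x' \<and> y = y' \<and> z = z'"
proof
  assume "el x y z = el x' y' z'"
  hence "el (x + - x') (y + - y') (z + - z') = 0"
    unfolding el_add[symmetric] el_uminus[symmetric] by simp
  thus "x = x' \<and> y = y' \<and> z = z'" by (auto dest: el_eq_0)
qed auto

lemma el_inverse:
  assumes "el x y z \<noteq> 0" obtains x' y' z' where "inverse (el x y z) = el x' y' z'"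
proof -
  \<comment> \<open>These are the coordinates of the product of the two other conjugates, and
    \<open>N\<close> is the norm.\<close>
  define x' y' z' where "x' = x\<^sup>2 - of_nat (a * b) * y * z" and "y' = of_nat a * z\<^sup>2 - x * y"
    and "z' = of_nat b * y\<^sup>2 - x * z"
  define N where "N = x ^ 3 + of_nat a * of_nat b ^ 2 * y ^ 3 + of_nat a ^ 2 * of_nat b * z ^ 3
      - 3 * of_nat a * of_nat b * x * y * z"
  have "el x y z * el x' y' z' = el N 0 0"
    unfolding el_mult el_eq_iff
    by (simp add: x'_def y'_def z'_def N_def algebra_simps power2_eq_square power3_eq_cube)
  hence N: "el x y z * el x' y' z' = of_rat N" by (simp add: el_def)
  have "N \<noteq> 0"
  proof
    assume "N = 0"
    hence "el x' y' z' = 0" using N assms by simp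
    hence 0: "x\<^sup>2 = of_nat (a * b) * y * z" "of_nat a * z\<^sup>2 = x * y" "of_nat b * y\<^sup>2 = x * z"
      using el_eq_0[of x' y' z'] by (auto simp: x'_def y'_def z'_def)
    have "of_nat a * z ^ 3 = (of_nat a * z\<^sup>2) * z" by (simp add: power2_eq_square power3_eq_cube)
    also have "\<dots> = x * z * y" unfolding 0 by simp
    also have "\<dots> = of_nat b * y ^ 3" unfolding 0(3)[symmetric] by (simp add: power2_eq_square power3_eq_cube)
    finally have "y = 0" "z = 0" using rat_cubes by blast+
    with 0 have "x = 0" by simp
    with \<open>y = 0\<close> \<open>z = 0\<close> assms show False by (simp add: el_def)
  qed
  have "inverse (el x y z) = el x' y' z' * of_rat (inverse N)"
    using N assms \<open>N \<noteq> 0\<close> by (simp add: inverse_eq_divide of_rat_divide field_simps)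
  also have "\<dots> = el (x' / N) (y' / N) (z' / N)"
    by (simp add: el_def of_rat_divide of_rat_inverse of_rat_mult divide_inverse algebra_simps)
  finally show thesis by (rule that)
qed

lemma alpha_in_K: "\<alpha> \<in> K" by (rule Q_adjoin_self)

lemma beta_in_K: "\<beta> \<in> K"
proof -
  have "\<beta> = of_rat (inverse (of_nat b)) * (\<alpha> * \<alpha>)"
    using alpha_sq by (simp add: of_rat_inverse power2_eq_square)
  thus ?thesis by (metis Q_adjoin_mult Q_adjoin_of_rat Q_adjoin_self)
qed

lemma el_in_K: "el x y z \<in> K"
  unfolding el_def by (intro Q_adjoin_add Q_adjoin_mult Q_adjoin_of_rat alpha_in_K beta_in_K)

lemma K_eq: "K = {el x y z | x y z. True}"
proof
  show "K \<subseteq> {el x y z | x y z. True}"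
  proof (rule Q_adjoin_least)
    show "\<alpha> \<in> {el x y z |x y z. True}"
      by (rule CollectI, rule exI[of _ 0], rule exI[of _ 1], rule exI[of _ 0]) (simp add: el_def)
    show "1 \<in> {el x y z |x y z. True}"
      by (rule CollectI, rule exI[of _ 1], rule exI[of _ 0], rule exI[of _ 0]) (simp add: el_def)
  next
    fix t assume "t \<in> {el x y z |x y z. True}" "t \<noteq> 0"
    thus "inverse t \<in> {el x y z |x y z. True}" using el_inverse by blast
  qed (use el_add el_mult el_uminus in blast)+
qed (use el_in_K in auto)

lemma K_cases:
  assumes "t \<in> K" obtains x y z where "t = el x y z"
  using assms K_eq by auto

text \<open>The coefficients of \<open>\<alpha>\<close> and \<open>\<beta>\<close> in the cube
  vanish, and eliminating between them gives \<open>x (a z^3 - b y^3) = 0\<close>. So the only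
  elements with rational cube are rational multiples of 1, \<open>\<alpha>\<close> and
  \<open>\<beta>\<close>, which pins down the parameters.\<close>

lemma rational_cube:
  assumes "el x y z ^ 3 \<in> \<rat>"
  shows "y = 0 \<and> z = 0 \<or> x = 0 \<and> z = 0 \<or> x = 0 \<and> y = 0"
proof -
  obtain q where "el x y z ^ 3 = of_rat q" using assms by (auto elim: Rats_cases)
  hence "el x y z * el x y z * el x y z = el q 0 0" by (simp add: power3_eq_cube el_def)
  hence 1: "x\<^sup>2 * y + of_nat (a * b) * y\<^sup>2 * z + of_nat a * x * z\<^sup>2 = 0"
    and 2: "x\<^sup>2 * z + of_nat b * x * y\<^sup>2 + of_nat (a * b) * y * z\<^sup>2 = 0"
    unfolding el_mult el_eq_iff by (simp_all add: algebra_simps power2_eq_square)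
  have "x * (of_nat a * z ^ 3 - of_nat b * y ^ 3)
     = (x\<^sup>2 * y + of_nat (a * b) * y\<^sup>2 * z + of_nat a * x * z\<^sup>2) * z
     - (x\<^sup>2 * z + of_nat b * x * y\<^sup>2 + of_nat (a * b) * y * z\<^sup>2) * y"
    by (simp add: algebra_simps power2_eq_square power3_eq_cube)
  also have "\<dots> = 0" unfolding 1 2 by simp
  finally have "x = 0 \<or> of_nat a * z ^ 3 = of_nat b * y ^ 3" by simp
  thus ?thesis
  proof
    assume "x = 0"
    with 1 show ?thesis by auto
  qed (use rat_cubes in blast)
qed

end

section \<open>Homomorphisms, complex embeddings and the trace\<close>

lemma ring_hom_as_field:
  "h \<in> Ring.ring_hom (as_field S) (as_field U) \<Longrightarrow> h \<in> Ring.ring_hom (as_field S) real_ring"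
  by (auto simp: Ring.ring_hom_def)

lemma as_field_iso_refl: "as_field S \<simeq> as_field S"
proof -
  have "id \<in> ring_iso (as_field S) (as_field S)"
    by (auto simp: ring_iso_def Ring.ring_hom_def)
  thus ?thesis unfolding is_ring_iso_def by blast
qed

definition primitive_cube_root :: complex where
  "primitive_cube_root = Complex (- 1 / 2) (sqrt 3 / 2)"

lemma cube_root_sum: "1 + primitive_cube_root + primitive_cube_root\<^sup>2 = 0"
  by (simp add: primitive_cube_root_def complex_eq_iff power2_eq_square Re_divide)

lemma cube_root_cubed: "primitive_cube_root ^ 3 = 1"
proof -
  have "primitive_cube_root ^ 3 - 1 =
      (primitive_cube_root - 1) * (1 + primitive_cube_root + primitive_cube_root\<^sup>2)"
    by (simp add: algebra_simps power2_eq_square power3_eq_cube)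
  thus ?thesis by (simp add: cube_root_sum)
qed

lemma cube_roots_distinct:
  "primitive_cube_root \<noteq> 1" "primitive_cube_root\<^sup>2 \<noteq> 1" "primitive_cube_root\<^sup>2 \<noteq> primitive_cube_root"
  by (auto simp: primitive_cube_root_def complex_eq_iff power2_eq_square)

definition cube_roots_of_unity :: "complex set" where
  "cube_roots_of_unity = {1, primitive_cube_root, primitive_cube_root\<^sup>2}"

lemma cube_roots_of_unity_iff: "\<omega> \<in> cube_roots_of_unity \<longleftrightarrow> \<omega> ^ 3 = 1"
proof -
  define w where "w = primitive_cube_root"
  have s: "w\<^sup>2 = - 1 - w" using cube_root_sum by (simp add: w_def eq_neg_iff_add_eq_0 algebra_simps)
  have s3: "w ^ 3 = 1" using cube_root_cubed by (simp add: w_def)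
  have "(\<omega> - 1) * (\<omega> - w) * (\<omega> - w\<^sup>2) = \<omega> ^ 3 - (1 + w + w\<^sup>2) * \<omega>\<^sup>2 + (w + w\<^sup>2 + w ^ 3) * \<omega> - w ^ 3"
    by (simp add: algebra_simps power2_eq_square power3_eq_cube)
  also have "\<dots> = \<omega> ^ 3 - 1" unfolding s s3 by simp
  finally have "\<omega> ^ 3 = 1 \<longleftrightarrow> (\<omega> - 1) * (\<omega> - w) * (\<omega> - w\<^sup>2) = 0" by simp
  thus ?thesis by (auto simp: cube_roots_of_unity_def w_def)
qed

lemma sum_cube_roots_of_unity:
  "(\<Sum>\<omega>\<in>cube_roots_of_unity. f \<omega>) = f 1 + f primitive_cube_root + f (primitive_cube_root\<^sup>2)"
  using cube_roots_distinct by (simp add: cube_roots_of_unity_def add.assoc)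

context cubic_pair
begin

definition coords :: "real \<Rightarrow> rat \<times> rat \<times> rat" where
  "coords t = (THE (x, y, z). t = el x y z)"

lemma coords_el [simp]: "coords (el x y z) = (x, y, z)"
  unfolding coords_def by (rule the_equality) auto

definition conj_el :: "complex \<Rightarrow> rat \<Rightarrow> rat \<Rightarrow> rat \<Rightarrow> complex" where
  "conj_el \<omega> x y z = of_rat x + \<omega> * of_rat y * of_real \<alpha> + \<omega>\<^sup>2 * of_rat z * of_real \<beta>"

text \<open>Restriction to \<open>K\<close> makes the map extensional, as \<open>embeddings\<close>
  demands.\<close>

definition conjugate :: "complex \<Rightarrow> real \<Rightarrow> complex" where
  "conjugate \<omega> = restrict (\<lambda>t. case coords t of (x, y, z) \<Rightarrow> conj_el \<omega> x y z) K"

lemma conjugate_el [simp]: "conjugate \<omega> (el x y z) = conj_el \<omega> x y z"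
  using el_in_K by (simp add: conjugate_def)

lemma conj_el_add: "conj_el \<omega> x y z + conj_el \<omega> x' y' z' = conj_el \<omega> (x + x') (y + y') (z + z')"
  by (simp add: conj_el_def of_rat_add algebra_simps)

lemma conj_el_mult:
  assumes "\<omega> ^ 3 = 1"
  shows "conj_el \<omega> x y z * conj_el \<omega> x' y' z' =
  conj_el \<omega> (x * x' + of_nat (a * b) * (y * z' + z * y')) (x * y' + y * x' + of_nat a * z * z')
    (x * z' + z * x' + of_nat b * y * y')"
proof -
  have "complex_of_real \<alpha> * of_real \<beta> = of_nat a * of_nat b" "(complex_of_real \<alpha>)\<^sup>2 = of_nat b * of_real \<beta>"
    "(complex_of_real \<beta>)\<^sup>2 = of_nat a * of_real \<alpha>"
    using arg_cong[OF alpha_beta, of complex_of_real] arg_cong[OF alpha_sq, of complex_of_real]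
      arg_cong[OF beta_sq, of complex_of_real] by simp_all
  from pure_cubic_mult[OF this assms, of "of_rat x" "of_rat y" "of_rat z" "of_rat x'" "of_rat y'" "of_rat z'"]
  show ?thesis by (simp add: conj_el_def of_rat_add of_rat_mult)
qed

lemma conjugate_ring_hom:
  assumes "\<omega> ^ 3 = 1"
  shows "conjugate \<omega> \<in> Ring.ring_hom (as_field K) complex_ring"
proof (rule ring_hom_memI)
  fix s t assume "s \<in> carrier (as_field K)" "t \<in> carrier (as_field K)"
  then obtain x y z x' y' z' where st: "s = el x y z" "t = el x' y' z'" using K_cases by simp metis
  show "conjugate \<omega> (s \<otimes>\<^bsub>as_field K\<^esub> t) = conjugate \<omega> s \<otimes>\<^bsub>complex_ring\<^esub> conjugate \<omega> t"
    using assms by (simp add: st el_mult conj_el_mult)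
  show "conjugate \<omega> (s \<oplus>\<^bsub>as_field K\<^esub> t) = conjugate \<omega> s \<oplus>\<^bsub>complex_ring\<^esub> conjugate \<omega> t"
    by (simp add: st el_add conj_el_add)
next
  have "conjugate \<omega> (el 1 0 0) = 1" by (simp add: conj_el_def)
  thus "conjugate \<omega> \<one>\<^bsub>as_field K\<^esub> = \<one>\<^bsub>complex_ring\<^esub>" by (simp add: el_def)
qed simp

text \<open>A homomorphism fixes the rationals and preserves \<open>\<alpha>^3 = a b^2\<close> and
  \<open>\<alpha>^2 = b \<beta>\<close>, so its value at \<open>\<alpha>\<close> determines
  it.\<close>

lemma ring_hom_el:
  fixes h :: "real \<Rightarrow> 'a :: field_char_0"
  assumes h: "h \<in> Ring.ring_hom (as_field K) ring_of_type_algebra"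
  shows "h (el x y z) = of_rat x + of_rat y * h \<alpha> + of_rat z * h \<beta>"
    and "h \<alpha> ^ 3 = of_nat (a * b\<^sup>2)" and "h \<alpha> ^ 2 = of_nat b * h \<beta>"
proof -
  have add: "h (x + y) = h x + h y" if "x \<in> K" "y \<in> K" for x y
    using ring_hom_add[OF h] that by simp
  have mult: "h (x * y) = h x * h y" if "x \<in> K" "y \<in> K" for x y
    using ring_hom_mult[OF h] that by simp
  note r = ring_hom_of_rat[OF h]
  note c = Q_adjoin_of_rat Q_adjoin_mult Q_adjoin_add alpha_in_K beta_in_K
  show "h (el x y z) = of_rat x + of_rat y * h \<alpha> + of_rat z * h \<beta>"
    unfolding el_def by (simp add: add mult c r)
  have "h \<alpha> ^ 3 = h (\<alpha> * (\<alpha> * \<alpha>))" by (simp add: mult c power3_eq_cube)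
  also have "\<alpha> * (\<alpha> * \<alpha>) = of_rat (of_nat (a * b\<^sup>2))" using alpha_cube by (simp add: power3_eq_cube of_rat_mult of_rat_power mult.assoc)
  finally show "h \<alpha> ^ 3 = of_nat (a * b\<^sup>2)" unfolding r by (simp only: of_rat_of_nat_eq)
  have "h \<alpha> ^ 2 = h (\<alpha> * \<alpha>)" by (simp add: mult c power2_eq_square)
  also have "\<alpha> * \<alpha> = of_rat (of_nat b) * \<beta>" using alpha_sq by (simp add: power2_eq_square)
  also have "h \<dots> = h (of_rat (of_nat b)) * h \<beta>" by (rule mult) (rule c)+
  finally show "h \<alpha> ^ 2 = of_nat b * h \<beta>" unfolding r by simp
qed

text \<open>An embedding sends \<open>\<alpha>\<close> to a number with the same cube; the quotient
  is a cube root of unity, and \<open>\<alpha>^2 = b \<beta>\<close> makes its square the factor at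
  \<open>\<beta>\<close>.\<close>

lemma embeddings_eq: "embeddings K = conjugate ` cube_roots_of_unity"
proof (intro equalityI subsetI)
  fix h assume "h \<in> embeddings K"
  hence h: "h \<in> Ring.ring_hom (as_field K) complex_ring" and ext: "h \<in> extensional K"
    by (auto simp: embeddings_def)
  define \<omega> where "\<omega> = h \<alpha> / of_real \<alpha>"
  have nz: "complex_of_real \<alpha> \<noteq> 0" using alpha_nz by simp
  have 1: "h \<alpha> = \<omega> * of_real \<alpha>" using nz by (simp add: \<omega>_def)
  have "h \<alpha> ^ 3 = of_real (\<alpha> ^ 3)" unfolding ring_hom_el(2)[OF h] alpha_cube by simp
  hence "\<omega> ^ 3 = 1" using nz by (simp add: \<omega>_def power_divide)
  have "of_nat b * h \<beta> = \<omega>\<^sup>2 * of_real (\<alpha>\<^sup>2)"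
    using ring_hom_el(3)[OF h] by (simp add: 1 power_mult_distrib)
  hence 2: "h \<beta> = \<omega>\<^sup>2 * of_real \<beta>" unfolding alpha_sq by simp
  have "h = conjugate \<omega>"
  proof (rule extensionalityI[OF ext])
    show "conjugate \<omega> \<in> extensional K" by (simp add: conjugate_def)
    fix t assume "t \<in> K"
    then obtain x y z where t: "t = el x y z" by (rule K_cases)
    show "h t = conjugate \<omega> t" unfolding t ring_hom_el(1)[OF h] by (simp add: conj_el_def 1 2)
  qed
  with \<open>\<omega> ^ 3 = 1\<close> show "h \<in> conjugate ` cube_roots_of_unity" by (auto simp: cube_roots_of_unity_iff)
next
  fix h assume "h \<in> conjugate ` cube_roots_of_unity"
  then obtain \<omega> where "h = conjugate \<omega>" "\<omega> ^ 3 = 1" by (auto simp: cube_roots_of_unity_iff)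
  thus "h \<in> embeddings K" using conjugate_ring_hom by (auto simp: embeddings_def conjugate_def)
qed

lemma inj_conjugate: "inj conjugate"
proof
  fix \<omega> \<omega>' assume "conjugate \<omega> = conjugate \<omega>'"
  hence "conjugate \<omega> (el 0 1 0) = conjugate \<omega>' (el 0 1 0)" by simp
  thus "\<omega> = \<omega>'" using alpha_nz by (simp add: conj_el_def)
qed

text \<open>The irrational coordinates cancel because the three cube roots of unity, and likewise
  their squares, sum to zero.\<close>

lemma field_trace_el: "field_trace K (el x y z) = of_rat (3 * x)"
proof -
  define w where "w = primitive_cube_root"
  have w3: "w ^ 3 = 1" "1 + w + w\<^sup>2 = 0" unfolding w_def by (rule cube_root_cubed cube_root_sum)+
  have w4: "(w\<^sup>2)\<^sup>2 = w" using w3(1) by (simp add: power2_eq_square power3_eq_cube mult.assoc)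
  have "field_trace K (el x y z) = (\<Sum>\<omega>\<in>cube_roots_of_unity. conj_el \<omega> x y z)"
    unfolding field_trace_def embeddings_eq
    by (subst sum.reindex) (auto intro: inj_on_subset[OF inj_conjugate])
  also have "\<dots> = 3 * of_rat x + (1 + w + w\<^sup>2) * (of_rat y * of_real \<alpha>) + (1 + w\<^sup>2 + (w\<^sup>2)\<^sup>2) * (of_rat z * of_real \<beta>)"
    unfolding sum_cube_roots_of_unity conj_el_def w_def[symmetric] by (simp add: algebra_simps)
  also have "1 + w\<^sup>2 + (w\<^sup>2)\<^sup>2 = 0" unfolding w4 using w3(2) by (simp add: algebra_simps)
  finally show ?thesis using w3(2) by (simp add: of_rat_mult)
qed

text \<open>An embedding fixes the integers, hence commutes with evaluating an integer polynomial,
  and the same monic polynomial annihilates the conjugate.\<close>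

lemma algebraic_int_conjugate:
  assumes "algebraic_int t" "t \<in> K" "\<omega> ^ 3 = 1"
  shows "algebraic_int (conjugate \<omega> t)"
proof -
  note h = conjugate_ring_hom[OF assms(3)]
  have add: "conjugate \<omega> (x + y) = conjugate \<omega> x + conjugate \<omega> y" if "x \<in> K" "y \<in> K" for x y
    using ring_hom_add[OF h] that by simp
  have mult: "conjugate \<omega> (x * y) = conjugate \<omega> x * conjugate \<omega> y" if "x \<in> K" "y \<in> K" for x y
    using ring_hom_mult[OF h] that by simp
  have int: "conjugate \<omega> (of_int k) = of_int k" "of_int k \<in> K" for k
    using ring_hom_of_rat[OF h, of "of_int k"] Q_adjoin_of_rat[of "of_int k"] by simp_all
  obtain p where p: "poly (map_poly of_int p) t = 0" "Polynomial.lead_coeff p = 1"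
    using assms(1) unfolding algebraic_int_altdef_ipoly by blast
  have "poly (map_poly of_int q) t \<in> K \<and>
      conjugate \<omega> (poly (map_poly of_int q) t) = poly (map_poly of_int q) (conjugate \<omega> t)" for q :: "int poly"
  proof (induction q)
    case 0
    show ?case using int[of 0] by simp
  next
    case (pCons k q)
    thus ?case using assms(2) int[of k] by (simp add: map_poly_pCons add mult Q_adjoin_add Q_adjoin_mult)
  qed
  from this[of p] have "poly (map_poly of_int p) (conjugate \<omega> t) = 0" using p(1) int[of 0] by simp
  with p(2) show ?thesis unfolding algebraic_int_altdef_ipoly by blast
qed

section \<open>Uniqueness of the parameters and isomorphism classes\<close>

text \<open>The root has a rational cube, so it is a rational multiple of 1, \<open>\<alpha>\<close>
  or \<open>\<beta>\<close>. The first is excluded by irrationality, the second gives the same pair,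
  the third the swapped pair, which \<open>b < a\<close> and \<open>d < c\<close> exclude.\<close>

lemma param_unique_aux:
  assumes "cubic_pair c d" and root_in: "root 3 (real (c * d\<^sup>2)) \<in> K"
  shows "a = c \<and> b = d"
proof -
  interpret L: cubic_pair c d by fact
  obtain x y z where xyz: "L.\<alpha> = el x y z" using root_in K_cases unfolding L.\<alpha>_def by metis
  have cube: "el x y z ^ 3 = real (c * d\<^sup>2)" unfolding xyz[symmetric] L.alpha_cube by simp
  have pos: "L.\<alpha> > 0" unfolding L.\<alpha>_def using L.a_pos L.b_pos by simp
  \<comment> \<open>Clears the denominator of \<open>q\<close>, giving an equation between natural
    numbers to which uniqueness of the cubefree decomposition applies.\<close>
  have scaled: "\<exists>u v :: nat. u > 0 \<and> v > 0 \<and> e * u ^ 3 = c * d\<^sup>2 * v ^ 3"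
    if q: "real (c * d\<^sup>2) = real e * real_of_rat q ^ 3" "e > 0" for e q
  proof -
    have "real (c * d\<^sup>2) > 0" using L.a_pos L.b_pos by simp
    hence "real_of_rat q ^ 3 > 0" unfolding q(1) by (rule zero_less_mult_pos) (use q(2) in simp)
    hence "q > 0" by (simp add: zero_less_power_eq)
    then obtain u v where uv: "q = of_int u / of_int v" "v > 0"
      by (cases q) (auto simp: Fract_of_int_quotient)
    with \<open>q > 0\<close> have "u > 0" by (simp add: zero_less_divide_iff)
    have "real (c * d\<^sup>2) * of_int v ^ 3 = real e * of_int u ^ 3"
      using uv(2) unfolding q(1) uv(1) by (simp add: of_rat_divide field_simps)
    hence "real (c * d\<^sup>2 * nat v ^ 3) = real (e * nat u ^ 3)" using uv(2) \<open>u > 0\<close> by simp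
    hence "e * nat u ^ 3 = c * d\<^sup>2 * nat v ^ 3" by (simp only: of_nat_eq_iff)
    thus ?thesis using uv(2) \<open>u > 0\<close> by (intro exI[of _ "nat u"] exI[of _ "nat v"]) simp
  qed
  have "el x y z ^ 3 \<in> \<rat>" unfolding cube by simp
  then consider "y = 0" "z = 0" | "x = 0" "z = 0" | "x = 0" "y = 0" using rational_cube by blast
  thus ?thesis
  proof cases
    case 1
    hence "L.\<alpha> \<in> \<rat>" unfolding xyz by (simp add: el_def)
    thus ?thesis using L.alpha_irrational by simp
  next
    case 2
    hence "real (c * d\<^sup>2) = real (a * b\<^sup>2) * of_rat y ^ 3"
      using cube alpha_cube by (simp add: el_def power_mult_distrib mult_ac)
    then obtain u v where "u > 0" "v > 0" "a * b\<^sup>2 * u ^ 3 = c * d\<^sup>2 * v ^ 3"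
      using scaled[of "a * b\<^sup>2" y] a_pos b_pos by auto
    thus ?thesis using cubefree_decomp_unique coprime squarefree_a squarefree_b
        L.coprime L.squarefree_a L.squarefree_b by blast
  next
    case 3
    hence "real (c * d\<^sup>2) = real (b * a\<^sup>2) * of_rat z ^ 3"
      using cube beta_cube by (simp add: el_def power_mult_distrib mult_ac)
    then obtain u v where "u > 0" "v > 0" "b * a\<^sup>2 * u ^ 3 = c * d\<^sup>2 * v ^ 3"
      using scaled[of "b * a\<^sup>2" z] a_pos b_pos by auto
    hence "b = c \<and> a = d" using cubefree_decomp_unique coprime squarefree_a squarefree_b
        L.coprime L.squarefree_a L.squarefree_b by (metis coprime_commute)
    thus ?thesis using b_less_a L.b_less_a by simp
  qed
qed

text \<open>The image of \<open>\<alpha>\<close> is a real number with the same cube, hence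
  \<open>\<alpha>\<close> itself, which therefore lies in the other field.\<close>

lemma iso_imp_eq:
  assumes "cubic_pair c d" and iso: "as_field K \<simeq> as_field (Q_adjoin (root 3 (real (c * d\<^sup>2))))"
  shows "a = c \<and> b = d"
proof -
  interpret L: cubic_pair c d by fact
  obtain h where "h \<in> Ring.ring_hom (as_field K) (as_field L.K)"
    using iso unfolding is_ring_iso_def ring_iso_def L.\<alpha>_def by blast
  hence h: "h \<in> Ring.ring_hom (as_field K) real_ring" and "h \<alpha> \<in> L.K"
    using alpha_in_K ring_hom_as_field ring_hom_memE(1) by force+
  have "h \<alpha> ^ 3 = \<alpha> ^ 3" unfolding ring_hom_el(2)[OF h] alpha_cube by simp
  hence "h \<alpha> = \<alpha>" by (metis odd_numeral odd_real_root_power_cancel)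
  with \<open>h \<alpha> \<in> L.K\<close> have "root 3 (real (a * b\<^sup>2)) \<in> L.K" by (simp add: \<alpha>_def)
  thus ?thesis using L.param_unique_aux[OF cubic_pair_axioms] by simp
qed

end

text \<open>Each of the two roots is the square of the other up to a rational factor. This allows
  the larger parameter to be put in front.\<close>

lemma Q_adjoin_swap:
  assumes "a > 0" "b > 0"
  shows "Q_adjoin (root 3 (real (a\<^sup>2 * b))) = Q_adjoin (root 3 (real (a * b\<^sup>2)))"
proof -
  have *: "Q_adjoin (root 3 (real (d\<^sup>2 * c))) \<subseteq> Q_adjoin (root 3 (real (d * c\<^sup>2)))"
    if "c > 0" "d > 0" for c d :: nat
  proof (rule Q_adjoin_subset)
    have "root 3 (real (d * c\<^sup>2)) ^ 2 = root 3 (real (d\<^sup>2 * c) * real c ^ 3)"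
      by (simp add: power2_eq_square power3_eq_cube mult_ac flip: real_root_mult)
    also have "\<dots> = root 3 (real (d\<^sup>2 * c)) * real c"
      unfolding real_root_mult by (simp add: real_root_power_cancel)
    finally have "root 3 (real (d\<^sup>2 * c)) =
        root 3 (real (d * c\<^sup>2)) * root 3 (real (d * c\<^sup>2)) * of_rat (inverse (of_nat c))"
      using that by (simp add: of_rat_inverse power2_eq_square)
    thus "root 3 (real (d\<^sup>2 * c)) \<in> Q_adjoin (root 3 (real (d * c\<^sup>2)))"
      by (metis Q_adjoin_mult Q_adjoin_of_rat Q_adjoin_self)
  qed
  show ?thesis using *[of b a] *[of a b] assms by (simp add: mult.commute)
qed

lemma pure_cubic_fields_eq:
  "pure_cubic_fields = {Q_adjoin (root 3 (real (a * b\<^sup>2))) | a b. cubic_pair a b}"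
proof (intro equalityI subsetI)
  fix F assume "F \<in> pure_cubic_fields"
  then obtain m :: nat where m: "F = Q_adjoin (root 3 (real m))" "m > 0" "\<not> (\<exists>n. m = n ^ 3)"
    by (auto simp: pure_cubic_fields_def)
  obtain a b c where abc: "coprime a b" "squarefree a" "squarefree b" "c > 0" "m = a * b\<^sup>2 * c ^ 3"
    using cubefree_decomp_exists[OF m(2)] .
  have pos: "a > 0" "b > 0" using m(2) abc(5) by (auto intro: Nat.gr0I)
  have "root 3 (real m) = of_rat (of_nat c) * root 3 (real (a * b\<^sup>2))"
    by (simp add: abc(5) real_root_mult real_root_power_cancel)
  hence F: "F = Q_adjoin (root 3 (real (a * b\<^sup>2)))"
    using Q_adjoin_scale[of "of_nat c"] abc(4) m(1) by simp
  \<comment> \<open>Coprime and equal means that both are 1, and \<open>m\<close> would be a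
    cube.\<close>
  have "a \<noteq> b"
  proof
    assume "a = b"
    hence "m = c ^ 3" using abc(1,5) by simp
    with m(3) show False by blast
  qed
  then consider "b < a" | "a < b" by linarith
  thus "F \<in> {Q_adjoin (root 3 (real (a * b\<^sup>2))) | a b. cubic_pair a b}"
  proof cases
    case 1
    thus ?thesis using F abc pos by (auto simp: cubic_pair_def)
  next
    case 2
    hence "cubic_pair b a" using abc pos by (auto simp: cubic_pair_def coprime_commute)
    moreover have "F = Q_adjoin (root 3 (real (b * a\<^sup>2)))"
      using F Q_adjoin_swap[OF pos] by (simp add: mult.commute)
    ultimately show ?thesis by blast
  qed
next
  fix F assume "F \<in> {Q_adjoin (root 3 (real (a * b\<^sup>2))) | a b. cubic_pair a b}"
  then obtain a b where F: "F = Q_adjoin (root 3 (real (a * b\<^sup>2)))" and "cubic_pair a b" by auto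
  then interpret cubic_pair a b by simp
  have "a * b\<^sup>2 > 0" using a_pos b_pos by simp
  moreover have "a * b\<^sup>2 \<noteq> n ^ 3" for n
    using not_cube[of n 1] calculation by (cases "n = 0") auto
  ultimately show "F \<in> pure_cubic_fields" unfolding pure_cubic_fields_def F by blast
qed

context cubic_pair
begin

lemma pure_params_eq: "pure_params K = (a, b)"
  unfolding pure_params_def
proof (rule the_equality)
  show "case (a, b) of (a, b) \<Rightarrow> 0 < b \<and> b < a \<and> Rings.coprime a b \<and> squarefree a \<and> squarefree b \<and>
      K = Q_adjoin (root 3 (real (a * b\<^sup>2)))"
    using b_pos b_less_a coprime squarefree_a squarefree_b by (simp add: \<alpha>_def)
next
  fix p assume *: "case p of (a, b) \<Rightarrow> 0 < b \<and> b < a \<and> Rings.coprime a b \<and> squarefree a \<and> squarefree b \<and>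
      K = Q_adjoin (root 3 (real (a * b\<^sup>2)))"
  obtain c d where p: "p = (c, d)" by force
  with * have "cubic_pair c d" and "root 3 (real (c * d\<^sup>2)) \<in> K"
    using Q_adjoin_self by (auto simp: cubic_pair_def)
  thus "p = (a, b)" using param_unique_aux p by blast
qed

lemma radicand_eq: "radicand K = a * b\<^sup>2" and ratio_eq: "ratio K = of_nat a / of_nat b"
  by (simp_all add: radicand_def ratio_def pure_params_eq)

end

text \<open>Among these subfields of the reals isomorphic means equal, so sums over classes become
  sums over fields.\<close>

lemma field_iso_class:
  assumes "F \<in> pure_cubic_fields" shows "field_iso `` {F} = {F}"
proof -
  have "G = F" if G: "G \<in> pure_cubic_fields" "as_field F \<simeq> as_field G" for G
  proof -
    obtain a b where F: "F = Q_adjoin (root 3 (real (a * b\<^sup>2)))" and ab: "cubic_pair a b"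
      using assms unfolding pure_cubic_fields_eq by auto
    obtain c d where G': "G = Q_adjoin (root 3 (real (c * d\<^sup>2)))" and cd: "cubic_pair c d"
      using G unfolding pure_cubic_fields_eq by auto
    have "a = c \<and> b = d"
      using cubic_pair.iso_imp_eq[OF ab cd] G(2) unfolding F G' cubic_pair.\<alpha>_def[OF ab] by blast
    thus ?thesis by (simp add: F G')
  qed
  thus ?thesis using assms as_field_iso_refl by (auto simp: field_iso_def)
qed

lemma iso_classes_eq:
  "iso_classes t N = (\<lambda>F. {F}) ` {F \<in> pure_cubic_fields. type_of_field F = t \<and> \<bar>discriminant F\<bar> \<le> int N}"
  unfolding iso_classes_def quotient_def using field_iso_class by auto

section \<open>Rings of integers and discriminants\<close>

lemma det_3:
  fixes f :: "nat \<times> nat \<Rightarrow> 'a :: comm_ring_1"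
  shows "Determinant.det (Matrix.mat 3 3 f) =
    f (0,0) * (f (1,1) * f (2,2) - f (1,2) * f (2,1)) - f (0,1) * (f (1,0) * f (2,2) - f (1,2) * f (2,0))
    + f (0,2) * (f (1,0) * f (2,1) - f (1,1) * f (2,0))"
proof -
  have det2: "Determinant.det M = M $$ (0,0) * M $$ (1,1) - M $$ (0,1) * M $$ (1,0)"
    if "M \<in> carrier_mat 2 2" for M :: "'a mat"
    unfolding laplace_expansion_row[OF that, of 0, simplified]
    using that by (simp add: numeral_2_eq_2 cofactor_def mat_delete_def det_single algebra_simps)
  have "Matrix.mat 3 3 f \<in> carrier_mat 3 3" by simp
  note L = laplace_expansion_row[OF this, of 0, simplified]
  show ?thesis
    unfolding L by (simp add: numeral_3_eq_3 cofactor_def det2 mat_delete_def algebra_simps numeral_2_eq_2)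
qed

lemma rat_algebraic_int:
  assumes "algebraic_int (of_rat q :: 'a :: field_char_0)" shows "q \<in> \<int>"
proof -
  have "(of_rat q :: 'a) \<in> \<int>" using assms by (intro rational_algebraic_int_is_int) (simp_all add: Rats_def)
  then obtain k where "(of_rat q :: 'a) = of_int k" by (rule Ints_cases)
  hence "(of_rat q :: 'a) = of_rat (of_int k)" by simp
  hence "q = of_int k" by (simp only: of_rat_eq_iff)
  thus ?thesis by simp
qed

text \<open>The matrix \<open>A\<close> is invertible over the integers, so its determinant is 1 or
  -1, and it enters squared.\<close>

lemma det_gram_change:
  fixes G G' P :: "complex mat" and A B :: "int mat"
  assumes A: "A \<in> carrier_mat n n" and B: "B \<in> carrier_mat n n" and G: "G \<in> carrier_mat n n"
    and AB: "A * B = 1\<^sub>m n"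
    and G': "G' = map_mat of_int A * G * transpose_mat (map_mat of_int A)"
  shows "Determinant.det G' = Determinant.det G"
proof -
  have "Determinant.det A * Determinant.det B = 1" using det_mult[OF A B] AB by simp
  hence "Determinant.det A = 1 \<or> Determinant.det A = - 1" using zmult_eq_1_iff by auto
  hence sq: "Determinant.det A * Determinant.det A = 1" by auto
  have "Determinant.det G' = of_int (Determinant.det A * Determinant.det A) * Determinant.det G"
    using A G unfolding G'
    by (simp add: det_mult[of _ n] det_transpose[of _ n] of_int_hom.hom_det)
  thus ?thesis by (simp add: sq)
qed

section \<open>Congruences at 3 for the coordinates of an integer\<close>

lemma square_mod_3:
  fixes r :: int
  assumes "\<not> 3 dvd r" shows "\<exists>p. r\<^sup>2 = 1 + 3 * p"
proof -
  have "r mod 3 = 1 \<or> r mod 3 = 2" using assms by presburger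
  hence "r\<^sup>2 mod 3 = 1" by (auto simp: power2_eq_square mod_mult_eq[symmetric, of r])
  hence "r\<^sup>2 = 1 + 3 * (r\<^sup>2 div 3)" using div_mult_mod_eq[of "r\<^sup>2" 3] by linarith
  thus ?thesis ..
qed

text \<open>Here \<open>x\<close>, \<open>y\<close>, \<open>z\<close> are three times the
  coordinates of an algebraic integer; \<open>S\<close> and \<open>N\<close> say that its second
  symmetric function and its norm are integers. A denominator 3 survives only if
  \<open>a^2 \<equiv> b^2\<close> modulo 9, and then only in multiples of \<open>(1, a, b)\<close>
  modulo 3.\<close>

lemma cubic_congruences:
  fixes a b x y z :: int
  assumes "coprime a b" "squarefree a" "squarefree b"
    and S: "3 dvd x\<^sup>2 - a * b * y * z"
    and N: "27 dvd x ^ 3 + a * b\<^sup>2 * y ^ 3 + a\<^sup>2 * b * z ^ 3 - 3 * a * b * x * y * z"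
  shows "3 dvd x \<and> 3 dvd y \<and> 3 dvd z \<or>
    \<not> 3 dvd a \<and> \<not> 3 dvd b \<and> 9 dvd a\<^sup>2 - b\<^sup>2 \<and> 3 dvd y - a * x \<and> 3 dvd z - b * x"
proof -
  have prime3: "Factorial_Ring.prime (3::int)" by simp
  \<comment> \<open>The case \<open>3 dvd a\<close>, with its own variables so that swapping
    \<open>a, y\<close> with \<open>b, z\<close> covers \<open>3 dvd b\<close>. As 3 divides
    \<open>a\<close> exactly once, \<open>S\<close> yields \<open>x\<close>, and the terms
    \<open>a b^2 y^3\<close> and \<open>a^2 b z^3\<close> of the norm yield \<open>y\<close> and
    \<open>z\<close>, each one power of 3 later.\<close>
  have ramified: "3 dvd x \<and> 3 dvd y \<and> 3 dvd z"
    if hyps: "3 dvd a" "coprime a b" "squarefree a" "3 dvd x\<^sup>2 - a * b * y * z"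
      "27 dvd x ^ 3 + a * b\<^sup>2 * y ^ 3 + a\<^sup>2 * b * z ^ 3 - 3 * a * b * x * y * z" for a b x y z :: int
  proof -
    obtain a' where a': "a = 3 * a'" using hyps(1) by (rule dvdE)
    have na': "\<not> 3 dvd a'"
    proof
      assume "3 dvd a'"
      hence "3\<^sup>2 dvd a" by (auto simp: a')
      hence "3 dvd (1::int)" using hyps(3) by (rule squarefreeD[rotated])
      thus False by simp
    qed
    have nb: "\<not> 3 dvd b" using hyps(1,2) by (meson coprime_common_divisor prime3 not_prime_unit)
    have "x\<^sup>2 = (x\<^sup>2 - a * b * y * z) + 3 * (a' * b * y * z)" by (simp add: a')
    hence "3 dvd x\<^sup>2" using hyps(4) by (metis dvd_add dvd_triv_left)
    hence "3 dvd x" using prime3 prime_dvd_power by blast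
    then obtain x' where x': "x = 3 * x'" by (rule dvdE)
    have "x ^ 3 + a * b\<^sup>2 * y ^ 3 + a\<^sup>2 * b * z ^ 3 - 3 * a * b * x * y * z
       = 3 * (a' * b\<^sup>2 * y ^ 3 + 3 * a'\<^sup>2 * b * z ^ 3 + 9 * (x' ^ 3 - a' * b * x' * y * z))"
      by (simp add: a' x' power2_eq_square power3_eq_cube algebra_simps)
    with hyps(5) have "3 * 9 dvd 3 * (a' * b\<^sup>2 * y ^ 3 + 3 * a'\<^sup>2 * b * z ^ 3 + 9 * (x' ^ 3 - a' * b * x' * y * z))"
      by simp
    hence "9 dvd a' * b\<^sup>2 * y ^ 3 + 3 * a'\<^sup>2 * b * z ^ 3 + 9 * (x' ^ 3 - a' * b * x' * y * z)"
      by (subst (asm) dvd_mult_cancel_left) simp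
    hence 9: "9 dvd a' * b\<^sup>2 * y ^ 3 + 3 * a'\<^sup>2 * b * z ^ 3"
      by (subst (asm) dvd_add_left_iff) simp_all
    hence "3 dvd a' * b\<^sup>2 * y ^ 3 + 3 * a'\<^sup>2 * b * z ^ 3" by (rule dvd_trans[rotated]) simp
    hence "3 dvd a' * b\<^sup>2 * y ^ 3" by (subst (asm) dvd_add_left_iff) simp_all
    hence "3 dvd y" using na' nb prime3 by (auto simp: prime_dvd_mult_iff prime_dvd_power_iff)
    then obtain y' where y': "y = 3 * y'" by (rule dvdE)
    have "a' * b\<^sup>2 * y ^ 3 + 3 * a'\<^sup>2 * b * z ^ 3 = 3 * (a'\<^sup>2 * b * z ^ 3 + 9 * (a' * b\<^sup>2 * y' ^ 3))"
      by (simp add: y' power3_eq_cube algebra_simps)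
    with 9 have "3 * 3 dvd 3 * (a'\<^sup>2 * b * z ^ 3 + 9 * (a' * b\<^sup>2 * y' ^ 3))" by simp
    hence "3 dvd a'\<^sup>2 * b * z ^ 3 + 9 * (a' * b\<^sup>2 * y' ^ 3)" by (subst (asm) dvd_mult_cancel_left) simp
    hence "3 dvd a'\<^sup>2 * b * z ^ 3" by (subst (asm) dvd_add_left_iff) simp_all
    hence "3 dvd z" using na' nb prime3 by (auto simp: prime_dvd_mult_iff prime_dvd_power_iff)
    with \<open>3 dvd x\<close> \<open>3 dvd y\<close> show ?thesis by simp
  qed
  show ?thesis
  proof (cases "3 dvd a \<or> 3 dvd b")
    case True
    thus ?thesis
    proof
      assume "3 dvd a" thus ?thesis using ramified[of a b x y z] assms by blast
    next
      assume "3 dvd b"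
      moreover have "3 dvd x\<^sup>2 - b * a * z * y" using S by (simp add: mult_ac)
      moreover have "27 dvd x ^ 3 + b * a\<^sup>2 * z ^ 3 + b\<^sup>2 * a * y ^ 3 - 3 * b * a * x * z * y"
        using N by (simp add: algebra_simps)
      moreover have "coprime b a" using assms(1) by (rule coprime_commute[THEN iffD1])
      ultimately show ?thesis using ramified[of b a x z y] assms(3) by blast
    qed
  next
    case False
    hence na: "\<not> 3 dvd a" and nb: "\<not> 3 dvd b" by auto
    obtain p q where p: "a\<^sup>2 = 1 + 3 * p" and q: "b\<^sup>2 = 1 + 3 * q" using square_mod_3 na nb by meson
    have N3: "3 dvd x ^ 3 + a * b\<^sup>2 * y ^ 3 + a\<^sup>2 * b * z ^ 3 - 3 * a * b * x * y * z"
      using N by (rule dvd_trans[rotated]) simp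
    have fermat: "3 dvd r ^ 3 - r" for r :: int
    proof -
      have "r mod 3 = 0 \<or> r mod 3 = 1 \<or> r mod 3 = 2" by presburger
      hence "r ^ 3 mod 3 = r mod 3"
        by (auto simp: power3_eq_cube mod_mult_eq[symmetric, of "r * r"] mod_mult_eq[symmetric, of r])
      thus ?thesis by (simp add: mod_eq_dvd_iff)
    qed
    \<comment> \<open>Modulo 3 the norm is linear: cubes reduce by Fermat, and \<open>a^2\<close>
      and \<open>b^2\<close> are 1.\<close>
    have lin_eq: "x + a * y + b * z = (x ^ 3 + a * b\<^sup>2 * y ^ 3 + a\<^sup>2 * b * z ^ 3 - 3 * a * b * x * y * z)
       - (x ^ 3 - x) - a * (y ^ 3 - y) - b * (z ^ 3 - z) + 3 * (a * b * x * y * z - a * q * y ^ 3 - b * p * z ^ 3)"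
      by (simp add: p q algebra_simps)
    have lin: "3 dvd x + a * y + b * z"
      unfolding lin_eq by (intro dvd_add dvd_diff dvd_triv_left N3 fermat dvd_mult[OF fermat])
    show ?thesis
    proof (cases "3 dvd x")
      case True
      hence "3 dvd a * y + b * z" using lin by (simp add: add.assoc dvd_add_right_iff)
      have "3 dvd x\<^sup>2" using True by (simp add: power2_eq_square)
      hence "3 dvd a * b * y * z" using S by (simp add: dvd_diff_right_iff)
      hence "3 dvd y \<or> 3 dvd z" using na nb prime3 by (auto simp: prime_dvd_mult_iff)
      hence "3 dvd y \<and> 3 dvd z" using \<open>3 dvd a * y + b * z\<close> na nb prime3
        by (metis dvd_add_left_iff dvd_add_right_iff dvd_mult prime_dvd_mult_iff)
      thus ?thesis using True by simp
    next
      case nx: False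
      have "3 dvd y - a * x \<and> 3 dvd z - b * x"
      proof -
        \<comment> \<open>Modulo 3 the numbers \<open>a y\<close> and \<open>b z\<close> have sum
          \<open>- x\<close> and product \<open>x^2\<close>; the discriminant \<open>- 3 x^2\<close>
          of their quadratic vanishes, so they agree.\<close>
        have sq: "(a * y - b * z)\<^sup>2 = (x + a * y + b * z) * (a * y + b * z - x)
            + 4 * (x\<^sup>2 - a * b * y * z) - 3 * x\<^sup>2"
          by (simp add: power2_eq_square algebra_simps)
        have "3 dvd (a * y - b * z)\<^sup>2"
          unfolding sq by (intro dvd_diff dvd_add dvd_mult2[OF lin] dvd_mult[OF S] dvd_triv_left)
        hence uv: "3 dvd a * y - b * z" using prime3 prime_dvd_power by blast
        have ux_eq: "a * y - x = 3 * (a * y) - (a * y - b * z) - (x + a * y + b * z)" by simp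
        have ux: "3 dvd a * y - x" by (subst ux_eq) (intro dvd_diff dvd_triv_left uv lin)
        have vx: "3 dvd b * z - x" using dvd_diff[OF ux uv] by simp
        have "a * (a * y - x) = a\<^sup>2 * y - a * x" "b * (b * z - x) = b\<^sup>2 * z - b * x"
          by (simp_all add: power2_eq_square right_diff_distrib)
        hence "y - a * x = a * (a * y - x) - 3 * (p * y)" "z - b * x = b * (b * z - x) - 3 * (q * z)"
          unfolding p q by (simp_all add: algebra_simps)
        moreover have "3 dvd a * (a * y - x) - 3 * (p * y)" "3 dvd b * (b * z - x) - 3 * (q * z)"
          by (intro dvd_diff dvd_triv_left dvd_mult[OF ux] dvd_mult[OF vx])+
        ultimately show ?thesis by (simp only: simp_thms)
      qed
      then obtain k l where k: "y = a * x + 3 * k" and l: "z = b * x + 3 * l"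
        by (metis add.commute diff_add_cancel dvdE)
      \<comment> \<open>After the substitution the terms linear in \<open>k\<close> and
        \<open>l\<close> are divisible by 27, because \<open>a^2 - 1\<close> and
        \<open>b^2 - 1\<close> are multiples of 3. The factor of \<open>x^3\<close> that remains is
        the norm of \<open>1 + a \<alpha> + b \<beta>\<close>.\<close>
      have "x ^ 3 + a * b\<^sup>2 * y ^ 3 + a\<^sup>2 * b * z ^ 3 - 3 * a * b * x * y * z =
        x ^ 3 * (1 + a\<^sup>2 * b\<^sup>2 * (a\<^sup>2 + b\<^sup>2 - 3)) + 9 * x\<^sup>2 * k * a * b\<^sup>2 * (a\<^sup>2 - 1) + 9 * x\<^sup>2 * l * a\<^sup>2 * b * (b\<^sup>2 - 1)
        + 27 * (a * b\<^sup>2 * (a * x * k\<^sup>2 + k ^ 3) + a\<^sup>2 * b * (b * x * l\<^sup>2 + l ^ 3) - a * b * x * k * l)"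
        unfolding k l by (simp add: power2_eq_square power3_eq_cube algebra_simps)
      also have "\<dots> = x ^ 3 * (1 + a\<^sup>2 * b\<^sup>2 * (a\<^sup>2 + b\<^sup>2 - 3))
        + 27 * (x\<^sup>2 * k * a * b\<^sup>2 * p + x\<^sup>2 * l * a\<^sup>2 * b * q
        + a * b\<^sup>2 * (a * x * k\<^sup>2 + k ^ 3) + a\<^sup>2 * b * (b * x * l\<^sup>2 + l ^ 3) - a * b * x * k * l)"
      proof -
        have "a\<^sup>2 - 1 = 3 * p" "b\<^sup>2 - 1 = 3 * q" using p q by simp_all
        thus ?thesis by (simp only:) (simp add: algebra_simps)
      qed
      finally have "27 dvd x ^ 3 * (1 + a\<^sup>2 * b\<^sup>2 * (a\<^sup>2 + b\<^sup>2 - 3))"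
        using N by (simp only: dvd_add_left_iff[OF dvd_triv_left])
      \<comment> \<open>A factor 9 is automatic; one more 3 divides only if it divides
        \<open>p - q\<close>, which means \<open>a^2 \<equiv> b^2\<close> modulo 9.\<close>
      moreover have "1 + a\<^sup>2 * b\<^sup>2 * (a\<^sup>2 + b\<^sup>2 - 3) = 9 * ((p - q)\<^sup>2 + 3 * (p * q * (1 + p + q)))"
        unfolding p q by (simp add: power2_eq_square algebra_simps)
      ultimately have "27 dvd 9 * (x ^ 3 * ((p - q)\<^sup>2 + 3 * (p * q * (1 + p + q))))"
        by (simp only: mult.left_commute)
      hence "9 * 3 dvd 9 * (x ^ 3 * ((p - q)\<^sup>2 + 3 * (p * q * (1 + p + q))))" by simp
      hence "3 dvd x ^ 3 * ((p - q)\<^sup>2 + 3 * (p * q * (1 + p + q)))" by (subst (asm) dvd_mult_cancel_left) simp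
      hence "3 dvd (p - q)\<^sup>2 + 3 * (p * q * (1 + p + q))"
        using nx prime3 by (auto simp: prime_dvd_mult_iff prime_dvd_power_iff)
      hence "3 dvd (p - q)\<^sup>2" by (subst (asm) dvd_add_left_iff) simp_all
      hence "3 dvd p - q" using prime3 prime_dvd_power by blast
      hence "3 * 3 dvd 3 * (p - q)" by (intro mult_dvd_mono) simp_all
      moreover have "a\<^sup>2 - b\<^sup>2 = 3 * (p - q)" using p q by simp
      ultimately have "9 dvd a\<^sup>2 - b\<^sup>2" by simp
      thus ?thesis using na nb \<open>3 dvd y - a * x \<and> 3 dvd z - b * x\<close> by simp
    qed
  qed
qed

text \<open>Makes \<open>(1 - a^2 b^2) / 3\<close> and
  \<open>(1 + a^2 b^2 (a^2 + b^2 - 3)) / 27\<close> integers; these are coefficients, up to sign, of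
  the cubic equation of \<open>\<eta>\<close> below.\<close>

lemma norm_congruence:
  fixes a b :: int
  assumes "\<not> 3 dvd a" "\<not> 3 dvd b" "9 dvd a\<^sup>2 - b\<^sup>2"
  shows "3 dvd 1 - a\<^sup>2 * b\<^sup>2" "27 dvd 1 + a\<^sup>2 * b\<^sup>2 * (a\<^sup>2 + b\<^sup>2 - 3)"
proof -
  obtain p q where p: "a\<^sup>2 = 1 + 3 * p" and q: "b\<^sup>2 = 1 + 3 * q" using square_mod_3 assms(1,2) by meson
  have "1 - a\<^sup>2 * b\<^sup>2 = 3 * (- p - q - 3 * p * q)" unfolding p q by (simp add: algebra_simps)
  thus "3 dvd 1 - a\<^sup>2 * b\<^sup>2" by simp
  have "3 * 3 dvd 3 * (p - q)" using assms(3) p q by simp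
  hence "3 dvd p - q" by (subst (asm) dvd_mult_cancel_left) simp
  then obtain r where r: "p = q + 3 * r" by (metis add.commute diff_add_cancel dvdE)
  have "1 + a\<^sup>2 * b\<^sup>2 * (a\<^sup>2 + b\<^sup>2 - 3) = 27 * (3 * r\<^sup>2 + (q + 3 * r) * q * (1 + q + 3 * r + q))"
    unfolding p q r by (simp add: power2_eq_square algebra_simps)
  thus "27 dvd 1 + a\<^sup>2 * b\<^sup>2 * (a\<^sup>2 + b\<^sup>2 - 3)" by (metis dvd_triv_left)
qed

text \<open>A prime in the denominator of \<open>r\<close> would divide \<open>a b^2\<close> at
  least three times, but its multiplicity there is at most 2.\<close>

lemma cubefree_denominator:
  fixes r :: rat and a b :: nat
  assumes "r ^ 3 * of_nat a * of_nat b ^ 2 \<in> \<int>"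
    and coprime: "coprime a b" and squarefree_a: "squarefree a" and squarefree_b: "squarefree b"
  shows "r \<in> \<int>"
proof -
  have [simp]: "a \<noteq> 0" "b \<noteq> 0" using squarefree_a squarefree_b not_squarefree_0 by metis+
  obtain p q where r: "r = of_int p / of_int q" and q: "q > 0" "coprime p q"
    by (cases r) (auto simp: Fract_of_int_quotient)
  obtain k where "r ^ 3 * of_nat a * of_nat b ^ 2 = of_int k" using assms(1) by (auto elim: Ints_cases)
  hence "of_int (p ^ 3 * int a * int b ^ 2) = (of_int (k * q ^ 3) :: rat)"
    using q(1) by (simp add: r field_simps)
  hence e: "p ^ 3 * (int a * int b ^ 2) = k * q ^ 3" by (simp only: of_int_eq_iff mult.assoc)
  have "coprime (q ^ 3) (p ^ 3)" using q(2) by (simp add: coprime_commute)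
  hence dvd: "q ^ 3 dvd int a * int b ^ 2" using e by (metis coprime_dvd_mult_right_iff dvd_triv_right)
  have "nat q = 1"
  proof (rule ccontr)
    assume "nat q \<noteq> 1"
    then obtain s where s: "Factorial_Ring.prime s" "s dvd nat q" using prime_factor_nat by blast
    have "int (nat q ^ 3) dvd int (a * b\<^sup>2)" using dvd q(1) by simp
    hence "nat q ^ 3 dvd a * b\<^sup>2" by (simp only: of_nat_dvd_iff)
    hence "s ^ 3 dvd a * b\<^sup>2" using s(2) by (meson dvd_power_same dvd_trans)
    hence "3 \<le> multiplicity s (a * b\<^sup>2)" using s(1) by (intro multiplicity_geI) auto
    also have "\<dots> = multiplicity s a + 2 * multiplicity s b"
      using s(1) by (simp add: prime_elem_multiplicity_mult_distrib prime_elem_multiplicity_power_distrib)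
    finally have 3: "3 \<le> multiplicity s a + 2 * multiplicity s b" .
    have "multiplicity s a \<le> 1" "multiplicity s b \<le> 1"
      using squarefree_a squarefree_b s(1) by (auto simp: squarefree_factorial_semiring'')
    moreover have "multiplicity s a = 0 \<or> multiplicity s b = 0"
      using coprime s(1) by (meson coprime_common_divisor not_dvd_imp_multiplicity_0 not_prime_unit)
    ultimately show False using 3 by auto
  qed
  hence "q = 1" using q(1) by simp
  thus ?thesis by (simp add: r)
qed

context cubic_pair
begin

text \<open>Named after the ramification of 3, whose largest index is 2 in this case and 3
  otherwise. The congruence of squares is the form in which the condition comes out of the norm; it
  amounts to \<open>a / b\<close> being 1 or -1 modulo 9.\<close>

definition tame :: bool where
  "tame \<longleftrightarrow> \<not> 3 dvd a \<and> \<not> 3 dvd b \<and> (9 :: int) dvd (int a)\<^sup>2 - (int b)\<^sup>2"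

text \<open>The conjugates \<open>p\<close>, \<open>q\<close>, \<open>r\<close> are algebraic
  integers, and so are integer polynomials in them and the cube root of unity \<open>w\<close>; the
  rational ones among these are integers. The last two claims concern the second symmetric function
  and the norm.\<close>

lemma algebraic_int_coords:
  assumes alg: "algebraic_int (el x y z)"
  shows "3 * x \<in> \<int>" "3 * y \<in> \<int>" "3 * z \<in> \<int>" "3 * x\<^sup>2 - 3 * of_nat a * of_nat b * y * z \<in> \<int>"
    "x ^ 3 + of_nat a * of_nat b ^ 2 * y ^ 3 + of_nat a ^ 2 * of_nat b * z ^ 3 - 3 * of_nat a * of_nat b * x * y * z \<in> \<int>"
proof -
  define w where "w = primitive_cube_root"
  have w3: "w ^ 3 = 1" unfolding w_def by (rule cube_root_cubed)
  have w2: "1 + w + w\<^sup>2 = 0" unfolding w_def by (rule cube_root_sum)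
  have w4: "(w\<^sup>2)\<^sup>2 = w" using w3 by (simp add: power2_eq_square power3_eq_cube mult.assoc)
  have w23: "(w\<^sup>2) ^ 3 = 1" using w3 by (metis power_commutes power_mult power_one mult.commute)
  have aw: "algebraic_int w"
    by (rule algebraic_int_root[of 1 "Polynomial.monom 1 3"]) (auto simp: w3 poly_monom Polynomial.degree_monom_eq)
  define A where "A = complex_of_real \<alpha>"
  define B where "B = complex_of_real \<beta>"
  define u where "u = (of_rat x :: complex)"
  define v where "v = of_rat y * A"
  define t where "t = of_rat z * B"
  have AB: "A * B = of_nat a * of_nat b" "A ^ 3 = of_nat a * of_nat b ^ 2" "B ^ 3 = of_nat a ^ 2 * of_nat b"
    unfolding A_def B_def using arg_cong[OF alpha_beta, of complex_of_real]
      arg_cong[OF alpha_cube, of complex_of_real] arg_cong[OF beta_cube, of complex_of_real] by simp_all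
  have c: "algebraic_int (conj_el \<omega> x y z)" if "\<omega> ^ 3 = 1" for \<omega>
    using algebraic_int_conjugate[OF alg el_in_K that] by simp
  define p where "p = u + v + t"
  define q where "q = u + w * v + w\<^sup>2 * t"
  define r where "r = u + w\<^sup>2 * v + w * t"
  have alg3: "algebraic_int p" "algebraic_int q" "algebraic_int r"
    using c[of 1] c[of w] c[of "w\<^sup>2"] w3 w23
    unfolding conj_el_def w4 p_def q_def r_def u_def v_def t_def A_def B_def by (simp_all add: mult.assoc)
  have "p + q + r = 3 * u + (1 + w + w\<^sup>2) * (v + t)"
    unfolding p_def q_def r_def by (simp add: algebra_simps)
  hence "of_rat (3 * x) = p + q + r" unfolding w2 by (simp add: u_def of_rat_mult)
  thus "3 * x \<in> \<int>"     by (intro rat_algebraic_int[where 'a = complex]) (simp add: algebraic_int_add alg3)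
  \<comment> \<open>A discrete Fourier transform over the cube roots of unity isolates the component
    along \<open>\<alpha>\<close>.\<close>
  have "p + w\<^sup>2 * q + w * r = (1 + w + w\<^sup>2) * (u + t) + (1 + 2 * w ^ 3) * v + (w * w ^ 3 - w) * t"
    unfolding p_def q_def r_def by (simp add: algebra_simps power2_eq_square power3_eq_cube)
  hence "3 * v = p + w\<^sup>2 * q + w * r" unfolding w2 w3 by simp
  moreover have "algebraic_int (p + w\<^sup>2 * q + w * r)"
    by (intro algebraic_int_add algebraic_int_mult algebraic_int_power alg3 aw)
  ultimately have "algebraic_int (3 * v)" by simp
  \<comment> \<open>The component \<open>3 v\<close> need not be rational, but its cube is, and a
    cubefree factor \<open>a b^2\<close> cannot absorb the denominator of
    \<open>(3 y)^3\<close>.\<close>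
  hence "algebraic_int ((3 * v) ^ 3)" by (rule algebraic_int_power)
  also have "(3 * v) ^ 3 = of_rat ((3 * y) ^ 3 * of_nat a * of_nat b ^ 2)"
    using AB(2) by (simp add: v_def of_rat_mult of_rat_power power_mult_distrib)
  finally show "3 * y \<in> \<int>"
    by (intro cubefree_denominator[OF rat_algebraic_int coprime squarefree_a squarefree_b])
  have "p + w * q + w\<^sup>2 * r = (1 + w + w\<^sup>2) * (u + v) + (w * w ^ 3 - w) * v + (1 + 2 * w ^ 3) * t"
    unfolding p_def q_def r_def by (simp add: algebra_simps power2_eq_square power3_eq_cube)
  hence "3 * t = p + w * q + w\<^sup>2 * r" unfolding w2 w3 by simp
  moreover have "algebraic_int (p + w * q + w\<^sup>2 * r)"
    by (intro algebraic_int_add algebraic_int_mult algebraic_int_power alg3 aw)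
  ultimately have "algebraic_int (3 * t)" by simp
  hence "algebraic_int ((3 * t) ^ 3)" by (rule algebraic_int_power)
  also have "(3 * t) ^ 3 = of_rat ((3 * z) ^ 3 * of_nat b * of_nat a ^ 2)"
    using AB(3) by (simp add: t_def of_rat_mult of_rat_power power_mult_distrib mult_ac)
  finally show "3 * z \<in> \<int>"
    by (intro cubefree_denominator[OF rat_algebraic_int coprime_commute[THEN iffD1, OF coprime]
          squarefree_b squarefree_a])
  have vt: "v * t = of_rat (of_nat a * of_nat b * y * z)"
    using AB(1) by (simp add: v_def t_def of_rat_mult mult_ac)
  have cubes: "v ^ 3 = of_rat (of_nat a * of_nat b ^ 2 * y ^ 3)" "t ^ 3 = of_rat (of_nat a ^ 2 * of_nat b * z ^ 3)"
    using AB(2,3) by (simp_all add: v_def t_def of_rat_mult of_rat_power power_mult_distrib mult_ac)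
  have "q + r = 2 * u - v - t + (1 + w + w\<^sup>2) * (v + t)"
    unfolding q_def r_def by (simp add: algebra_simps)
  hence sum: "q + r = 2 * u - v - t" by (simp add: w2)
  have "q * r = u\<^sup>2 + v\<^sup>2 * w ^ 3 + t\<^sup>2 * w ^ 3 - u * v - u * t - v * t + (1 + w + w\<^sup>2) * (u * v + u * t + v * t)
      + w * (w ^ 3 - 1) * (v * t)"
    unfolding q_def r_def by (simp add: algebra_simps power2_eq_square power3_eq_cube)
  hence prod: "q * r = u\<^sup>2 + v\<^sup>2 + t\<^sup>2 - u * v - u * t - v * t" by (simp add: w2 w3)
  have "p * (q + r) + q * r = 3 * u\<^sup>2 - 3 * (v * t)"
    unfolding sum prod p_def by (simp add: algebra_simps power2_eq_square)
  hence "of_rat (3 * x\<^sup>2 - 3 * (of_nat a * of_nat b * y * z)) = p * (q + r) + q * r"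
    unfolding of_rat_diff of_rat_mult[of 3] vt[symmetric] by (simp add: u_def of_rat_power)
  hence "3 * x\<^sup>2 - 3 * (of_nat a * of_nat b * y * z) \<in> \<int>"
    by (intro rat_algebraic_int[where 'a = complex]) (simp add: algebraic_int_add algebraic_int_mult alg3)
  thus "3 * x\<^sup>2 - 3 * of_nat a * of_nat b * y * z \<in> \<int>" by (simp add: mult.assoc)
  have "p * (q * r) = u ^ 3 + v ^ 3 + t ^ 3 - 3 * (u * (v * t))"
    unfolding prod p_def by (simp add: algebra_simps power2_eq_square power3_eq_cube)
  hence "of_rat (x ^ 3 + of_nat a * of_nat b ^ 2 * y ^ 3 + of_nat a ^ 2 * of_nat b * z ^ 3
      - 3 * (x * (of_nat a * of_nat b * y * z))) = p * (q * r)"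
    unfolding of_rat_diff of_rat_add of_rat_mult[of 3] of_rat_mult[of x] vt[symmetric] cubes
    by (simp add: u_def of_rat_power)
  hence "x ^ 3 + of_nat a * of_nat b ^ 2 * y ^ 3 + of_nat a ^ 2 * of_nat b * z ^ 3
      - 3 * (x * (of_nat a * of_nat b * y * z)) \<in> \<int>"
    by (intro rat_algebraic_int[where 'a = complex]) (simp add: algebraic_int_add algebraic_int_mult alg3)
  thus "x ^ 3 + of_nat a * of_nat b ^ 2 * y ^ 3 + of_nat a ^ 2 * of_nat b * z ^ 3 - 3 * of_nat a * of_nat b * x * y * z \<in> \<int>"
    by (simp add: mult_ac)
qed

end

section \<open>Integral bases and independence of the discriminant\<close>

lemma int_combination_nth:
  fixes \<omega> :: "real list"
  assumes "i < length \<omega>"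
  shows "(\<Sum>j<length \<omega>. of_int (map (\<lambda>j. if j = i then 1 else 0 :: int) [0..<length \<omega>] ! j) * \<omega> ! j) = \<omega> ! i"
proof -
  have "(\<Sum>j<length \<omega>. of_int (map (\<lambda>j. if j = i then 1 else 0 :: int) [0..<length \<omega>] ! j) * \<omega> ! j)
      = (\<Sum>j<length \<omega>. if j = i then \<omega> ! j else 0)"
    by (intro sum.cong) auto
  also have "\<dots> = \<omega> ! i" using assms by simp
  finally show ?thesis .
qed

lemma integral_basis_nth:
  assumes "integral_basis F \<omega>" "i < length \<omega>" shows "\<omega> ! i \<in> ring_of_integers F"
proof -
  have "(\<Sum>j<length \<omega>. of_int (map (\<lambda>j. if j = i then 1 else 0 :: int) [0..<length \<omega>] ! j) * \<omega> ! j)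
     \<in> ring_of_integers F"
    using assms(1) unfolding integral_basis_def by (rule bij_betw_apply) simp
  thus ?thesis unfolding int_combination_nth[OF assms(2)] .
qed

lemma integral_basis_coeffs:
  assumes "integral_basis F \<omega>" "t \<in> ring_of_integers F"
  obtains c :: "nat \<Rightarrow> int" where "t = (\<Sum>j<length \<omega>. of_int (c j) * \<omega> ! j)"
proof -
  have "t \<in> (\<lambda>c :: int list. \<Sum>i<length \<omega>. of_int (c ! i) * \<omega> ! i) ` {c. length c = length \<omega>}"
    using assms unfolding integral_basis_def by (simp add: bij_betw_def)
  then obtain c :: "int list" where "t = (\<Sum>i<length \<omega>. of_int (c ! i) * \<omega> ! i)" by blast
  thus thesis by (rule that)
qed

lemma integral_basis_unique:
  fixes c d :: "nat \<Rightarrow> int"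
  assumes "integral_basis F \<omega>" "(\<Sum>j<length \<omega>. of_int (c j) * \<omega> ! j) = (\<Sum>j<length \<omega>. of_int (d j) * \<omega> ! j)"
    and "j < length \<omega>"
  shows "c j = d j"
proof -
  have eq: "(\<Sum>j<length \<omega>. of_int (map f [0..<length \<omega>] ! j) * \<omega> ! j) = (\<Sum>j<length \<omega>. of_int (f j) * \<omega> ! j)"
    for f :: "nat \<Rightarrow> int" by (intro sum.cong) auto
  have "map c [0..<length \<omega>] = map d [0..<length \<omega>]"
    using assms(1) unfolding integral_basis_def bij_betw_def
    by (intro inj_onD[where f = "\<lambda>c :: int list. \<Sum>i<length \<omega>. of_int (c ! i) * \<omega> ! i"
          and A = "{c. length c = length \<omega>}"]) (auto simp: eq assms(2))
  thus ?thesis using assms(3) by (metis add_0 diff_zero nth_map_upt)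
qed

text \<open>The lengths are kept separate, since \<open>integral_basis\<close> does not prescribe
  one. Both products are recorded so that equality of the lengths can be derived from them.\<close>

lemma integral_basis_transition:
  assumes "integral_basis F \<omega>" "integral_basis F \<omega>'"
  shows "\<exists>A B :: nat \<Rightarrow> nat \<Rightarrow> int.
    (\<forall>i<length \<omega>'. \<omega>' ! i = (\<Sum>j<length \<omega>. of_int (A i j) * \<omega> ! j)) \<and>
    (\<forall>i<length \<omega>'. \<forall>k<length \<omega>'. (\<Sum>j<length \<omega>. A i j * B j k) = (if k = i then 1 else 0)) \<and>
    (\<forall>i<length \<omega>. \<forall>k<length \<omega>. (\<Sum>j<length \<omega>'. B i j * A j k) = (if k = i then 1 else 0))"
proof -
  have ex: "\<exists>A :: nat \<Rightarrow> nat \<Rightarrow> int. \<forall>i<length \<nu>'. \<nu>' ! i = (\<Sum>j<length \<nu>. of_int (A i j) * \<nu> ! j)"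
    if "integral_basis F \<nu>" "integral_basis F \<nu>'" for \<nu> \<nu>'
  proof -
    have "\<forall>i. \<exists>c :: nat \<Rightarrow> int. i < length \<nu>' \<longrightarrow> \<nu>' ! i = (\<Sum>j<length \<nu>. of_int (c j) * \<nu> ! j)"
      using integral_basis_coeffs[OF that(1) integral_basis_nth[OF that(2)]] by metis
    thus ?thesis by metis
  qed
  \<comment> \<open>Expanding \<open>\<nu>'\<close> through \<open>\<nu>\<close> and back must
    return unit coordinates, as coordinates are unique.\<close>
  have comp: "(\<Sum>j<length \<nu>. A i j * B j k) = (if k = i then 1 else 0)"
    if "integral_basis F \<nu>'" "\<forall>i<length \<nu>'. \<nu>' ! i = (\<Sum>j<length \<nu>. of_int (A i j) * \<nu> ! j)"
      "\<forall>i<length \<nu>. \<nu> ! i = (\<Sum>j<length \<nu>'. of_int (B i j) * \<nu>' ! j)" "i < length \<nu>'" "k < length \<nu>'"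
    for A B :: "nat \<Rightarrow> nat \<Rightarrow> int" and \<nu> \<nu>' i k
  proof -
    have "(\<Sum>k<length \<nu>'. of_int (\<Sum>j<length \<nu>. A i j * B j k) * \<nu>' ! k)
      = (\<Sum>k<length \<nu>'. \<Sum>j<length \<nu>. of_int (A i j) * (of_int (B j k) * \<nu>' ! k))"
      by (simp add: sum_distrib_right mult.assoc)
    also have "\<dots> = (\<Sum>j<length \<nu>. of_int (A i j) * (\<Sum>k<length \<nu>'. of_int (B j k) * \<nu>' ! k))"
      by (subst sum.swap) (simp add: sum_distrib_left)
    also have "\<dots> = (\<Sum>j<length \<nu>. of_int (A i j) * \<nu> ! j)" using that(3) by simp
    also have "\<dots> = \<nu>' ! i" using that(2,4) by simp
    also have "\<dots> = (\<Sum>k<length \<nu>'. of_int (if k = i then 1 else 0) * \<nu>' ! k)"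
    proof -
      have "(\<Sum>k<length \<nu>'. of_int (if k = i then 1 else 0) * \<nu>' ! k) = (\<Sum>k<length \<nu>'. if k = i then \<nu>' ! k else 0)"
        by (intro sum.cong) auto
      thus ?thesis using that(4) by simp
    qed
    finally show ?thesis by (rule integral_basis_unique[OF that(1) _ that(5)])
  qed
  obtain A B :: "nat \<Rightarrow> nat \<Rightarrow> int"
    where A: "\<forall>i<length \<omega>'. \<omega>' ! i = (\<Sum>j<length \<omega>. of_int (A i j) * \<omega> ! j)"
      and B: "\<forall>i<length \<omega>. \<omega> ! i = (\<Sum>j<length \<omega>'. of_int (B i j) * \<omega>' ! j)"
    using ex[OF assms] ex[OF assms(2,1)] by blast
  show ?thesis using A comp[OF assms(2) A B] comp[OF assms(1) B A] by (intro exI[of _ A] exI[of _ B]) simp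
qed

abbreviation trace_gram :: "real set \<Rightarrow> real list \<Rightarrow> complex mat" where
  "trace_gram F \<omega> \<equiv> Matrix.mat (length \<omega>) (length \<omega>) (\<lambda>(i, j). field_trace F (\<omega> ! i * \<omega> ! j))"

lemma det_trace_gram_3:
  "Determinant.det (trace_gram F [e0, e1, e2]) =
    field_trace F (e0 * e0) * (field_trace F (e1 * e1) * field_trace F (e2 * e2) - field_trace F (e1 * e2) * field_trace F (e2 * e1))
    - field_trace F (e0 * e1) * (field_trace F (e1 * e0) * field_trace F (e2 * e2) - field_trace F (e1 * e2) * field_trace F (e2 * e0))
    + field_trace F (e0 * e2) * (field_trace F (e1 * e0) * field_trace F (e2 * e1) - field_trace F (e1 * e1) * field_trace F (e2 * e0))"
proof -
  have 3: "length [e0, e1, e2] = 3" by simp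
  show ?thesis unfolding 3 det_3 by simp
qed

lemma integral_basis_3I:
  assumes inj: "\<And>p q r p' q' r' :: int. of_int p * e0 + of_int q * e1 + of_int r * e2
      = of_int p' * e0 + of_int q' * e1 + of_int r' * e2 \<Longrightarrow> p = p' \<and> q = q' \<and> r = r'"
    and range: "\<And>t. t \<in> ring_of_integers F \<longleftrightarrow> (\<exists>p q r :: int. t = of_int p * e0 + of_int q * e1 + of_int r * e2)"
  shows "integral_basis F [e0, e1, e2]"
proof -
  let ?f = "\<lambda>c :: int list. \<Sum>i<length [e0, e1, e2]. of_int (c ! i) * [e0, e1, e2] ! i"
  have f: "?f [p, q, r] = of_int p * e0 + of_int q * e1 + of_int r * e2" for p q r
    by (simp add: add.assoc)
  have len: "length c = length [e0, e1, e2] \<longleftrightarrow> (\<exists>p q r. c = [p, q, r])" for c :: "int list"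
    by (auto simp: length_Suc_conv)
  have S: "{c :: int list. length c = length [e0, e1, e2]} = {[p, q, r] | p q r. True}"
    unfolding len by auto
  show ?thesis
    unfolding integral_basis_def S bij_betw_def
  proof (intro conjI inj_onI equalityI subsetI)
    fix c d assume "c \<in> {[p, q, r] | p q r :: int. True}" "d \<in> {[p, q, r] | p q r :: int. True}" "?f c = ?f d"
    then obtain p q r p' q' r' where "c = [p, q, r]" "d = [p', q', r']" "?f [p, q, r] = ?f [p', q', r']" by blast
    thus "c = d" using inj[of p q r p' q' r'] unfolding f by blast
  next
    fix t assume "t \<in> ?f ` {[p, q, r] | p q r. True}"
    then obtain p q r where "t = ?f [p, q, r]" by blast
    thus "t \<in> ring_of_integers F" unfolding f range by blast
  next
    fix t assume "t \<in> ring_of_integers F"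
    then obtain p q r :: int where "t = ?f [p, q, r]" unfolding f range by blast
    thus "t \<in> ?f ` {[p, q, r] | p q r. True}" by blast
  qed
qed

lemma squarefree_int_of_nat:
  assumes "squarefree n" shows "squarefree (int n)"
proof (rule squarefreeI)
  fix x assume "x\<^sup>2 dvd int n"
  hence "int ((nat \<bar>x\<bar>)\<^sup>2) dvd int n" by simp
  hence "(nat \<bar>x\<bar>)\<^sup>2 dvd n" by (simp only: of_nat_dvd_iff)
  hence "nat \<bar>x\<bar> dvd 1" using assms by (rule squarefreeD[rotated])
  thus "x dvd 1" by simp
qed

context cubic_pair
begin

lemma field_trace_add: "s \<in> K \<Longrightarrow> t \<in> K \<Longrightarrow> field_trace K (s + t) = field_trace K s + field_trace K t"
  by (elim K_cases) (simp add: el_add field_trace_el of_rat_add of_rat_mult distrib_left)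

lemma field_trace_int_mult: "t \<in> K \<Longrightarrow> field_trace K (of_int k * t) = of_int k * field_trace K t"
proof (elim K_cases)
  fix x y z assume t: "t = el x y z"
  have "of_int k * el x y z = el (of_int k) 0 0 * el x y z" by (simp add: el_def)
  also have "\<dots> = el (of_int k * x) (of_int k * y) (of_int k * z)" unfolding el_mult by simp
  finally show ?thesis by (simp add: t field_trace_el of_rat_mult)
qed

lemma of_int_in_K: "of_int k \<in> K" using Q_adjoin_of_rat[of "of_int k"] by simp

lemma sum_in_K: "finite I \<Longrightarrow> (\<And>i. i \<in> I \<Longrightarrow> f i \<in> K) \<Longrightarrow> (\<Sum>i\<in>I. f i) \<in> K"
  by (induction I rule: finite_induct) (auto intro: Q_adjoin_0 Q_adjoin_add)

lemma field_trace_sum: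
  assumes "finite I" "\<And>i. i \<in> I \<Longrightarrow> f i \<in> K"
  shows "field_trace K (\<Sum>i\<in>I. of_int (c i) * f i) = (\<Sum>i\<in>I. of_int (c i) * field_trace K (f i))"
  using assms
proof (induction I rule: finite_induct)
  case empty
  have "field_trace K (of_int 0 * 1) = of_int 0 * field_trace K 1"
    by (rule field_trace_int_mult[OF Q_adjoin_1])
  thus ?case by simp
next
  case (insert i I)
  thus ?case
    by (simp add: field_trace_add field_trace_int_mult sum_in_K Q_adjoin_mult of_int_in_K)
qed

text \<open>A change of integral basis turns the Gram matrix \<open>G\<close> into
  \<open>A G A^T\<close> with \<open>A\<close> invertible over the integers. This makes the definite
  description in \<open>discriminant\<close> meaningful.\<close>

lemma discriminant_basis_independent:
  assumes "integral_basis K \<omega>" "integral_basis K \<omega>'"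
  shows "Determinant.det (trace_gram K \<omega>') = Determinant.det (trace_gram K \<omega>)"
proof -
  let ?n = "length \<omega>" and ?m = "length \<omega>'"
  obtain A B where "\<forall>i<?m. \<omega>' ! i = (\<Sum>j<?n. of_int (A i j) * \<omega> ! j)"
    and "\<forall>i<?m. \<forall>k<?m. (\<Sum>j<?n. A i j * B j k) = (if k = i then 1 else 0)"
    and "\<forall>i<?n. \<forall>k<?n. (\<Sum>j<?m. B i j * A j k) = (if k = i then 1 else 0)"
    using integral_basis_transition[OF assms] by blast
  hence A: "\<And>i. i < ?m \<Longrightarrow> \<omega>' ! i = (\<Sum>j<?n. of_int (A i j) * \<omega> ! j)"
    and AB: "\<And>i k. i < ?m \<Longrightarrow> k < ?m \<Longrightarrow> (\<Sum>j<?n. A i j * B j k) = (if k = i then 1 else 0)"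
    and BA: "\<And>i k. i < ?n \<Longrightarrow> k < ?n \<Longrightarrow> (\<Sum>j<?m. B i j * A j k) = (if k = i then 1 else 0)"
    by blast+
  \<comment> \<open>The traces of \<open>A B\<close> and \<open>B A\<close> agree, so both bases have the same length.\<close>
  have "int ?m = (\<Sum>i<?m. \<Sum>j<?n. A i j * B j i)" by (simp add: AB)
  also have "\<dots> = (\<Sum>j<?n. \<Sum>i<?m. B j i * A i j)" by (subst sum.swap) (simp add: mult.commute)
  also have "\<dots> = int ?n" by (simp add: BA)
  finally have mn: "?m = ?n" by simp
  have wK: "\<omega> ! i \<in> K" if "i < ?n" for i
    using integral_basis_nth[OF assms(1) that] by (simp add: ring_of_integers_def)
  define MA where "MA = Matrix.mat ?n ?n (\<lambda>(i, j). A i j)"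
  define MB where "MB = Matrix.mat ?n ?n (\<lambda>(i, j). B i j)"
  show ?thesis
  proof (rule det_gram_change[of MA ?n MB])
    show "MA * MB = 1\<^sub>m ?n"
      using AB mn by (intro eq_matI) (auto simp: MA_def MB_def scalar_prod_def lessThan_atLeast0)
    show "trace_gram K \<omega>' = map_mat of_int MA * trace_gram K \<omega> * transpose_mat (map_mat of_int MA)"
    proof (rule eq_matI)
      fix i j assume "i < dim_row (map_mat of_int MA * trace_gram K \<omega> * transpose_mat (map_mat of_int MA))"
        "j < dim_col (map_mat of_int MA * trace_gram K \<omega> * transpose_mat (map_mat of_int MA))"
      hence ij: "i < ?n" "j < ?n" by (simp_all add: MA_def)
      have "trace_gram K \<omega>' $$ (i, j) = field_trace K (\<omega>' ! i * \<omega>' ! j)" using ij mn by simp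
      also have "\<omega>' ! i * \<omega>' ! j = (\<Sum>k<?n. of_int (A i k) * \<omega> ! k) * (\<Sum>l<?n. of_int (A j l) * \<omega> ! l)"
        using A[of i] A[of j] ij mn by simp
      also have "\<dots> = (\<Sum>k<?n. of_int (A i k) * (\<Sum>l<?n. of_int (A j l) * (\<omega> ! k * \<omega> ! l)))"
        by (subst sum_product, rule sum.cong[OF refl], subst sum_distrib_left, rule sum.cong) (simp_all add: mult_ac)
      also have "field_trace K \<dots> = (\<Sum>k<?n. of_int (A i k) * (\<Sum>l<?n. of_int (A j l) * field_trace K (\<omega> ! k * \<omega> ! l)))"
      proof (subst field_trace_sum)
        show "(\<Sum>l<?n. of_int (A j l) * (\<omega> ! k * \<omega> ! l)) \<in> K" if "k \<in> {..<?n}" for k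
          using that by (intro sum_in_K Q_adjoin_mult of_int_in_K wK) simp_all
        show "(\<Sum>k<?n. of_int (A i k) * field_trace K (\<Sum>l<?n. of_int (A j l) * (\<omega> ! k * \<omega> ! l))) =
            (\<Sum>k<?n. of_int (A i k) * (\<Sum>l<?n. of_int (A j l) * field_trace K (\<omega> ! k * \<omega> ! l)))"
          by (intro sum.cong arg_cong2[where f = "(*)"] refl field_trace_sum Q_adjoin_mult wK) simp_all
      qed simp
      also have "\<dots> = (map_mat of_int MA * trace_gram K \<omega> * transpose_mat (map_mat of_int MA)) $$ (i, j)"
        using ij
        by (simp add: MA_def scalar_prod_def lessThan_atLeast0 sum_distrib_left sum_distrib_right mult_ac)
          (subst sum.swap, simp add: mult.commute)
      finally show "trace_gram K \<omega>' $$ (i, j)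
          = (map_mat of_int MA * trace_gram K \<omega> * transpose_mat (map_mat of_int MA)) $$ (i, j)" .
    qed (simp_all add: MA_def mn)
  qed (simp_all add: MA_def MB_def)
qed

lemma discriminant_eqI:
  assumes "integral_basis K \<omega>" "Determinant.det (trace_gram K \<omega>) = of_int d"
  shows "discriminant K = d"
  unfolding discriminant_def
proof (rule the_equality)
  fix d' assume "\<exists>\<omega>'. integral_basis K \<omega>' \<and> of_int d' = Determinant.det (trace_gram K \<omega>')"
  then obtain \<omega>' where "integral_basis K \<omega>'" "of_int d' = Determinant.det (trace_gram K \<omega>')" by blast
  hence "(of_int d' :: complex) = of_int d" using discriminant_basis_independent[OF assms(1)] assms(2) by simp
  thus "d' = d" by simp
qed (use assms in metis)

section \<open>The two integral bases and their discriminants\<close>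

text \<open>The congruences apply to the tripled coordinates \<open>u\<close>, \<open>v\<close>,
  \<open>w\<close>. The second case is \<open>p * \<eta> + q * \<alpha> + r * \<beta>\<close> in
  coordinates, with \<open>\<eta>\<close> as defined below.\<close>

lemma integers_cases:
  assumes "t \<in> ring_of_integers K"
  obtains x y z :: int where "t = el (of_int x) (of_int y) (of_int z)"
  | p q r :: int where tame "t = el (of_int p / 3) (of_int q + of_int p * of_nat a / 3) (of_int r + of_int p * of_nat b / 3)"
proof -
  have "t \<in> K" using assms by (simp add: ring_of_integers_def)
  then obtain x y z where t: "t = el x y z" by (rule K_cases)
  have alg: "algebraic_int (el x y z)" using assms t by (simp add: ring_of_integers_def)
  obtain u where u: "3 * x = of_int u" using algebraic_int_coords(1)[OF alg] by (rule Ints_cases)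
  obtain v where v: "3 * y = of_int v" using algebraic_int_coords(2)[OF alg] by (rule Ints_cases)
  obtain w where w: "3 * z = of_int w" using algebraic_int_coords(3)[OF alg] by (rule Ints_cases)
  have xyz: "x = of_int u / 3" "y = of_int v / 3" "z = of_int w / 3" using u v w by simp_all
  obtain k where "3 * x\<^sup>2 - 3 * of_nat a * of_nat b * y * z = of_int k"
    using algebraic_int_coords(4)[OF alg] by (rule Ints_cases)
  hence "of_int (u\<^sup>2 - int a * int b * v * w) = (of_int (3 * k) :: rat)"
    unfolding xyz by (simp add: field_simps power2_eq_square)
  hence S: "u\<^sup>2 - int a * int b * v * w = 3 * k" by (simp only: of_int_eq_iff)
  obtain l where "x ^ 3 + of_nat a * of_nat b ^ 2 * y ^ 3 + of_nat a ^ 2 * of_nat b * z ^ 3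
      - 3 * of_nat a * of_nat b * x * y * z = of_int l"
    using algebraic_int_coords(5)[OF alg] by (rule Ints_cases)
  hence "of_int (u ^ 3 + int a * (int b)\<^sup>2 * v ^ 3 + (int a)\<^sup>2 * int b * w ^ 3 - 3 * int a * int b * u * v * w)
      = (of_int (27 * l) :: rat)"
    unfolding xyz by (simp add: field_simps power2_eq_square power3_eq_cube)
  hence N: "u ^ 3 + int a * (int b)\<^sup>2 * v ^ 3 + (int a)\<^sup>2 * int b * w ^ 3 - 3 * int a * int b * u * v * w = 27 * l"
    by (simp only: of_int_eq_iff)
  have sf: "squarefree (int a)" "squarefree (int b)"
    using squarefree_a squarefree_b by (simp_all add: squarefree_int_of_nat)
  have "3 dvd u \<and> 3 dvd v \<and> 3 dvd w \<or>
    \<not> 3 dvd int a \<and> \<not> 3 dvd int b \<and> 9 dvd (int a)\<^sup>2 - (int b)\<^sup>2 \<and> 3 dvd v - int a * u \<and> 3 dvd w - int b * u"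
    by (rule cubic_congruences) (use coprime sf S N in simp_all)
  thus thesis
  proof
    assume "3 dvd u \<and> 3 dvd v \<and> 3 dvd w"
    then obtain u' v' w' where "u = 3 * u'" "v = 3 * v'" "w = 3 * w'" by (metis dvdE)
    thus thesis using that(1)[of u' v' w'] t xyz by simp
  next
    assume *: "\<not> 3 dvd int a \<and> \<not> 3 dvd int b \<and> 9 dvd (int a)\<^sup>2 - (int b)\<^sup>2 \<and> 3 dvd v - int a * u \<and> 3 dvd w - int b * u"
    then obtain q r where qr: "v = int a * u + 3 * q" "w = int b * u + 3 * r" by (metis add.commute diff_add_cancel dvdE)
    have tame unfolding tame_def using * by presburger
    moreover have "y = of_int q + of_int u * of_nat a / 3" "z = of_int r + of_int u * of_nat b / 3"
      unfolding xyz qr by simp_all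
    ultimately show thesis using that(2)[of u q r] t xyz(1) by (simp only:)
  qed
qed

lemma algebraic_int_alpha: "algebraic_int \<alpha>" and algebraic_int_beta: "algebraic_int \<beta>"
  unfolding \<alpha>_def \<beta>_def by (intro algebraic_int_nth_root_real int_imp_algebraic_int Ints_of_nat)+

text \<open>The additional integer of the tame case: a third of the vector \<open>(1, a, b)\<close>
  singled out by the congruences.\<close>

definition \<eta> :: real where "\<eta> = el (1 / 3) (of_nat a / 3) (of_nat b / 3)"

text \<open>It is a root of \<open>X^3 - X^2 + k X - l\<close>, where \<open>k\<close> is its second
  symmetric function and \<open>l\<close> its norm.\<close>

lemma algebraic_int_eta:
  assumes tame shows "algebraic_int \<eta>"
proof -
  have w: "\<not> 3 dvd int a" "\<not> 3 dvd int b" "9 dvd (int a)\<^sup>2 - (int b)\<^sup>2"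
    using assms unfolding tame_def by presburger+
  obtain k where k: "1 - (int a)\<^sup>2 * (int b)\<^sup>2 = 3 * k" using norm_congruence(1)[OF w] by (rule dvdE)
  obtain l where l: "1 + (int a)\<^sup>2 * (int b)\<^sup>2 * ((int a)\<^sup>2 + (int b)\<^sup>2 - 3) = 27 * l"
    using norm_congruence(2)[OF w] by (rule dvdE)
  have k': "of_int k = (1 - (of_nat a)\<^sup>2 * (of_nat b)\<^sup>2) / (3 :: rat)"
    using arg_cong[OF k, of "of_int :: int \<Rightarrow> rat"] by simp
  have l': "of_int l = (1 + (of_nat a)\<^sup>2 * (of_nat b)\<^sup>2 * ((of_nat a)\<^sup>2 + (of_nat b)\<^sup>2 - 3)) / (27 :: rat)"
    using arg_cong[OF l, of "of_int :: int \<Rightarrow> rat"] by simp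
  \<comment> \<open>Horner form, so that \<open>el_mult\<close> and \<open>el_add\<close> evaluate
    the polynomial in coordinates.\<close>
  have "\<eta> * (\<eta> * (\<eta> + el (- 1) 0 0) + el (of_int k) 0 0) + el (- of_int l) 0 0 = el 0 0 0"
    unfolding \<eta>_def el_mult el_add el_eq_iff k' l'
    by (simp add: field_simps power2_eq_square power3_eq_cube)
  hence "\<eta> * (\<eta> * (\<eta> - 1) + of_int k) - of_int l = 0" by (simp add: el_def of_rat_minus)
  hence "poly (map_poly of_int [:- l, k, - 1, 1:]) \<eta> = 0" by (simp add: map_poly_pCons algebra_simps)
  thus ?thesis unfolding algebraic_int_altdef_ipoly by (intro exI[of _ "[:- l, k, - 1, 1:]"]) simp
qed

lemma integral_basis_wild:
  assumes "\<not> tame" shows "integral_basis K [1, \<alpha>, \<beta>]"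
proof -
  have comb: "of_int p * 1 + of_int q * \<alpha> + of_int r * \<beta> = el (of_int p) (of_int q) (of_int r)" for p q r
    by (simp add: el_def)
  show ?thesis
  proof (rule integral_basis_3I)
    fix p q r p' q' r' :: int
    assume "of_int p * 1 + of_int q * \<alpha> + of_int r * \<beta> = of_int p' * 1 + of_int q' * \<alpha> + of_int r' * \<beta>"
    thus "p = p' \<and> q = q' \<and> r = r'" unfolding comb by simp
  next
    fix t
    have alg: "algebraic_int (of_int p * 1 + of_int q * \<alpha> + of_int r * \<beta>)" for p q r
      by (intro algebraic_int_add algebraic_int_mult algebraic_int_alpha algebraic_int_beta) simp_all
    have "\<exists>p q r :: int. t = el (of_int p) (of_int q) (of_int r)" if "t \<in> ring_of_integers K"
      using that by (cases rule: integers_cases) (use assms in auto)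
    moreover have "of_int p * 1 + of_int q * \<alpha> + of_int r * \<beta> \<in> ring_of_integers K" for p q r
      using alg[of p q r] el_in_K unfolding ring_of_integers_def comb by simp
    ultimately show "t \<in> ring_of_integers K \<longleftrightarrow> (\<exists>p q r :: int. t = of_int p * 1 + of_int q * \<alpha> + of_int r * \<beta>)"
      unfolding comb by blast
  qed
qed

lemma integral_basis_tame:
  assumes tame shows "integral_basis K [\<eta>, \<alpha>, \<beta>]"
proof -
  have comb: "of_int p * \<eta> + of_int q * \<alpha> + of_int r * \<beta>
      = el (of_int p / 3) (of_int q + of_int p * of_nat a / 3) (of_int r + of_int p * of_nat b / 3)" for p q r
    by (simp add: el_def \<eta>_def of_rat_add of_rat_divide of_rat_mult algebra_simps)
  show ?thesis
  proof (rule integral_basis_3I)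
    fix p q r p' q' r' :: int
    assume "of_int p * \<eta> + of_int q * \<alpha> + of_int r * \<beta> = of_int p' * \<eta> + of_int q' * \<alpha> + of_int r' * \<beta>"
    thus "p = p' \<and> q = q' \<and> r = r'" unfolding comb by auto
  next
    fix t
    have alg: "algebraic_int (of_int p * \<eta> + of_int q * \<alpha> + of_int r * \<beta>)" for p q r
      by (intro algebraic_int_add algebraic_int_mult algebraic_int_alpha algebraic_int_beta algebraic_int_eta assms)
        simp_all
    have "\<exists>p q r :: int. t = of_int p * \<eta> + of_int q * \<alpha> + of_int r * \<beta>" if "t \<in> ring_of_integers K"
      using that
    proof (cases rule: integers_cases)
      case (1 x y z)
      \<comment> \<open>Uses \<open>1 = 3 * \<eta> - a * \<alpha> - b * \<beta>\<close>.\<close>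
      have "t = of_int (3 * x) * \<eta> + of_int (y - int a * x) * \<alpha> + of_int (z - int b * x) * \<beta>"
        unfolding comb 1 by simp
      thus ?thesis by blast
    next
      case (2 p q r)
      hence "t = of_int p * \<eta> + of_int q * \<alpha> + of_int r * \<beta>" unfolding comb by simp
      thus ?thesis by blast
    qed
    moreover have "of_int p * \<eta> + of_int q * \<alpha> + of_int r * \<beta> \<in> ring_of_integers K" for p q r
      using alg[of p q r] el_in_K unfolding ring_of_integers_def comb by simp
    ultimately show "t \<in> ring_of_integers K \<longleftrightarrow> (\<exists>p q r :: int. t = of_int p * \<eta> + of_int q * \<alpha> + of_int r * \<beta>)"
      by blast
  qed
qed

lemma alpha_el: "\<alpha> = el 0 1 0" and beta_el: "\<beta> = el 0 0 1" and one_el: "1 = el 1 0 0"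
  by (simp_all add: el_def)

lemma field_trace_mult_el:
  "field_trace K (el x y z * el x' y' z') = of_rat (3 * (x * x' + of_nat (a * b) * (y * z' + z * y')))"
  unfolding el_mult by (rule field_trace_el)

lemmas field_trace_products =
  field_trace_mult_el[of 1 0 0 1 0 0, folded one_el] field_trace_mult_el[of 1 0 0 0 1 0, folded one_el alpha_el]
  field_trace_mult_el[of 1 0 0 0 0 1, folded one_el beta_el] field_trace_mult_el[of 0 1 0 1 0 0, folded one_el alpha_el]
  field_trace_mult_el[of 0 0 1 1 0 0, folded one_el beta_el] field_trace_mult_el[of 0 1 0 0 1 0, folded alpha_el]
  field_trace_mult_el[of 0 1 0 0 0 1, folded alpha_el beta_el] field_trace_mult_el[of 0 0 1 0 1 0, folded alpha_el beta_el]
  field_trace_mult_el[of 0 0 1 0 0 1, folded beta_el]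
  field_trace_mult_el[of "1 / 3" "of_nat a / 3" "of_nat b / 3" "1 / 3" "of_nat a / 3" "of_nat b / 3", folded \<eta>_def]
  field_trace_mult_el[of "1 / 3" "of_nat a / 3" "of_nat b / 3" 0 1 0, folded \<eta>_def alpha_el]
  field_trace_mult_el[of "1 / 3" "of_nat a / 3" "of_nat b / 3" 0 0 1, folded \<eta>_def beta_el]
  field_trace_mult_el[of 0 1 0 "1 / 3" "of_nat a / 3" "of_nat b / 3", folded \<eta>_def alpha_el]
  field_trace_mult_el[of 0 0 1 "1 / 3" "of_nat a / 3" "of_nat b / 3", folded \<eta>_def beta_el]

text \<open>The only nonzero traces of products of basis elements are 3 for \<open>1 * 1\<close> and
  \<open>3 a b\<close> for \<open>\<alpha> * \<beta>\<close>, so the determinant is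
  \<open>3 * (- (3 a b)^2)\<close>.\<close>

lemma discriminant_wild:
  assumes "\<not> tame" shows "discriminant K = - 27 * (int a)\<^sup>2 * (int b)\<^sup>2"
proof (rule discriminant_eqI[OF integral_basis_wild[OF assms]])
  show "Determinant.det (trace_gram K [1, \<alpha>, \<beta>]) = of_int (- 27 * (int a)\<^sup>2 * (int b)\<^sup>2)"
    unfolding det_trace_gram_3 field_trace_products
    by (simp add: of_rat_mult power2_eq_square)
qed

text \<open>The lattice spanned by \<open>1, \<alpha>, \<beta>\<close> has index 3 in this one,
  which accounts for the factor \<open>3^2\<close> lost against the wild case.\<close>

lemma discriminant_tame:
  assumes tame shows "discriminant K = - 3 * (int a)\<^sup>2 * (int b)\<^sup>2"
proof (rule discriminant_eqI[OF integral_basis_tame[OF assms]])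
  show "Determinant.det (trace_gram K [\<eta>, \<alpha>, \<beta>]) = of_int (- 3 * (int a)\<^sup>2 * (int b)\<^sup>2)"
    unfolding det_trace_gram_3 field_trace_products
    by (simp add: of_rat_mult of_rat_add of_rat_divide power2_eq_square field_simps)
qed

end

section \<open>Riemann sums over residue classes\<close>

text \<open>Each summand times \<open>(Q / T)^2\<close> is its integral over a cell of side
  \<open>Q / T\<close>, so the scaled sum is the integral of a step function \<open>\<Phi>\<close>
  that converges to \<open>F\<close> wherever \<open>F\<close> is continuous, and dominated
  convergence applies. Continuity almost everywhere admits jumps at the boundary of the
  sector.\<close>

lemma grid_sum_tendsto:
  fixes F :: "real \<times> real \<Rightarrow> real" and Q r s :: nat and J :: "real \<Rightarrow> nat"
  assumes bound: "\<And>p. \<bar>F p\<bar> \<le> B"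
    and supp: "\<And>u v. F (u, v) \<noteq> 0 \<Longrightarrow> 0 < u \<and> u \<le> M \<and> 0 < v \<and> v \<le> M"
    and meas: "F \<in> borel_measurable borel"
    and cont: "AE p in lborel. isCont F p"
    and Q: "r < Q" "s < Q"
    and J: "\<And>T. M * T < real (J T)" "\<And>T. T \<ge> 1 \<Longrightarrow> real (J T) \<le> L * T"
  shows "((\<lambda>T. (\<Sum>j<J T. \<Sum>k<J T. F (real (r + Q * j) / T, real (s + Q * k) / T)) / T\<^sup>2)
    \<longlongrightarrow> (\<integral>p. F p \<partial>lborel) / (real Q)\<^sup>2) at_top"
proof -
  \<comment> \<open>Cells are half-open: a point of the quadrant lies in exactly one along each
    axis, with a floor as index, and this gives \<open>\<Phi>\<close> a closed form.\<close>
  define cell where "cell = (\<lambda>T j. {real (Q * j) / T ..< real (Q * (j + 1)) / T})"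
  define \<Phi> where "\<Phi> = (\<lambda>T p. \<Sum>j<J T. \<Sum>k<J T.
    F (real (r + Q * j) / T, real (s + Q * k) / T) * indicator (cell T j \<times> cell T k) p)"
  have Q0: "real Q > 0" using Q by simp
  have B0: "B \<ge> 0" using bound[of "(0, 0)"] by linarith
  have cell_iff: "u \<in> cell T j \<longleftrightarrow> 0 \<le> u \<and> j = nat \<lfloor>u * T / Q\<rfloor>" if "T > 0" for u T j
  proof -
    have "u \<in> cell T j \<longleftrightarrow> real j \<le> u * T / Q \<and> u * T / Q < real j + 1"
      using that Q0 by (simp add: cell_def field_simps)
    also have "\<dots> \<longleftrightarrow> \<lfloor>u * T / Q\<rfloor> = int j" by (simp add: floor_eq_iff)
    also have "\<dots> \<longleftrightarrow> 0 \<le> \<lfloor>u * T / Q\<rfloor> \<and> j = nat \<lfloor>u * T / Q\<rfloor>"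
      using eq_nat_nat_iff by (metis nat_int of_nat_0_le_iff int_nat_eq)
    also have "0 \<le> \<lfloor>u * T / Q\<rfloor> \<longleftrightarrow> 0 \<le> u"
      using that Q0 by (simp add: zero_le_mult_iff zero_le_divide_iff)
    finally show ?thesis .
  qed
  have \<Phi>_eq: "\<Phi> T (u, v) = (if 0 \<le> u \<and> 0 \<le> v then
      F (real (r + Q * nat \<lfloor>u * T / Q\<rfloor>) / T, real (s + Q * nat \<lfloor>v * T / Q\<rfloor>) / T) else 0)"
    if T: "T > 0" for T u v
  proof (cases "0 \<le> u \<and> 0 \<le> v")
    case True
    define j0 k0 where "j0 = nat \<lfloor>u * T / Q\<rfloor>" and "k0 = nat \<lfloor>v * T / Q\<rfloor>"
    have "\<Phi> T (u, v) = (\<Sum>j<J T. \<Sum>k<J T. if j = j0 then if k = k0 then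
        F (real (r + Q * j0) / T, real (s + Q * k0) / T) else 0 else 0)"
      unfolding \<Phi>_def using cell_iff[OF T] True
      by (intro sum.cong refl) (auto simp: j0_def k0_def indicator_def)
    also have "\<dots> = (if j0 < J T \<and> k0 < J T then F (real (r + Q * j0) / T, real (s + Q * k0) / T) else 0)"
    proof -
      have "(\<Sum>j<n. \<Sum>k<m. if j = j0 then if k = k0 then x else 0 else 0)
          = (\<Sum>j<n. if j = j0 then \<Sum>k<m. if k = k0 then x else 0 else 0)" for n m and x :: real
        by (intro sum.cong) auto
      thus ?thesis by simp
    qed
    also have "\<dots> = F (real (r + Q * j0) / T, real (s + Q * k0) / T)"
    proof -
      \<comment> \<open>Indices from \<open>J T\<close> on sample beyond \<open>M\<close>, where
        \<open>F\<close> vanishes, so truncating the sum at \<open>J T\<close> loses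
        nothing.\<close>
      have out: "M < real (q + Q * i) / T" if "\<not> i < J T" for q i
      proof -
        have "M * T < real (J T)" by (rule J)
        also have "\<dots> \<le> real (1 * i)" using that by simp
        also have "\<dots> \<le> real (q + Q * i)" using Q by (intro of_nat_mono) (simp add: trans_le_add2)
        finally show ?thesis using T by (simp add: field_simps)
      qed
      show ?thesis using out[of j0 r] out[of k0 s] supp by (auto simp: not_less dest: leD)
    qed
    finally show ?thesis using True by (simp add: j0_def k0_def)
  next
    case False
    hence "\<Phi> T (u, v) = 0" unfolding \<Phi>_def using cell_iff[OF T] by (auto intro!: sum.neutral simp: indicator_def)
    thus ?thesis using False by auto
  qed
  have cell_meas: "cell T j \<in> sets borel" "emeasure lborel (cell T j) = ennreal (Q / T)" if "T > 0" for T j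
    using that Q0 by (simp_all add: cell_def field_simps)
  have cell_int: "integrable lborel (indicator (cell T j \<times> cell T k) :: real \<times> real \<Rightarrow> real)"
    "(\<integral>p. indicator (cell T j \<times> cell T k) p \<partial>lborel) = (Q / T)\<^sup>2" if "T > 0" for T j k
  proof -
    have s: "cell T j \<times> cell T k \<in> sets (lborel :: (real \<times> real) measure)"
      using cell_meas[OF that] by (simp add: borel_prod[symmetric])
    have e: "emeasure (lborel :: (real \<times> real) measure) (cell T j \<times> cell T k) = ennreal ((Q / T)\<^sup>2)"
      using cell_meas[OF that] that
      by (simp add: lborel_prod[symmetric] lborel.emeasure_pair_measure_Times power2_eq_square flip: ennreal_mult)
    show "integrable lborel (indicator (cell T j \<times> cell T k) :: real \<times> real \<Rightarrow> real)"
      using s e by (intro integrable_real_indicator) simp_all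
    show "(\<integral>p. indicator (cell T j \<times> cell T k) p \<partial>lborel) = (Q / T)\<^sup>2"
      using s e by (simp add: measure_def)
  qed
  have int_\<Phi>: "(\<integral>p. \<Phi> T p \<partial>lborel) =
      (\<Sum>j<J T. \<Sum>k<J T. F (real (r + Q * j) / T, real (s + Q * k) / T)) * (Q / T)\<^sup>2" if "T > 0" for T
  proof -
    let ?t = "\<lambda>j k p. F (real (r + Q * j) / T, real (s + Q * k) / T) * indicator (cell T j \<times> cell T k) p"
    have i: "integrable lborel (?t j k)" for j k
      by (intro integrable_mult_right cell_int(1) that)
    have "(\<integral>p. \<Phi> T p \<partial>lborel) = (\<Sum>j<J T. \<integral>p. (\<Sum>k<J T. ?t j k p) \<partial>lborel)"
      unfolding \<Phi>_def by (intro Bochner_Integration.integral_sum Bochner_Integration.integrable_sum i)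
    also have "\<dots> = (\<Sum>j<J T. \<Sum>k<J T. \<integral>p. ?t j k p \<partial>lborel)"
      by (intro sum.cong refl Bochner_Integration.integral_sum i)
    also have "\<dots> = (\<Sum>j<J T. \<Sum>k<J T. F (real (r + Q * j) / T, real (s + Q * k) / T) * (Q / T)\<^sup>2)"
      by (simp only: integral_mult_right_zero cell_int(2)[OF that])
    finally show ?thesis by (simp only: sum_distrib_right)
  qed
  have lim: "((\<lambda>T. \<integral>p. \<Phi> T p \<partial>lborel) \<longlongrightarrow> (\<integral>p. F p \<partial>lborel)) at_top"
  proof (rule integral_dominated_convergence_at_top)
    show "F \<in> borel_measurable lborel" using meas by simp
    show "\<Phi> T \<in> borel_measurable lborel" for T
    proof -
      have "cell T j \<times> cell T k \<in> sets borel" for j k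
        by (simp add: cell_def borel_prod[symmetric])
      thus ?thesis unfolding \<Phi>_def by measurable
    qed
    \<comment> \<open>For \<open>T \<ge> 1\<close> the bound \<open>J T \<le> L * T\<close> keeps
      all cells in a square independent of \<open>T\<close>, on which the constant \<open>B\<close>
      dominates.\<close>
    define C where "C = Q * (L + 1)"
    show "integrable lborel (\<lambda>p. B * indicator (cbox (0, 0) (C, C)) p :: real)"
      by (intro integrable_mult_right integrable_real_indicator emeasure_lborel_cbox_finite) simp
    show "\<forall>\<^sub>F T in at_top. AE p in lborel. norm (\<Phi> T p) \<le> B * indicator (cbox (0, 0) (C, C)) p"
      using eventually_ge_at_top[of 1]
    proof eventually_elim
      case (elim T)
      have "norm (\<Phi> T (u, v)) \<le> B * indicator (cbox (0, 0) (C, C)) (u, v)" for u v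
      proof (cases "\<exists>j<J T. \<exists>k<J T. u \<in> cell T j \<and> v \<in> cell T k")
        case False
        hence "\<Phi> T (u, v) = 0" unfolding \<Phi>_def by (auto intro!: sum.neutral simp: indicator_def)
        thus ?thesis using B0 by simp
      next
        case True
        then obtain j k where jk: "j < J T" "k < J T" "u \<in> cell T j" "v \<in> cell T k" by blast
        have le: "w \<le> C" if "w \<in> cell T i" "i < J T" for w i
        proof -
          have "w \<le> Q * (real i + 1) / T" using that by (simp add: cell_def algebra_simps)
          also have "\<dots> \<le> Q * (L * T) / T" 
            using that J(2)[OF elim] Q0 elim by (intro divide_right_mono mult_left_mono) linarith+
          also have "\<dots> \<le> C" using elim Q0 by (simp add: C_def field_simps)
          finally show ?thesis .
        qed
        have "u \<le> C" "v \<le> C" "0 \<le> u" "0 \<le> v" using le jk cell_iff elim by auto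
        hence "(u, v) \<in> cbox (0, 0) (C, C)" by (simp add: cbox_Pair_eq)
        thus ?thesis using \<Phi>_eq[of T u v] elim bound B0 by simp
      qed
      thus ?case by auto
    qed
    show "AE p in lborel. ((\<lambda>T. \<Phi> T p) \<longlongrightarrow> F p) at_top"
      using cont
    proof eventually_elim
      case (elim p)
      obtain u v where p: "p = (u, v)" by force
      show ?case
      proof (cases "0 \<le> u \<and> 0 \<le> v")
        case True
        have lim1: "((\<lambda>T. real (q + Q * nat \<lfloor>w * T / Q\<rfloor>) / T) \<longlongrightarrow> w) at_top" if "0 \<le> w" for q w
        proof (rule tendsto_sandwich)
          show "\<forall>\<^sub>F T in at_top. w - Q / T \<le> real (q + Q * nat \<lfloor>w * T / Q\<rfloor>) / T"
            using eventually_gt_at_top[of 0]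
          proof eventually_elim
            case (elim T)
            have "w * T / Q - 1 \<le> real (nat \<lfloor>w * T / Q\<rfloor>)" using that elim by (simp add: of_nat_nat)
            hence "Q * (w * T / Q - 1) \<le> Q * real (nat \<lfloor>w * T / Q\<rfloor>)" using Q0 by (intro mult_left_mono) auto
            hence "w * T - Q \<le> real (q + Q * nat \<lfloor>w * T / Q\<rfloor>)" using Q0 by (simp add: field_simps)
            thus ?case using elim by (simp add: field_simps)
          qed
          show "\<forall>\<^sub>F T in at_top. real (q + Q * nat \<lfloor>w * T / Q\<rfloor>) / T \<le> w + q / T"
            using eventually_gt_at_top[of 0]
          proof eventually_elim
            case (elim T)
            have "real (nat \<lfloor>w * T / Q\<rfloor>) \<le> w * T / Q" using that elim by (simp add: of_nat_nat)
            hence "Q * real (nat \<lfloor>w * T / Q\<rfloor>) \<le> Q * (w * T / Q)" using Q0 by (intro mult_left_mono) auto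
            hence "real (q + Q * nat \<lfloor>w * T / Q\<rfloor>) \<le> q + w * T" using Q0 by simp
            hence "real (q + Q * nat \<lfloor>w * T / Q\<rfloor>) / T \<le> (q + w * T) / T"
              using elim by (intro divide_right_mono) simp_all
            thus ?case using elim by (simp add: add_divide_distrib)
          qed
          show "((\<lambda>T. w - Q / T) \<longlongrightarrow> w) at_top" by real_asymp
          show "((\<lambda>T. w + q / T) \<longlongrightarrow> w) at_top" by real_asymp
        qed
        have "((\<lambda>T. (real (r + Q * nat \<lfloor>u * T / Q\<rfloor>) / T, real (s + Q * nat \<lfloor>v * T / Q\<rfloor>) / T)) \<longlongrightarrow> p) at_top"
          unfolding p using True by (intro tendsto_Pair lim1) auto
        hence "((\<lambda>T. F (real (r + Q * nat \<lfloor>u * T / Q\<rfloor>) / T, real (s + Q * nat \<lfloor>v * T / Q\<rfloor>) / T)) \<longlongrightarrow> F p) at_top"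
          by (rule isCont_tendsto_compose[OF elim])
        thus ?thesis
          by (rule Lim_transform_eventually)
            (use eventually_gt_at_top[of 0] in eventually_elim, use True in \<open>simp add: p \<Phi>_eq\<close>)
      next
        case False
        hence "F p = 0" using supp[of u v] by (cases "F p = 0") (auto simp: p)
        thus ?thesis
          by (intro tendsto_eventually)
            (use eventually_gt_at_top[of 0] in eventually_elim, use False in \<open>auto simp: p \<Phi>_eq\<close>)
      qed
    qed
  qed
  have "((\<lambda>T. (\<integral>p. \<Phi> T p \<partial>lborel) / (real Q)\<^sup>2) \<longlongrightarrow> (\<integral>p. F p \<partial>lborel) / (real Q)\<^sup>2) at_top"
    using Q0 by (intro tendsto_divide lim tendsto_const) simp
  thus ?thesis
    by (rule Lim_transform_eventually)
      (use eventually_gt_at_top[of 0] in eventually_elim, use Q0 in \<open>simp add: int_\<Phi> power_divide\<close>)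
qed

section \<open>Sieving pairs of coprime squarefree integers\<close>

definition squarefree_at :: "nat \<Rightarrow> nat \<Rightarrow> nat \<Rightarrow> bool" where
  "squarefree_at p a b \<longleftrightarrow> \<not> p\<^sup>2 dvd a \<and> \<not> p\<^sup>2 dvd b \<and> \<not> (p dvd a \<and> p dvd b)"

lemma squarefree_coprime_iff:
  "coprime a b \<and> squarefree a \<and> squarefree b \<longleftrightarrow> (\<forall>p. Factorial_Ring.prime p \<longrightarrow> squarefree_at p a b)"
  for a b :: nat
proof (cases "a = 0 \<or> b = 0")
  case True
  \<comment> \<open>The square of every prime divides 0.\<close>
  hence "\<not> squarefree_at 2 a b" by (auto simp: squarefree_at_def)
  thus ?thesis using True two_is_prime_nat by auto
next
  case False
  have "coprime a b \<longleftrightarrow> (\<forall>p. Factorial_Ring.prime p \<longrightarrow> \<not> (p dvd a \<and> p dvd b))"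
  proof
    assume "coprime a b"
    thus "\<forall>p. Factorial_Ring.prime p \<longrightarrow> \<not> (p dvd a \<and> p dvd b)"
      by (meson coprime_common_divisor not_prime_unit)
  next
    assume *: "\<forall>p. Factorial_Ring.prime p \<longrightarrow> \<not> (p dvd a \<and> p dvd b)"
    show "coprime a b"
    proof (rule ccontr)
      assume "\<not> coprime a b"
      hence "gcd a b \<noteq> 1" by (simp add: coprime_iff_gcd_eq_1)
      then obtain p where "Factorial_Ring.prime p" "p dvd gcd a b" using prime_factor_nat by blast
      thus False using * by simp
    qed
  qed
  thus ?thesis using False by (auto simp: squarefree_at_def squarefree_factorial_semiring)
qed

definition tame_pair :: "nat \<Rightarrow> nat \<Rightarrow> bool" where
  "tame_pair a b \<longleftrightarrow> \<not> 3 dvd a \<and> \<not> 3 dvd b \<and> a\<^sup>2 mod 9 = b\<^sup>2 mod 9"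

text \<open>The type depends on \<open>a\<close> and \<open>b\<close> modulo 9, the square of 3.
  Imposing it as part of the condition at 3 keeps every local condition periodic modulo
  \<open>p^2\<close>.\<close>

definition good_at :: "cubic_type \<Rightarrow> nat \<Rightarrow> nat \<Rightarrow> nat \<Rightarrow> bool" where
  "good_at t p a b \<longleftrightarrow> squarefree_at p a b \<and> (p = 3 \<longrightarrow> (t = TypeII \<longleftrightarrow> tame_pair a b))"

lemma good_at_periodic: "good_at t p (a mod p\<^sup>2) (b mod p\<^sup>2) \<longleftrightarrow> good_at t p a b"
proof -
  have 1: "p dvd x mod p\<^sup>2 \<longleftrightarrow> p dvd x" for x by (intro dvd_mod_iff) simp
  have 2: "p\<^sup>2 dvd x mod p\<^sup>2 \<longleftrightarrow> p\<^sup>2 dvd x" for x by (intro dvd_mod_iff) simp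
  have "tame_pair (a mod 9) (b mod 9) \<longleftrightarrow> tame_pair a b"
  proof -
    have "3 dvd x mod 9 \<longleftrightarrow> 3 dvd x" for x :: nat by (intro dvd_mod_iff) simp
    thus ?thesis by (simp add: tame_pair_def power_mod)
  qed
  thus ?thesis unfolding good_at_def squarefree_at_def 1 2 by auto
qed

section \<open>Residue classes and local densities\<close>

definition residue_count :: "nat \<Rightarrow> (nat \<Rightarrow> nat \<Rightarrow> bool) \<Rightarrow> nat" where
  "residue_count m P = card {(x, y). x < m \<and> y < m \<and> P x y}"

text \<open>The Chinese remainder theorem is applied in each coordinate; periodicity lets each
  condition be read off from its own residues.\<close>

lemma residue_count_mult:
  assumes co: "coprime m n" and m: "m > 0" and n: "n > 0"
    and P: "\<And>x y. P (x mod m) (y mod m) \<longleftrightarrow> P x y" and R: "\<And>x y. R (x mod n) (y mod n) \<longleftrightarrow> R x y"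
  shows "residue_count (m * n) (\<lambda>x y. P x y \<and> R x y) = residue_count m P * residue_count n R"
proof -
  let ?A = "{(x, y). x < m * n \<and> y < m * n \<and> P x y \<and> R x y}"
  let ?B = "{(x, y). x < m \<and> y < m \<and> P x y} \<times> {(x, y). x < n \<and> y < n \<and> R x y}"
  let ?f = "\<lambda>(x, y). ((x mod m, y mod m), (x mod n, y mod n))"
  have crt: "x = y" if "x < m * n" "y < m * n" "x mod m = y mod m" "x mod n = y mod n" for x y
    using binary_chinese_remainder_unique_nat[OF co, of "y mod m" "y mod n"] m n that
    unfolding cong_def by (metis mod_mod_trivial nat_less_le less_imp_neq mult_eq_0_iff)
  have "bij_betw ?f ?A ?B"
    unfolding bij_betw_def
  proof (intro conjI equalityI subsetI)
    show "inj_on ?f ?A" by (auto intro!: inj_onI crt)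
  next
    fix w assume "w \<in> ?f ` ?A"
    thus "w \<in> ?B" using m n by (auto simp: P R)
  next
    fix w assume "w \<in> ?B"
    then obtain x y x' y' where w: "w = ((x, y), (x', y'))" and b: "x < m" "y < m" "P x y" "x' < n" "y' < n" "R x' y'"
      by auto
    obtain u where u: "u < m * n" "u mod m = x" "u mod n = x'"
      using binary_chinese_remainder_unique_nat[OF co, of x x'] m n b by (auto simp: cong_def)
    obtain v where v: "v < m * n" "v mod m = y" "v mod n = y'"
      using binary_chinese_remainder_unique_nat[OF co, of y y'] m n b by (auto simp: cong_def)
    have "(u, v) \<in> ?A" using u v b P[of u v] R[of u v] by simp
    thus "w \<in> ?f ` ?A" by (rule rev_image_eqI) (simp add: w u v)
  qed
  thus ?thesis unfolding residue_count_def by (simp add: bij_betw_same_card card_cartesian_product)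
qed

lemma residue_count_primes:
  assumes "finite S" "\<And>p. p \<in> S \<Longrightarrow> Factorial_Ring.prime p"
  shows "residue_count (\<Prod>p\<in>S. p\<^sup>2) (\<lambda>a b. \<forall>p\<in>S. good_at t p a b) = (\<Prod>p\<in>S. residue_count (p\<^sup>2) (good_at t p))"
  using assms
proof (induction S rule: finite_induct)
  case empty
  have "{(x, y). x < (1::nat) \<and> y < (1::nat)} = {(0, 0)}" by auto
  thus ?case by (simp add: residue_count_def)
next
  case (insert q S)
  have co: "coprime (q\<^sup>2) (\<Prod>p\<in>S. p\<^sup>2)"
  proof (rule prod_coprime_right)
    fix p assume "p \<in> S"
    hence "coprime q p" using insert by (intro primes_coprime) auto
    thus "coprime (q\<^sup>2) (p\<^sup>2)" by simp
  qed
  have per: "(\<forall>p\<in>S. good_at t p (x mod (\<Prod>p\<in>S. p\<^sup>2)) (y mod (\<Prod>p\<in>S. p\<^sup>2))) \<longleftrightarrow> (\<forall>p\<in>S. good_at t p x y)" for x y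
  proof (rule ball_cong[OF refl])
    fix p assume "p \<in> S"
    hence d: "p\<^sup>2 dvd (\<Prod>p\<in>S. p\<^sup>2)" using insert(1) by (intro dvd_prodI)
    have "x mod (\<Prod>p\<in>S. p\<^sup>2) mod p\<^sup>2 = x mod p\<^sup>2" for x by (rule mod_mod_cancel[OF d])
    thus "good_at t p (x mod (\<Prod>p\<in>S. p\<^sup>2)) (y mod (\<Prod>p\<in>S. p\<^sup>2)) = good_at t p x y"
      by (metis good_at_periodic)
  qed
  have pos: "q\<^sup>2 > 0" "(\<Prod>p\<in>S. p\<^sup>2) > 0" 
    using prime_gt_0_nat[OF insert.prems] by (auto intro!: prod_pos)
  show ?case
    using residue_count_mult[of "q\<^sup>2" "\<Prod>p\<in>S. p\<^sup>2" "good_at t q" "\<lambda>x y. \<forall>p\<in>S. good_at t p x y"]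
      co pos good_at_periodic per insert by simp
qed

lemma card_multiples:
  assumes "p > 0" shows "card {x. x < p\<^sup>2 \<and> p dvd x} = (p :: nat)"
proof -
  have "{x. x < p\<^sup>2 \<and> p dvd x} = (\<lambda>i. p * i) ` {..<p}"
    using assms by (auto simp: power2_eq_square elim!: dvdE)
  thus ?thesis using assms by (simp add: card_image inj_on_def)
qed

text \<open>With \<open>U\<close> the residues prime to \<open>p\<close> and \<open>V\<close> the
  nonzero multiples of \<open>p\<close>, the admissible pairs form
  \<open>U \<times> (U \<union> V)\<close> and \<open>V \<times> U\<close>. As \<open>U\<close> has
  \<open>p^2 - p\<close> and \<open>V\<close> has \<open>p - 1\<close> elements, their number is
  \<open>p^4 - 3 p^2 + 2 p\<close>.\<close>

lemma residue_count_squarefree_at: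
  assumes "Factorial_Ring.prime p"
  shows "real (residue_count (p\<^sup>2) (squarefree_at p)) / real p ^ 4 = 1 - 3 / real p ^ 2 + 2 / real p ^ 3"
proof -
  have p: "p > 1" using assms by (rule prime_gt_1_nat)
  define U where "U = {x. x < p\<^sup>2 \<and> \<not> p dvd x}"
  define V where "V = {x. x < p\<^sup>2 \<and> p dvd x} - {0}"
  have fin: "finite U" "finite V" by (auto simp: U_def V_def)
  have disj: "U \<inter> V = {}" by (auto simp: U_def V_def)
  have cV: "card V = p - 1" using p by (simp add: V_def card_multiples)
  have "{..<p\<^sup>2} = U \<union> {x. x < p\<^sup>2 \<and> p dvd x}" by (auto simp: U_def)
  hence "p\<^sup>2 = card (U \<union> {x. x < p\<^sup>2 \<and> p dvd x})" by (metis card_lessThan)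
  also have "\<dots> = card U + p"
    using p fin by (subst card_Un_disjoint) (auto simp: U_def card_multiples)
  finally have cU: "real (card U) = real p ^ 2 - real p" by (simp flip: of_nat_power)
  have zero: "p\<^sup>2 dvd x \<longleftrightarrow> x = 0" if "x < p\<^sup>2" for x using that by (auto dest: dvd_imp_le)
  have S: "{(x, y). x < p\<^sup>2 \<and> y < p\<^sup>2 \<and> squarefree_at p x y} = U \<times> (U \<union> V) \<union> V \<times> U"
    by (auto simp: U_def V_def squarefree_at_def zero)
  have "card (U \<times> (U \<union> V) \<union> V \<times> U) = card U * (card U + card V) + card V * card U"
    using fin disj by (subst card_Un_disjoint) (auto simp: card_cartesian_product card_Un_disjoint)
  hence "real (residue_count (p\<^sup>2) (squarefree_at p)) =
      real (card U) * (real (card U) + real (card V)) + real (card V) * real (card U)"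
    unfolding residue_count_def S by simp
  also have "real (card V) = real p - 1" using cV p by simp
  finally have "real (residue_count (p\<^sup>2) (squarefree_at p)) = real p ^ 4 - 3 * real p ^ 2 + 2 * real p"
    unfolding cU by (simp add: algebra_simps power2_eq_square power4_eq_xxxx)
  hence "real (residue_count (p\<^sup>2) (squarefree_at p)) / real p ^ 4
      = real p ^ 4 / real p ^ 4 - 3 * real p ^ 2 / real p ^ 4 + 2 * real p / real p ^ 4"
    by (simp add: add_divide_distrib diff_divide_distrib)
  moreover have "3 * real p ^ 2 / real p ^ 4 = 3 / real p ^ 2"
    using p by (simp add: power4_eq_xxxx power2_eq_square)
  moreover have "2 * real p / real p ^ 4 = 2 / real p ^ 3"
    using p by (simp add: power4_eq_xxxx power3_eq_cube)
  moreover have "real p ^ 4 / real p ^ 4 = 1" using p by simp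
  ultimately show ?thesis by (simp only:)
qed

text \<open>Turns a count into a list computation that \<open>simp\<close> can evaluate.\<close>

lemma residue_count_eq_length:
  "residue_count m P = length (filter (\<lambda>(x, y). P x y) (List.product [0..<m] [0..<m]))"
proof -
  have "{(x, y). x < m \<and> y < m \<and> P x y} = set (filter (\<lambda>(x, y). P x y) (List.product [0..<m] [0..<m]))"
    by auto
  thus ?thesis
    unfolding residue_count_def by (simp only:) (intro distinct_card distinct_filter distinct_product distinct_upt)
qed

text \<open>The local condition at 3 split by type: \<open>12 / 60\<close> and
  \<open>48 / 60\<close> are the values of \<open>type_share\<close>.\<close>

lemma residue_count_9:
  "residue_count 9 (good_at TypeII 3) = 12" "residue_count 9 (good_at TypeI 3) = 48"
  "residue_count 9 (squarefree_at 3) = 60"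
proof -
  have 9: "[0..<9] = [0, 1, 2, 3, 4, 5, 6, 7, 8]" by (simp add: upt_rec)
  show "residue_count 9 (good_at TypeII 3) = 12"
    unfolding residue_count_eq_length good_at_def squarefree_at_def tame_pair_def 9 by simp
  show "residue_count 9 (good_at TypeI 3) = 48"
    unfolding residue_count_eq_length good_at_def squarefree_at_def tame_pair_def 9 by simp
  show "residue_count 9 (squarefree_at 3) = 60"
    unfolding residue_count_eq_length squarefree_at_def 9 by simp
qed

definition primes_upto :: "nat \<Rightarrow> nat set" where
  "primes_upto z = {p. Factorial_Ring.prime p \<and> p \<le> z}"

lemma finite_primes_upto [simp]: "finite (primes_upto z)"
  unfolding primes_upto_def by (rule finite_subset[of _ "{..z}"]) auto

definition type_share :: "cubic_type \<Rightarrow> real" where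
  "type_share t = (if t = TypeI then 4 / 5 else 1 / 5)"

definition sieve_modulus :: "nat \<Rightarrow> nat" where
  "sieve_modulus z = (\<Prod>p\<in>primes_upto z. p\<^sup>2)"

definition sieved :: "cubic_type \<Rightarrow> nat \<Rightarrow> nat \<Rightarrow> nat \<Rightarrow> bool" where
  "sieved t z a b \<longleftrightarrow> (\<forall>p\<in>primes_upto z. good_at t p a b)"

text \<open>The bound \<open>z \<ge> 3\<close> brings in the prime 3, whose factor carries the share
  of the type.\<close>

lemma sieved_density:
  assumes "z \<ge> 3"
  shows "real (residue_count (sieve_modulus z) (sieved t z)) / real (sieve_modulus z) ^ 2 =
    type_share t * (\<Prod>p\<le>z. if Factorial_Ring.prime p then 1 - 3 / real p ^ 2 + 2 / real p ^ 3 else 1)"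
proof -
  let ?l = "\<lambda>p. 1 - 3 / real p ^ 2 + 2 / real p ^ 3"
  have 3: "3 \<in> primes_upto z" using assms by (simp add: primes_upto_def)
  have "sieved t z = (\<lambda>a b. \<forall>p\<in>primes_upto z. good_at t p a b)" by (simp add: sieved_def fun_eq_iff)
  hence "residue_count (sieve_modulus z) (sieved t z) = (\<Prod>p\<in>primes_upto z. residue_count (p\<^sup>2) (good_at t p))"
    unfolding sieve_modulus_def
    by (simp only:) (rule residue_count_primes, simp, simp add: primes_upto_def)
  moreover have "real (sieve_modulus z) ^ 2 = (\<Prod>p\<in>primes_upto z. real p ^ 4)"
    by (simp add: sieve_modulus_def flip: power_mult prod_power_distrib)
  ultimately have "real (residue_count (sieve_modulus z) (sieved t z)) / real (sieve_modulus z) ^ 2 =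
     (\<Prod>p\<in>primes_upto z. real (residue_count (p\<^sup>2) (good_at t p))) / (\<Prod>p\<in>primes_upto z. real p ^ 4)"
    by simp
  also have "\<dots> = (\<Prod>p\<in>primes_upto z. real (residue_count (p\<^sup>2) (good_at t p)) / real p ^ 4)"
    by (rule prod_dividef[symmetric])
  also have "\<dots> = (\<Prod>p\<in>primes_upto z. (if p = 3 then type_share t else 1) * ?l p)"
  proof (rule prod.cong[OF refl])
    fix p assume "p \<in> primes_upto z"
    hence p: "Factorial_Ring.prime p" by (simp add: primes_upto_def)
    show "real (residue_count (p\<^sup>2) (good_at t p)) / real p ^ 4 = (if p = 3 then type_share t else 1) * ?l p"
    proof (cases "p = 3")
      case False
      hence "good_at t p = squarefree_at p" by (auto simp: good_at_def fun_eq_iff)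
      thus ?thesis using False residue_count_squarefree_at[OF p] by simp
    next
      case True
      thus ?thesis by (cases t) (simp_all add: residue_count_9 type_share_def)
    qed
  qed
  also have "\<dots> = type_share t * (\<Prod>p\<in>primes_upto z. ?l p)"
    using 3 by (simp add: prod.distrib)
  also have "(\<Prod>p\<in>primes_upto z. ?l p) = (\<Prod>p\<le>z. if Factorial_Ring.prime p then ?l p else 1)"
    by (rule prod.mono_neutral_cong_left) (auto simp: primes_upto_def)
  finally show ?thesis .
qed

section \<open>The Euler product\<close>

text \<open>The factor equals \<open>(p - 1)^2 (p + 2) / p^3\<close>.\<close>

lemma local_factor_pos:
  assumes "p > 1" shows "1 - 3 / real p ^ 2 + 2 / real p ^ 3 > 0"
proof -
  have "(real p - 1)\<^sup>2 * (real p + 2) = real p ^ 3 - 3 * real p + 2"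
    by (simp add: power2_eq_square power3_eq_cube algebra_simps)
  hence "(real p - 1)\<^sup>2 * (real p + 2) / real p ^ 3 = real p ^ 3 / real p ^ 3 - 3 * real p / real p ^ 3 + 2 / real p ^ 3"
    by (simp only: add_divide_distrib diff_divide_distrib)
  moreover have "3 * real p / real p ^ 3 = 3 / real p ^ 2" using assms by (simp add: power2_eq_square power3_eq_cube)
  moreover have "real p ^ 3 / real p ^ 3 = 1" using assms by simp
  ultimately have "1 - 3 / real p ^ 2 + 2 / real p ^ 3 = (real p - 1)\<^sup>2 * (real p + 2) / real p ^ 3" by simp
  also have "\<dots> > 0" using assms by (intro divide_pos_pos mult_pos_pos) auto
  finally show ?thesis .
qed

abbreviation euler_factor :: "nat \<Rightarrow> real" where
  "euler_factor p \<equiv> if Factorial_Ring.prime p then 1 - 3 / real p ^ 2 + 2 / real p ^ 3 else 1"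

lemma euler_product: "convergent_prod euler_factor"
proof -
  have "summable (\<lambda>p. norm (euler_factor p - 1))"
  proof (rule summable_comparison_test)
    show "\<exists>N. \<forall>p\<ge>N. norm (norm (euler_factor p - 1)) \<le> 5 * inverse (real p ^ 2)"
    proof (intro exI[of _ 1] allI impI)
      fix p :: nat assume "p \<ge> 1"
      define A C where "A = inverse (real p ^ 2)" and "C = inverse (real p ^ 3)"
      have "0 \<le> C" "C \<le> A"
        using \<open>p \<ge> 1\<close> by (auto simp: A_def C_def intro!: le_imp_inverse_le power_increasing)
      moreover have "euler_factor p - 1 = (if Factorial_Ring.prime p then 2 * C - 3 * A else 0)"
        by (simp add: A_def C_def divide_inverse)
      ultimately have "norm (euler_factor p - 1) \<le> 5 * A" by (simp add: abs_le_iff)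
      thus "norm (norm (euler_factor p - 1)) \<le> 5 * inverse (real p ^ 2)" by (simp add: A_def)
    qed
    show "summable (\<lambda>p. 5 * inverse (real p ^ 2))"
      by (intro summable_mult inverse_power_summable) simp
  qed
  thus ?thesis
    by (intro abs_convergent_prod_imp_convergent_prod) (simp add: abs_convergent_prod_conv_summable)
qed

text \<open>A convergent infinite product with nonzero factors is nonzero. Positivity is required
  because the normalising constant stands in a denominator.\<close>

lemma density_const_pos: "density_const > 0" and euler_product_lim:
  "(\<lambda>z. \<Prod>p\<le>z. euler_factor p) \<longlonglongrightarrow> density_const"
proof -
  show lim: "(\<lambda>z. \<Prod>p\<le>z. euler_factor p) \<longlonglongrightarrow> density_const"
    unfolding density_const_def using convergent_prod_LIMSEQ[OF euler_product] .
  have pos: "euler_factor p > 0" for p using local_factor_pos[of p] by (auto dest: prime_gt_1_nat)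
  have "density_const \<noteq> 0"
    unfolding density_const_def using pos by (intro prodinf_nonzero euler_product) (metis less_irrefl)
  moreover have "density_const \<ge> 0"
    by (rule tendsto_lowerbound[OF lim]) (auto intro!: always_eventually prod_nonneg less_imp_le[OF pos])
  ultimately show "density_const > 0" by simp
qed

section \<open>Removing the truncation of the sieve\<close>

definition good :: "cubic_type \<Rightarrow> nat \<Rightarrow> nat \<Rightarrow> bool" where
  "good t a b \<longleftrightarrow> (\<forall>p. Factorial_Ring.prime p \<longrightarrow> good_at t p a b)"

lemma good_imp_sieved: "good t a b \<Longrightarrow> sieved t z a b"
  by (auto simp: good_def sieved_def primes_upto_def)

lemma card_multiples_le:
  assumes "k > 0" shows "real (card {x \<in> {1..n}. k dvd x}) \<le> real n / real k"
proof -
  have "{x \<in> {1..n}. k dvd x} \<subseteq> (\<lambda>i. k * i) ` {1..n div k}"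
  proof
    fix x assume x: "x \<in> {x \<in> {1..n}. k dvd x}"
    then obtain i where i: "x = k * i" by (auto elim: dvdE)
    with x have "i \<ge> 1" "i \<le> n div k" using assms by (auto simp: less_eq_div_iff_mult_less_eq mult.commute Suc_le_eq)
    thus "x \<in> (\<lambda>i. k * i) ` {1..n div k}" using i by auto
  qed
  hence "card {x \<in> {1..n}. k dvd x} \<le> card ((\<lambda>i. k * i) ` {1..n div k})" by (intro card_mono) auto
  also have "\<dots> \<le> n div k" using card_image_le[of "{1..n div k}"] by simp
  finally have "real (card {x \<in> {1..n}. k dvd x}) \<le> real (n div k)" by simp
  also have "\<dots> \<le> real n / real k" 
    using assms by (simp add: le_divide_eq flip: of_nat_mult)
  finally show ?thesis .
qed

lemma sum_inverse_squares_tail: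
  assumes "z > 0" shows "(\<Sum>d\<in>{z<..n}. 1 / (real d)\<^sup>2) \<le> 1 / real z"
proof -
  have "(\<Sum>d\<in>{z<..n}. 1 / (real d)\<^sup>2) \<le> 1 / real z - 1 / real n" if "z \<le> n"
    using that
  proof (induction n rule: dec_induct)
    case (step n)
    have n: "real n > 0" using assms step by simp
    have "{z<..Suc n} = insert (Suc n) {z<..n}" using step by auto
    hence "(\<Sum>d\<in>{z<..Suc n}. 1 / (real d)\<^sup>2) = (\<Sum>d\<in>{z<..n}. 1 / (real d)\<^sup>2) + 1 / (real (Suc n))\<^sup>2" by simp
    also have "1 / (real (Suc n))\<^sup>2 \<le> 1 / (real n * real (Suc n))"
      using n by (intro divide_left_mono) (auto simp: power2_eq_square)
    also have "1 / (real n * real (Suc n)) = 1 / real n - 1 / real (Suc n)"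
      using n by (simp add: diff_frac_eq)
    finally show ?case using step.IH by simp
  qed simp
  thus ?thesis using assms by (cases "z \<le> n") (force intro: order_trans)+
qed

text \<open>A prime \<open>d > z\<close> spoils at most \<open>3 n\<^sup>2 / d\<^sup>2\<close> pairs, and \<open>\<Sum>\<^sub>d 1 / d\<^sup>2\<close> telescopes.\<close>

lemma sieve_error:
  assumes "z \<ge> 3"
  shows "real (card {(a, b). a \<in> {1..n} \<and> b \<in> {1..n} \<and> sieved t z a b \<and> \<not> good t a b}) \<le> 3 * (real n)\<^sup>2 / real z"
proof -
  define D where "D = (\<lambda>k. {x \<in> {1..n}. k dvd x})"
  define E where "E = (\<lambda>d. D (d\<^sup>2) \<times> {1..n} \<union> {1..n} \<times> D (d\<^sup>2) \<union> D d \<times> D d)"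
  have cardD: "real (card (D k)) \<le> real n / real k" if "k > 0" for k
    unfolding D_def by (rule card_multiples_le[OF that])
  have finD: "finite (D k)" for k by (simp add: D_def)
  have "{(a, b). a \<in> {1..n} \<and> b \<in> {1..n} \<and> sieved t z a b \<and> \<not> good t a b} \<subseteq> (\<Union>d\<in>{z<..n}. E d)"
  proof clarify
    fix a b assume ab: "a \<in> {1..n}" "b \<in> {1..n}" and s: "sieved t z a b" and "\<not> good t a b"
    then obtain p where p: "Factorial_Ring.prime p" "\<not> good_at t p a b" by (auto simp: good_def)
    have "\<not> p \<le> z"
    proof
      assume "p \<le> z"
      hence "p \<in> primes_upto z" using p(1) by (simp add: primes_upto_def)
      with s p(2) show False unfolding sieved_def by blast
    qed
    hence "p > z" by simp
    \<comment> \<open>As \<open>p > z \<ge> 3\<close>, the type condition is not involved and the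
      squarefree condition must have failed.\<close>
    hence bad: "p\<^sup>2 dvd a \<or> p\<^sup>2 dvd b \<or> p dvd a \<and> p dvd b"
      using p(2) assms by (auto simp: good_at_def squarefree_at_def)
    hence "p dvd a \<or> p dvd b" by (auto simp: power2_eq_square dest: dvd_mult_left)
    hence "p \<le> n" using ab by (auto dest!: dvd_imp_le)
    with \<open>p > z\<close> have "p \<in> {z<..n}" by simp
    moreover have "(a, b) \<in> E p" using bad ab by (auto simp: E_def D_def)
    ultimately show "(a, b) \<in> (\<Union>d\<in>{z<..n}. E d)" by blast
  qed
  hence "card {(a, b). a \<in> {1..n} \<and> b \<in> {1..n} \<and> sieved t z a b \<and> \<not> good t a b} \<le> card (\<Union>d\<in>{z<..n}. E d)"
    by (intro card_mono) (auto simp: E_def finD)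
  also have "\<dots> \<le> (\<Sum>d\<in>{z<..n}. card (E d))" by (intro card_UN_le) simp
  finally have "real (card {(a, b). a \<in> {1..n} \<and> b \<in> {1..n} \<and> sieved t z a b \<and> \<not> good t a b})
      \<le> (\<Sum>d\<in>{z<..n}. real (card (E d)))" by (simp flip: of_nat_sum)
  also have "\<dots> \<le> (\<Sum>d\<in>{z<..n}. 3 * (real n)\<^sup>2 * (1 / (real d)\<^sup>2))"
  proof (rule sum_mono)
    fix d assume "d \<in> {z<..n}"
    hence d: "d > 0" by simp
    have "card (E d) \<le> card (D (d\<^sup>2)) * n + n * card (D (d\<^sup>2)) + card (D d) * card (D d)"
      unfolding E_def
      by (rule order_trans[OF card_Un_le] add_mono order_trans[OF card_Un_le])+
        (simp_all add: card_cartesian_product)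
    hence "real (card (E d)) \<le> real (card (D (d\<^sup>2)) * n + n * card (D (d\<^sup>2)) + card (D d) * card (D d))"
      by (simp only: of_nat_le_iff)
    also have "\<dots> = real (card (D (d\<^sup>2))) * n + n * real (card (D (d\<^sup>2))) + real (card (D d)) * real (card (D d))"
      by simp
    also have "\<dots> \<le> (real n / real (d\<^sup>2)) * n + n * (real n / real (d\<^sup>2)) + (real n / real d) * (real n / real d)"
      using d by (intro add_mono mult_mono mult_right_mono mult_left_mono cardD) auto
    also have "\<dots> = 3 * (real n)\<^sup>2 * (1 / (real d)\<^sup>2)" by (simp add: power2_eq_square)
    finally show "real (card (E d)) \<le> 3 * (real n)\<^sup>2 * (1 / (real d)\<^sup>2)" .
  qed
  also have "\<dots> = 3 * (real n)\<^sup>2 * (\<Sum>d\<in>{z<..n}. 1 / (real d)\<^sup>2)" by (simp only: sum_distrib_left)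
  also have "\<dots> \<le> 3 * (real n)\<^sup>2 * (1 / real z)"
    using assms by (intro mult_left_mono sum_inverse_squares_tail) auto
  finally show ?thesis by simp
qed

lemma sum_residue_classes:
  fixes f :: "nat \<Rightarrow> 'a :: comm_monoid_add"
  shows "(\<Sum>a<j * q. f a) = (\<Sum>r<q. \<Sum>i<j. f (r + q * i))"
proof -
  have "(\<Sum>a<j * q. f a) = (\<Sum>i<j. \<Sum>a\<in>{i * q..<i * q + q}. f a)" by (rule sum.nat_group[symmetric])
  also have "\<dots> = (\<Sum>i<j. \<Sum>r<q. f (r + q * i))"
  proof (rule sum.cong[OF refl])
    fix i
    have "(\<Sum>a\<in>{i * q..<i * q + q}. f a) = (\<Sum>a\<in>{0 + i * q..<q + i * q}. f a)" by (simp add: add.commute)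
    also have "\<dots> = (\<Sum>r\<in>{0..<q}. f (r + i * q))" by (rule sum.shift_bounds_nat_ivl)
    finally show "(\<Sum>a\<in>{i * q..<i * q + q}. f a) = (\<Sum>r<q. f (r + q * i))"
      by (simp add: lessThan_atLeast0 mult.commute)
  qed
  also have "\<dots> = (\<Sum>r<q. \<Sum>i<j. f (r + q * i))" by (rule sum.swap)
  finally show ?thesis .
qed

lemma sieve_modulus_pos: "sieve_modulus z > 0"
  unfolding sieve_modulus_def primes_upto_def by (intro prod_pos) (auto intro: prime_gt_0_nat)

lemma sieved_periodic:
  "sieved t z (r + sieve_modulus z * j) (s + sieve_modulus z * k) \<longleftrightarrow> sieved t z r s"
  unfolding sieved_def
proof (rule ball_cong[OF refl])
  fix p assume "p \<in> primes_upto z"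
  hence "p\<^sup>2 dvd sieve_modulus z" unfolding sieve_modulus_def by (intro dvd_prodI) simp_all
  then obtain c where c: "sieve_modulus z = p\<^sup>2 * c" by (rule dvdE)
  have "(x + sieve_modulus z * i) mod p\<^sup>2 = x mod p\<^sup>2" for x i
    unfolding c mult.assoc by (rule mod_mult_self2)
  thus "good_at t p (r + sieve_modulus z * j) (s + sieve_modulus z * k) = good_at t p r s"
    by (metis good_at_periodic)
qed

text \<open>After division by \<open>T^2\<close>, the sums \<open>S\<close> and \<open>Sz z\<close>
  differ by at most \<open>3 B L^2 / z\<close> for all \<open>T \<ge> 1\<close> and
  \<open>z \<ge> 3\<close>. This uniformity in \<open>T\<close> permits the interchange of the two
  limits.\<close>

lemma good_pairs_sum_tendsto:
  fixes F :: "real \<times> real \<Rightarrow> real" and J :: "real \<Rightarrow> nat"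
  assumes bound: "\<And>p. \<bar>F p\<bar> \<le> B"
    and supp: "\<And>u v. F (u, v) \<noteq> 0 \<Longrightarrow> 0 < u \<and> u \<le> M \<and> 0 < v \<and> v \<le> M"
    and meas: "F \<in> borel_measurable borel"
    and cont: "AE p in lborel. isCont F p"
    and J: "\<And>T. M * T < real (J T)" "\<And>T. T \<ge> 1 \<Longrightarrow> real (J T) \<le> L * T"
  shows "((\<lambda>T. (\<Sum>a<J T. \<Sum>b<J T. if good t a b then F (real a / T, real b / T) else 0) / T\<^sup>2)
    \<longlongrightarrow> type_share t * density_const * (\<integral>p. F p \<partial>lborel)) at_top"
proof -
  define I where "I = (\<integral>p. F p \<partial>lborel)"
  define S where "S = (\<lambda>T. \<Sum>a<J T. \<Sum>b<J T. if good t a b then F (real a / T, real b / T) else 0)"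
  define Sz where "Sz = (\<lambda>z T. \<Sum>a<J T. \<Sum>b<J T. if sieved t z a b then F (real a / T, real b / T) else 0)"
  define \<delta> where "\<delta> = (\<lambda>z. real (residue_count (sieve_modulus z) (sieved t z)) / real (sieve_modulus z) ^ 2)"
  have B0: "B \<ge> 0" using bound[of "(0, 0)"] by linarith
  have Sz_lim: "((\<lambda>T. Sz z T / T\<^sup>2) \<longlongrightarrow> \<delta> z * I) at_top" for z
  proof -
    let ?Q = "sieve_modulus z"
    have Q: "?Q > 0" by (rule sieve_modulus_pos)
    have "Sz z T = (\<Sum>r<?Q. \<Sum>s<?Q. if sieved t z r s then
        (\<Sum>j<J T. \<Sum>k<J T. F (real (r + ?Q * j) / T, real (s + ?Q * k) / T)) else 0)" if T: "T > 0" for T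
    proof -
      have zero: "F (real a / T, v) = 0" "F (v, real a / T) = 0" if "\<not> a < J T" for a v
      proof -
        have "M * T < real a" using J(1)[of T] that by linarith
        hence "M < real a / T" using T by (simp add: field_simps)
        thus "F (real a / T, v) = 0" "F (v, real a / T) = 0"
          using supp[of "real a / T" v] supp[of v "real a / T"] by force+
      qed
      \<comment> \<open>The range is extended to a multiple of the modulus; the terms added vanish
        by the support of \<open>F\<close>.\<close>
      have sub: "{..<J T} \<subseteq> {..<J T * ?Q}" using Q by (auto intro: order_less_le_trans)
      have "Sz z T = (\<Sum>a<J T * ?Q. \<Sum>b<J T * ?Q. if sieved t z a b then F (real a / T, real b / T) else 0)"
        unfolding Sz_def
      proof (rule sum.mono_neutral_cong_left)
        fix a
        show "(\<Sum>b<J T. if sieved t z a b then F (real a / T, real b / T) else 0) =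
          (\<Sum>b<J T * ?Q. if sieved t z a b then F (real a / T, real b / T) else 0)"
          by (rule sum.mono_neutral_left) (use sub in \<open>auto simp: zero\<close>)
      qed (use sub in \<open>auto simp: zero intro!: sum.neutral\<close>)
      also have "\<dots> = (\<Sum>r<?Q. \<Sum>j<J T. \<Sum>s<?Q. \<Sum>k<J T. if sieved t z (r + ?Q * j) (s + ?Q * k)
          then F (real (r + ?Q * j) / T, real (s + ?Q * k) / T) else 0)"
        by (simp only: sum_residue_classes)
      also have "\<dots> = (\<Sum>r<?Q. \<Sum>s<?Q. \<Sum>j<J T. \<Sum>k<J T. if sieved t z r s
          then F (real (r + ?Q * j) / T, real (s + ?Q * k) / T) else 0)"
        unfolding sieved_periodic by (intro sum.cong refl sum.swap)
      also have "\<dots> = (\<Sum>r<?Q. \<Sum>s<?Q. if sieved t z r s then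
        (\<Sum>j<J T. \<Sum>k<J T. F (real (r + ?Q * j) / T, real (s + ?Q * k) / T)) else 0)"
        by (intro sum.cong refl) auto
      finally show ?thesis .
    qed
    hence ev: "\<forall>\<^sub>F T in at_top. (\<Sum>r<?Q. \<Sum>s<?Q. if sieved t z r s then
        (\<Sum>j<J T. \<Sum>k<J T. F (real (r + ?Q * j) / T, real (s + ?Q * k) / T)) / T\<^sup>2 else 0) = Sz z T / T\<^sup>2"
      by (intro eventually_mono[OF eventually_gt_at_top[of 0]])
        (simp add: sum_divide_distrib if_distrib[of "\<lambda>x. x / _"] cong: if_cong)
    have "((\<lambda>T. \<Sum>r<?Q. \<Sum>s<?Q. if sieved t z r s then
        (\<Sum>j<J T. \<Sum>k<J T. F (real (r + ?Q * j) / T, real (s + ?Q * k) / T)) / T\<^sup>2 else 0)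
        \<longlongrightarrow> (\<Sum>r<?Q. \<Sum>s<?Q. if sieved t z r s then I / (real ?Q)\<^sup>2 else 0)) at_top"
    proof (intro tendsto_sum)
      fix r s assume "r \<in> {..<?Q}" "s \<in> {..<?Q}"
      thus "((\<lambda>T. if sieved t z r s then
        (\<Sum>j<J T. \<Sum>k<J T. F (real (r + ?Q * j) / T, real (s + ?Q * k) / T)) / T\<^sup>2 else 0)
        \<longlongrightarrow> (if sieved t z r s then I / (real ?Q)\<^sup>2 else 0)) at_top"
        using grid_sum_tendsto[OF bound supp meas cont _ _ J, of r ?Q s] by (simp add: I_def)
    qed
    also have "(\<Sum>r<?Q. \<Sum>s<?Q. if sieved t z r s then I / (real ?Q)\<^sup>2 else 0) = \<delta> z * I"
    proof -
      have "{(x, y). x < ?Q \<and> y < ?Q \<and> sieved t z x y} = (SIGMA x:{..<?Q}. {..<?Q} \<inter> {y. sieved t z x y})" by auto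
      hence "residue_count ?Q (sieved t z) = (\<Sum>x<?Q. card ({..<?Q} \<inter> {y. sieved t z x y}))"
        unfolding residue_count_def by (simp only:) (rule card_SigmaI, auto)
      moreover have "(\<Sum>r<?Q. \<Sum>s<?Q. if sieved t z r s then I / (real ?Q)\<^sup>2 else 0)
          = (\<Sum>r<?Q. real (card ({..<?Q} \<inter> {y. sieved t z r y})) * (I / (real ?Q)\<^sup>2))"
        by (intro sum.cong refl) (simp add: sum.If_cases)
      ultimately show ?thesis by (simp add: \<delta>_def sum_distrib_right sum_divide_distrib)
    qed
    finally show ?thesis using ev by (rule Lim_transform_eventually)
  qed
  have diff: "\<bar>S T / T\<^sup>2 - Sz z T / T\<^sup>2\<bar> \<le> 3 * B * L\<^sup>2 / real z" if z: "z \<ge> 3" and T: "T \<ge> 1" for z T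
  proof -
    let ?A = "{(a, b). a \<in> {1..J T} \<and> b \<in> {1..J T} \<and> sieved t z a b \<and> \<not> good t a b}"
    let ?t = "\<lambda>a b. if sieved t z a b \<and> \<not> good t a b then F (real a / T, real b / T) else 0"
    \<comment> \<open>The sums start at 0 while \<open>sieve_error\<close> counts from 1; pairs on
      the axes contribute nothing.\<close>
    have zero: "F (0, v) = 0" "F (v, 0) = 0" for v using supp[of 0 v] supp[of v 0] by auto
    have fin: "finite ?A" by (rule finite_subset[of _ "{1..J T} \<times> {1..J T}"]) auto
    have "Sz z T - S T = (\<Sum>a<J T. \<Sum>b<J T. ?t a b)"
      unfolding Sz_def S_def sum_subtractf[symmetric] by (intro sum.cong refl) (auto dest: good_imp_sieved)
    hence "\<bar>S T - Sz z T\<bar> = \<bar>\<Sum>a<J T. \<Sum>b<J T. ?t a b\<bar>" by linarith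
    also have "\<dots> \<le> (\<Sum>a<J T. \<Sum>b<J T. \<bar>?t a b\<bar>)"
      by (rule order_trans[OF sum_abs sum_mono[OF sum_abs]])
    also have "\<dots> = (\<Sum>p\<in>{..<J T} \<times> {..<J T}. \<bar>?t (fst p) (snd p)\<bar>)"
      by (simp add: sum.cartesian_product split_def)
    also have "\<dots> \<le> (\<Sum>p\<in>{..<J T} \<times> {..<J T}. if p \<in> ?A then B else 0)"
    proof (rule sum_mono)
      fix p assume "p \<in> {..<J T} \<times> {..<J T}"
      then obtain a b where p: "p = (a, b)" "a < J T" "b < J T" by auto
      show "\<bar>?t (fst p) (snd p)\<bar> \<le> (if p \<in> ?A then B else 0)"
        using p bound zero B0 by (cases "a = 0 \<or> b = 0") auto
    qed
    also have "\<dots> = (\<Sum>p\<in>({..<J T} \<times> {..<J T}) \<inter> ?A. B)" by (simp add: sum.If_cases)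
    also have "\<dots> \<le> real (card ?A) * B"
      using B0 fin by (simp add: card_mono mult_right_mono)
    also have "\<dots> \<le> 3 * (real (J T))\<^sup>2 / real z * B" by (intro mult_right_mono sieve_error z B0)
    also have "\<dots> \<le> 3 * (L * T)\<^sup>2 / real z * B"
      using J(2)[OF T] B0 by (intro mult_right_mono divide_right_mono mult_left_mono power_mono) auto
    finally have "\<bar>S T - Sz z T\<bar> / T\<^sup>2 \<le> 3 * (L * T)\<^sup>2 / real z * B / T\<^sup>2" by (rule divide_right_mono) simp
    also have "\<dots> = 3 * B * L\<^sup>2 / real z" using T by (simp add: power_mult_distrib)
    finally show ?thesis using T by (simp add: abs_divide flip: diff_divide_distrib)
  qed
  have \<delta>_lim: "(\<lambda>z. \<delta> z * I) \<longlonglongrightarrow> type_share t * density_const * I"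
  proof (intro tendsto_mult tendsto_const)
    have "(\<lambda>z. type_share t * (\<Prod>p\<le>z. euler_factor p)) \<longlonglongrightarrow> type_share t * density_const"
      by (intro tendsto_mult tendsto_const euler_product_lim)
    thus "\<delta> \<longlonglongrightarrow> type_share t * density_const"
      by (rule Lim_transform_eventually)
        (use eventually_ge_at_top[of 3] in eventually_elim, simp add: \<delta>_def sieved_density)
  qed
  have "((\<lambda>T. S T / T\<^sup>2) \<longlongrightarrow> type_share t * density_const * I) at_top"
  proof (rule tendstoI)
    fix e :: real assume e: "e > 0"
    have "(\<lambda>z. 3 * B * L\<^sup>2 / real z) \<longlonglongrightarrow> 0" by (rule lim_const_over_n)
    hence 1: "\<forall>\<^sub>F z in sequentially. dist (3 * B * L\<^sup>2 / real z) 0 < e / 3" using e by (intro tendstoD) auto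
    have 2: "\<forall>\<^sub>F z in sequentially. dist (\<delta> z * I) (type_share t * density_const * I) < e / 3"
      using e by (intro tendstoD[OF \<delta>_lim]) auto
    \<comment> \<open>One \<open>z\<close> makes the sieve error and the density error small
      together; \<open>T\<close> is taken large only afterwards.\<close>
    obtain z where z: "z \<ge> 3" "dist (3 * B * L\<^sup>2 / real z) 0 < e / 3"
      "dist (\<delta> z * I) (type_share t * density_const * I) < e / 3"
      using eventually_happens'[OF sequentially_bot eventually_conj[OF eventually_ge_at_top[of 3] eventually_conj[OF 1 2]]]
      by auto
    have 3: "\<forall>\<^sub>F T in at_top. dist (Sz z T / T\<^sup>2) (\<delta> z * I) < e / 3"
      using e by (intro tendstoD[OF Sz_lim]) auto
    show "\<forall>\<^sub>F T in at_top. dist (S T / T\<^sup>2) (type_share t * density_const * I) < e"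
      using 3 eventually_ge_at_top[of 1]
    proof eventually_elim
      case (elim T)
      have "3 * B * L\<^sup>2 / real z < e / 3" using z(2) unfolding dist_real_def by linarith
      hence "\<bar>S T / T\<^sup>2 - Sz z T / T\<^sup>2\<bar> < e / 3" using diff[OF z(1) elim(2)] by linarith
      thus ?case using elim(1) z(3) unfolding dist_real_def by linarith
    qed
  qed
  thus ?thesis by (simp add: S_def I_def)
qed

section \<open>The integral over the hyperbolic sector\<close>

text \<open>For \<open>u = a / T\<close> and \<open>v = b / T\<close> this is the contribution of a
  pair: the sector encodes \<open>b < a\<close> and the discriminant bound, and
  \<open>root 3 (u / v)\<close> is the parameter of the shape on its ray, invariant under
  scaling.\<close>

definition ratio_kernel :: "(real \<Rightarrow> real) \<Rightarrow> real \<times> real \<Rightarrow> real" where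
  "ratio_kernel g = (\<lambda>(u, v). if 0 < v \<and> v < u \<and> u * v \<le> 1 then g (root 3 (u / v)) else 0)"

context
  fixes g :: "real \<Rightarrow> real" and R :: real
  assumes cont_g: "continuous_on {1..} g" and R: "R \<ge> 1" and g_zero: "\<And>y. y > R \<Longrightarrow> g y = 0"
begin

text \<open>A continuous extension of \<open>g\<close> from \<open>{1..}\<close> to the line, to
  which the rules for continuity and measurability apply directly.\<close>

definition g_ext :: "real \<Rightarrow> real" where "g_ext y = g (max 1 y)"

lemma cont_g_ext: "continuous_on UNIV g_ext"
  unfolding g_ext_def
  by (rule continuous_on_compose2[OF cont_g]) (auto intro!: continuous_intros)

lemma g_ext_eq: "y \<ge> 1 \<Longrightarrow> g_ext y = g y" by (simp add: g_ext_def)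

lemma root_ge_1: "0 < v \<Longrightarrow> v < u \<Longrightarrow> root 3 (u / v) \<ge> 1"
  by (simp add: real_root_ge_1_iff)

lemma ratio_kernel_ext:
  "ratio_kernel g = (\<lambda>(u, v). if 0 < v \<and> v < u \<and> u * v \<le> 1 then g_ext (root 3 (u / v)) else 0)"
  by (auto simp: ratio_kernel_def fun_eq_iff g_ext_eq root_ge_1)

lemma g_bounded: "\<exists>B\<ge>0. \<forall>y\<ge>1. \<bar>g y\<bar> \<le> B"
proof -
  have "compact (g ` {1..R})"
    by (intro compact_continuous_image continuous_on_subset[OF cont_g]) auto
  then obtain B where B: "\<And>x. x \<in> g ` {1..R} \<Longrightarrow> norm x \<le> B"
    using compact_imp_bounded bounded_iff by metis
  have "\<bar>g y\<bar> \<le> max B 0" if "y \<ge> 1" for y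
    using B[of "g y"] g_zero[of y] that by (cases "y \<le> R") auto
  thus ?thesis by (intro exI[of _ "max B 0"]) simp
qed

lemma ratio_kernel_bounded:
  assumes "\<And>y. y \<ge> 1 \<Longrightarrow> \<bar>g y\<bar> \<le> B" "B \<ge> 0" shows "\<bar>ratio_kernel g p\<bar> \<le> B"
  using assms by (cases p) (auto simp: ratio_kernel_def root_ge_1)

text \<open>Vanishing of \<open>g\<close> beyond \<open>R\<close> gives
  \<open>u \<le> R^3 v\<close>, and \<open>v^2 \<le> u v \<le> 1\<close> gives
  \<open>v \<le> 1\<close>; so the cusp of the sector is cut off.\<close>

lemma ratio_kernel_support:
  assumes "ratio_kernel g (u, v) \<noteq> 0"
  shows "0 < u \<and> u \<le> R ^ 3 \<and> 0 < v \<and> v \<le> R ^ 3" "v \<le> u" "u \<le> R ^ 3 * v"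
proof -
  have uv: "0 < v" "v < u" "u * v \<le> 1" "g (root 3 (u / v)) \<noteq> 0"
    using assms by (auto simp: ratio_kernel_def split: if_splits)
  have "root 3 (u / v) \<le> R" using uv(4) g_zero by (meson not_le)
  hence "root 3 (u / v) ^ 3 \<le> R ^ 3" using root_ge_1[OF uv(1,2)] by (intro power_mono) auto
  hence "u / v \<le> R ^ 3" by (simp add: odd_real_root_pow)
  thus le: "u \<le> R ^ 3 * v" using uv by (simp add: divide_le_eq)
  have "v * v \<le> u * v" using uv by (intro mult_right_mono) auto
  hence "v\<^sup>2 \<le> 1" using uv(3) unfolding power2_eq_square by linarith
  hence v1: "v \<le> 1" using abs_square_le_1[of v] by linarith
  have R3: "R ^ 3 \<ge> 1" using R by simp
  have "R ^ 3 * v \<le> R ^ 3 * 1" using v1 R by (intro mult_left_mono) auto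
  thus "0 < u \<and> u \<le> R ^ 3 \<and> 0 < v \<and> v \<le> R ^ 3" using uv v1 R3 le by linarith
  show "v \<le> u" using uv by simp
qed

lemma ratio_kernel_measurable [measurable]: "ratio_kernel g \<in> borel_measurable borel"
proof -
  have [measurable]: "g_ext \<in> borel_measurable borel"
    using cont_g_ext by (rule borel_measurable_continuous_onI)
  have [measurable]: "root 3 \<in> borel_measurable borel"
    by (intro borel_measurable_continuous_onI continuous_on_real_root continuous_on_id)
  have "ratio_kernel g \<in> borel_measurable (borel \<Otimes>\<^sub>M borel)"
    unfolding ratio_kernel_ext by measurable
  thus ?thesis by (simp add: borel_prod)
qed

text \<open>Discontinuities lie on \<open>v = 0\<close>, \<open>u = v\<close> and
  \<open>u v = 1\<close>, and every line of fixed \<open>u\<close> meets these curves in at most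
  three points.\<close>

lemma ratio_kernel_continuous: "AE p in lborel. isCont (ratio_kernel g) p"
proof -
  have "isCont (ratio_kernel g) (u, v)" if nz: "v \<noteq> 0" "u \<noteq> v" "u * v \<noteq> 1" for u v
  proof -
    have locally_zero: "isCont (ratio_kernel g) (u, v)"
      if "open S" "(u, v) \<in> S" "\<And>p. p \<in> S \<Longrightarrow> ratio_kernel g p = 0" for S
    proof -
      have "continuous_on S (\<lambda>_. 0 :: real)" by simp
      hence "continuous_on S (ratio_kernel g)" by (rule continuous_on_eq) (simp add: that)
      thus ?thesis using that continuous_on_eq_continuous_at by blast
    qed
    consider "v < 0" | "u < v" | "u * v > 1" | "0 < v" "v < u" "u * v < 1" using nz by linarith
    thus ?thesis
    proof cases
      case 1
      show ?thesis
        by (rule locally_zero[of "{p. snd p < 0}"])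
          (use 1 in \<open>auto simp: ratio_kernel_def intro!: open_Collect_less continuous_intros\<close>)
    next
      case 2
      show ?thesis
        by (rule locally_zero[of "{p. fst p < snd p}"])
          (use 2 in \<open>auto simp: ratio_kernel_def intro!: open_Collect_less continuous_intros\<close>)
    next
      case 3
      show ?thesis
        by (rule locally_zero[of "{p. 1 < fst p * snd p}"])
          (use 3 in \<open>auto simp: ratio_kernel_def intro!: open_Collect_less continuous_intros\<close>)
    next
      case 4
      define S where "S = {p :: real \<times> real. 0 < snd p} \<inter> {p. snd p < fst p} \<inter> {p. fst p * snd p < 1}"
      have S: "open S" unfolding S_def by (intro open_Int open_Collect_less continuous_intros)
      have "continuous_on S (\<lambda>p. g_ext (root 3 (fst p / snd p)))"
        by (rule continuous_on_compose2[OF cont_g_ext]) (auto simp: S_def intro!: continuous_intros)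
      hence "continuous_on S (ratio_kernel g)"
        by (rule continuous_on_eq) (auto simp: S_def ratio_kernel_ext split_def)
      moreover have "(u, v) \<in> S" using 4 by (simp add: S_def)
      ultimately show ?thesis using continuous_on_eq_continuous_at[OF S] by blast
    qed
  qed
  moreover have "AE p in lborel \<Otimes>\<^sub>M lborel. snd p \<noteq> (0::real) \<and> fst p \<noteq> snd p \<and> fst p * snd p \<noteq> 1"
  proof (rule lborel_pair.AE_pair_measure)
    show "AE u in lborel. AE v in lborel. snd (u, v) \<noteq> (0::real) \<and> fst (u, v) \<noteq> snd (u, v) \<and> fst (u, v) * snd (u, v) \<noteq> 1"
    proof (rule AE_I2)
      fix u :: real
      have "finite ({0, u} \<union> {inverse u})" by simp
      hence "{0, u} \<union> {inverse u} \<in> null_sets lborel" by (rule finite_imp_null_set_lborel)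
      hence "AE v in lborel. v \<notin> {0, u} \<union> {inverse u}" by (rule AE_not_in)
      thus "AE v in lborel. snd (u, v) \<noteq> (0::real) \<and> fst (u, v) \<noteq> snd (u, v) \<and> fst (u, v) * snd (u, v) \<noteq> 1"
        by (rule AE_mp) (auto intro!: AE_I2 dest: inverse_unique)
    qed
  qed measurable
  ultimately show ?thesis unfolding lborel_prod by (auto elim: eventually_mono)
qed

lemma ratio_kernel_integrable: "integrable lborel (ratio_kernel g)"
proof -
  obtain B where B: "\<And>y. y \<ge> 1 \<Longrightarrow> \<bar>g y\<bar> \<le> B" "B \<ge> 0" using g_bounded by blast
  have "integrable lborel (\<lambda>p. B * indicator (cbox (0, 0) (R ^ 3, R ^ 3)) p :: real)"
    by (intro integrable_mult_right integrable_real_indicator emeasure_lborel_cbox_finite) simp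
  thus ?thesis
  proof (rule Bochner_Integration.integrable_bound)
    have "norm (ratio_kernel g (u, v)) \<le> norm (B * indicator (cbox (0, 0) (R ^ 3, R ^ 3)) (u, v))" for u v
      using ratio_kernel_bounded[OF B, of "(u, v)"] ratio_kernel_support(1)[of u v] B(2)
      by (cases "ratio_kernel g (u, v) = 0") (auto simp: indicator_def cbox_Pair_eq)
    thus "AE p in lborel. norm (ratio_kernel g p) \<le> norm (B * indicator (cbox (0, 0) (R ^ 3, R ^ 3)) p)"
      by (auto intro!: AE_I2)
  qed simp
qed

text \<open>The kernel after \<open>u = y^3 v\<close>, with Jacobian \<open>3 y^2 v\<close>: the
  bound \<open>u v \<le> 1\<close> becomes \<open>y^3 v^2 \<le> 1\<close>, and \<open>v < u\<close>
  becomes \<open>1 < y\<close>. The cutoff at \<open>R\<close> makes the support visibly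
  bounded.\<close>

definition slice_kernel :: "real \<Rightarrow> real \<Rightarrow> real" where
  "slice_kernel y v = (if 0 < v \<and> 1 < y \<and> y \<le> R \<and> y ^ 3 * v\<^sup>2 \<le> 1 then g_ext y * (3 * y\<^sup>2 * v) else 0)"

lemma slice_kernel_integrable: "integrable (lborel \<Otimes>\<^sub>M lborel) (\<lambda>(y, v). slice_kernel y v)"
proof -
  have [measurable]: "g_ext \<in> borel_measurable borel"
    using cont_g_ext by (rule borel_measurable_continuous_onI)
  obtain B where B: "\<And>y. y \<ge> 1 \<Longrightarrow> \<bar>g y\<bar> \<le> B" "B \<ge> 0" using g_bounded by blast
  have "integrable (lborel \<Otimes>\<^sub>M lborel) (\<lambda>p. B * (3 * R\<^sup>2) * indicator (cbox (0, 0) (R, 1)) p :: real)"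
    unfolding lborel_prod
    by (intro integrable_mult_right integrable_real_indicator emeasure_lborel_cbox_finite) simp
  thus ?thesis
  proof (rule Bochner_Integration.integrable_bound)
    show "(\<lambda>(y, v). slice_kernel y v) \<in> borel_measurable (lborel \<Otimes>\<^sub>M lborel)"
      unfolding slice_kernel_def by measurable
    have "norm (slice_kernel y v) \<le> norm (B * (3 * R\<^sup>2) * indicator (cbox (0, 0) (R, 1)) (y, v))" for y v
    proof (cases "0 < v \<and> 1 < y \<and> y \<le> R \<and> y ^ 3 * v\<^sup>2 \<le> 1")
      case True
      hence y3: "1 \<le> y ^ 3" by simp
      have "1 * v\<^sup>2 \<le> y ^ 3 * v\<^sup>2" using y3 by (intro mult_right_mono) auto
      hence "v\<^sup>2 \<le> 1" using True by linarith
      hence v1: "v \<le> 1" using abs_square_le_1[of v] by linarith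
      have "\<bar>g_ext y\<bar> * (3 * y\<^sup>2 * v) \<le> B * (3 * R\<^sup>2 * 1)"
        using True B v1 by (intro mult_mono power_mono) (auto simp: g_ext_eq)
      thus ?thesis using True v1 B(2) by (simp add: slice_kernel_def abs_mult cbox_Pair_eq)
    qed (auto simp: slice_kernel_def)
    thus "AE p in lborel \<Otimes>\<^sub>M lborel. norm (case p of (y, v) \<Rightarrow> slice_kernel y v)
        \<le> norm (B * (3 * R\<^sup>2) * indicator (cbox (0, 0) (R, 1)) p)"
      by (auto intro!: AE_I2)
  qed
qed

lemma slice_substitution: 
  assumes "integrable lborel (\<lambda>u. ratio_kernel g (u, v))"
  shows "(LBINT u. ratio_kernel g (u, v)) = (LBINT y. slice_kernel y v)"
proof (cases "v > 0")
  case False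
  thus ?thesis by (simp add: ratio_kernel_def slice_kernel_def)
next
  case v: True
  \<comment> \<open>The interval is the image of \<open>{1..R}\<close> under the substitution, and
    the kernel vanishes off it.\<close>
  have "(LBINT u. ratio_kernel g (u, v) * indicator {1 ^ 3 * v..R ^ 3 * v} u)
      = (LBINT y. ratio_kernel g (y ^ 3 * v, v) * (3 * y\<^sup>2 * v) * indicator {1..R} y)"
  proof (rule integral_substitution)
    show "set_integrable lborel {1 ^ 3 * v..R ^ 3 * v} (\<lambda>u. ratio_kernel g (u, v))"
      unfolding set_integrable_def using assms by (intro integrable_mult_indicator) auto
    show "((\<lambda>y. y ^ 3 * v) has_real_derivative 3 * y\<^sup>2 * v) (at y)" for y
      by (auto intro!: derivative_eq_intros)
    show "continuous_on {1..R} (\<lambda>y. 3 * y\<^sup>2 * v)" by (intro continuous_intros)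
  qed (use v R in auto)
  also have "(\<lambda>u. ratio_kernel g (u, v) * indicator {1 ^ 3 * v..R ^ 3 * v} u) = (\<lambda>u. ratio_kernel g (u, v))"
    using ratio_kernel_support(2,3)[of _ v] by (auto simp: fun_eq_iff indicator_def)
  also have "(\<lambda>y. ratio_kernel g (y ^ 3 * v, v) * (3 * y\<^sup>2 * v) * indicator {1..R} y) = (\<lambda>y. slice_kernel y v)"
  proof
    fix y
    show "ratio_kernel g (y ^ 3 * v, v) * (3 * y\<^sup>2 * v) * indicator {1..R} y = slice_kernel y v"
    proof (cases "1 \<le> y \<and> y \<le> R")
      case True
      have "root 3 (y ^ 3 * v / v) = y" using v True by (simp add: real_root_power_cancel)
      moreover have "v < y ^ 3 * v \<longleftrightarrow> 1 < y" 
      proof -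
        have "v < y ^ 3 * v \<longleftrightarrow> 1 < y ^ 3" using v by simp
        also have "\<dots> \<longleftrightarrow> 1 < y" using True by (cases "y = 1") (auto simp: one_less_power)
        finally show ?thesis .
      qed
      ultimately show ?thesis using True v
        by (simp add: ratio_kernel_ext slice_kernel_def power2_eq_square mult.assoc)
    qed (auto simp: slice_kernel_def indicator_def)
  qed
  finally show ?thesis .
qed

text \<open>For \<open>1 < y \<le> R\<close> the range is \<open>0 < v \<le> c\<close> with
  \<open>c^2 = 1 / y^3\<close>, so the integral is \<open>3 y^2 g(y) c^2 / 2\<close>. Here both the
  density \<open>1 / y\<close> and the factor \<open>3/2\<close> arise.\<close>

lemma slice_integral:
  "(LBINT v. slice_kernel y v) = 3 / 2 * (indicator {1<..} y * (g y / y))"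
proof (cases "1 < y \<and> y \<le> R")
  case True
  define c where "c = sqrt (1 / y ^ 3)"
  have c: "c \<ge> 0" "c\<^sup>2 = 1 / y ^ 3" using True by (simp_all add: c_def)
  have iff: "y ^ 3 * v\<^sup>2 \<le> 1 \<longleftrightarrow> v \<le> c" if "v > 0" for v
  proof -
    have "y ^ 3 * v\<^sup>2 \<le> 1 \<longleftrightarrow> v\<^sup>2 \<le> c\<^sup>2" using True by (simp add: c(2) pos_le_divide_eq mult.commute)
    also have "\<dots> \<longleftrightarrow> v \<le> c" using that c(1) by (simp add: power2_le_iff_abs_le)
    finally show ?thesis .
  qed
  have "(LBINT v. slice_kernel y v) = (LBINT v. (g y * (3 * y\<^sup>2)) * (v * indicator {0..c} v))"
    by (rule Bochner_Integration.integral_cong)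
      (use True iff in \<open>auto simp: slice_kernel_def g_ext_eq indicator_def\<close>)
  also have "\<dots> = (g y * (3 * y\<^sup>2)) * (LBINT v. v * indicator {0..c} v)" by simp
  also have "(LBINT v. v * indicator {0..c} v) = c\<^sup>2 / 2 - 0\<^sup>2 / 2"
    by (rule integral_FTC_Icc_nonneg)
      (use c(1) in \<open>auto intro!: derivative_eq_intros borel_measurable_continuous_onI continuous_intros\<close>)
  also have "(g y * (3 * y\<^sup>2)) * (c\<^sup>2 / 2 - 0\<^sup>2 / 2) = 3 / 2 * (indicator {1<..} y * (g y / y))"
    unfolding c(2) using True by (simp add: power2_eq_square power3_eq_cube)
  finally show ?thesis .
qed (auto simp: slice_kernel_def indicator_def g_zero)

text \<open>The substitution is made for fixed \<open>v\<close>; Fubini then exchanges the order so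
  that \<open>v\<close> can be integrated out.\<close>

lemma ratio_kernel_integral:
  "(\<integral>p. ratio_kernel g p \<partial>lborel) = 3 / 2 * (LBINT y. indicator {1..} y * (g y / y))"
proof -
  have int: "integrable (lborel \<Otimes>\<^sub>M lborel) (\<lambda>(u, v). ratio_kernel g (u, v))"
    using ratio_kernel_integrable by (simp add: lborel_prod)
  have "(\<integral>p. ratio_kernel g p \<partial>lborel) = (LBINT v. LBINT u. ratio_kernel g (u, v))"
    using lborel_pair.integral_snd[OF int] by (simp add: lborel_prod)
  also have "\<dots> = (LBINT v. LBINT y. slice_kernel y v)"
  proof (rule integral_cong_AE)
    show "AE v in lborel. (LBINT u. ratio_kernel g (u, v)) = (LBINT y. slice_kernel y v)"
      using lborel_pair.AE_integrable_snd[OF int]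
      by eventually_elim (rule slice_substitution)
    show "(\<lambda>v. LBINT u. ratio_kernel g (u, v)) \<in> borel_measurable lborel"
      using lborel_pair.integrable_snd[OF int] by (rule borel_measurable_integrable)
    show "(\<lambda>v. LBINT y. slice_kernel y v) \<in> borel_measurable lborel"
      using lborel_pair.integrable_snd[OF slice_kernel_integrable] by (rule borel_measurable_integrable)
  qed
  also have "\<dots> = (LBINT y. LBINT v. slice_kernel y v)"
    by (rule lborel_pair.Fubini_integral[OF slice_kernel_integrable])
  also have "\<dots> = (LBINT y. 3 / 2 * (indicator {1<..} y * (g y / y)))" by (simp only: slice_integral)
  also have "\<dots> = 3 / 2 * (LBINT y. indicator {1<..} y * (g y / y))" by (rule integral_mult_right_zero)
  also have "(LBINT y. indicator {1<..} y * (g y / y)) = (LBINT y. indicator {1..} y * (g y / y))"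
  proof (rule integral_cong_AE)
    have [measurable]: "g_ext \<in> borel_measurable borel"
      using cont_g_ext by (rule borel_measurable_continuous_onI)
    have "(\<lambda>y. indicator {1<..} y * (g y / y)) = (\<lambda>y. indicator {1<..} y * (g_ext y / y))"
      "(\<lambda>y. indicator {1..} y * (g y / y)) = (\<lambda>y. indicator {1..} y * (g_ext y / y))"
      by (auto simp: fun_eq_iff indicator_def g_ext_eq)
    thus "(\<lambda>y. indicator {1<..} y * (g y / y)) \<in> borel_measurable lborel"
      "(\<lambda>y. indicator {1..} y * (g y / y)) \<in> borel_measurable lborel" by simp_all
    show "AE y in lborel. indicator {1<..} y * (g y / y) = indicator {1..} y * (g y / y)"
      using AE_lborel_singleton[of 1] by eventually_elim (auto simp: indicator_def)
  qed
  finally show ?thesis .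
qed

end

section \<open>Counting pure cubic fields by shape\<close>

text \<open>As \<open>b\<close> is prime to 3 it can be cleared from the denominator; conversely
  \<open>b\<close> itself serves as the denominator of the required fraction.\<close>

lemma rat_cong_9_iff:
  fixes a b :: nat and e :: int
  assumes "\<not> 3 dvd b"
  shows "rat_cong (of_nat a / of_nat b) (of_int e) 9 \<longleftrightarrow> 9 dvd int a - e * int b"
proof
  have b: "(of_nat b :: rat) \<noteq> 0" using assms by (intro notI) simp
  assume "rat_cong (of_nat a / of_nat b) (of_int e) 9"
  then obtain c d :: int where cd: "d \<noteq> 0" "coprime d 9"
    "(of_nat a / of_nat b - of_int e :: rat) = of_int 9 * (of_int c / of_int d)"
    unfolding rat_cong_def by blast
  have "(of_int ((int a - e * int b) * d) :: rat) = (of_nat a / of_nat b - of_int e) * of_nat b * of_int d"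
    using b by (simp add: left_diff_distrib)
  also have "\<dots> = of_int (9 * (c * int b))" unfolding cd(3) using cd(1) by simp
  finally have "(int a - e * int b) * d = 9 * (c * int b)" by (simp only: of_int_eq_iff)
  hence "9 dvd (int a - e * int b) * d" by simp
  thus "9 dvd int a - e * int b" using cd(2) by (simp add: coprime_dvd_mult_left_iff coprime_commute)
next
  have b: "(of_nat b :: rat) \<noteq> 0" using assms by (intro notI) simp
  assume "9 dvd int a - e * int b"
  then obtain c where c: "int a - e * int b = 9 * c" by (rule dvdE)
  have "coprime (3 :: int) (int b)" using assms
    by (intro prime_imp_coprime) (auto simp: int_dvd_int_iff[of 3 b, simplified])
  hence "coprime ((3 :: int)\<^sup>2) (int b)" by (subst coprime_power_left_iff) simp
  hence co: "coprime (int b) 9" by (simp add: coprime_commute)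
  have "(of_nat a - of_int e * of_nat b :: rat) = of_int 9 * of_int c"
    using arg_cong[OF c, of "of_int :: int \<Rightarrow> rat"] by simp
  moreover have "(of_nat a / of_nat b - of_int e :: rat) = (of_nat a - of_int e * of_nat b) / of_nat b"
    using b by (simp add: diff_divide_distrib)
  ultimately have "(of_nat a / of_nat b - of_int e :: rat) = of_int 9 * (of_int c / of_int (int b))" by simp
  thus "rat_cong (of_nat a / of_nat b) (of_int e) 9"
    unfolding rat_cong_def using co b by (intro exI[of _ c] exI[of _ "int b"]) simp
qed

text \<open>If 3 divided both \<open>a - b\<close> and \<open>a + b\<close> it would divide
  \<open>2 a\<close>; so one factor is prime to 3 and the other carries the whole 9.\<close>

lemma nine_dvd_square_diff_iff:
  fixes a b :: int
  assumes "\<not> 3 dvd a"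
  shows "9 dvd a\<^sup>2 - b\<^sup>2 \<longleftrightarrow> 9 dvd a - b \<or> 9 dvd a + b"
proof
  have eq: "a\<^sup>2 - b\<^sup>2 = (a - b) * (a + b)" by (simp add: power2_eq_square algebra_simps)
  assume 9: "9 dvd a\<^sup>2 - b\<^sup>2"
  have pr: "Factorial_Ring.prime (3::int)" by simp
  have "\<not> 3 dvd a - b \<or> \<not> 3 dvd a + b"
  proof (rule ccontr)
    assume "\<not> ?thesis"
    hence "3 dvd a" by presburger
    with assms show False by contradiction
  qed
  thus "9 dvd a - b \<or> 9 dvd a + b"
  proof
    assume "\<not> 3 dvd a - b"
    hence "coprime ((3::int)\<^sup>2) (a - b)" using prime_imp_coprime[OF pr] by (subst coprime_power_left_iff) simp
    thus ?thesis using 9 unfolding eq by (simp add: coprime_dvd_mult_right_iff)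
  next
    assume "\<not> 3 dvd a + b"
    hence "coprime ((3::int)\<^sup>2) (a + b)" using prime_imp_coprime[OF pr] by (subst coprime_power_left_iff) simp
    thus ?thesis using 9 unfolding eq by (simp add: coprime_dvd_mult_left_iff)
  qed
next
  have eq: "a\<^sup>2 - b\<^sup>2 = (a - b) * (a + b)" by (simp add: power2_eq_square algebra_simps)
  assume "9 dvd a - b \<or> 9 dvd a + b"
  thus "9 dvd a\<^sup>2 - b\<^sup>2" unfolding eq by auto
qed

definition disc_factor :: "cubic_type \<Rightarrow> nat" where
  "disc_factor t = (if t = TypeI then 27 else 3)"

context cubic_pair
begin

lemma tame_iff_tame_pair: "tame \<longleftrightarrow> tame_pair a b"
proof -
  have "9 dvd (int a)\<^sup>2 - (int b)\<^sup>2 \<longleftrightarrow> int (a\<^sup>2) mod int 9 = int (b\<^sup>2) mod int 9"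
    by (simp add: mod_eq_dvd_iff)
  also have "\<dots> \<longleftrightarrow> a\<^sup>2 mod 9 = b\<^sup>2 mod 9" by (simp only: zmod_int[symmetric] of_nat_eq_iff)
  finally show ?thesis by (simp add: tame_def tame_pair_def)
qed

lemma type_of_field_eq: "type_of_field K = (if tame then TypeII else TypeI)"
proof (cases "3 dvd a \<or> 3 dvd b")
  case True
  hence "3 dvd a * b\<^sup>2" by (auto simp: power2_eq_square)
  thus ?thesis using True by (auto simp: type_of_field_def radicand_eq tame_def)
next
  case False
  have "Factorial_Ring.prime (3::nat)" by simp
  hence "\<not> 3 dvd a * b\<^sup>2" using False by (simp add: prime_dvd_mult_iff prime_dvd_power_iff)
  moreover have "rat_cong (of_nat a / of_nat b) 1 9 \<longleftrightarrow> 9 dvd int a - int b"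
    using rat_cong_9_iff[of b a 1] False by simp
  moreover have "rat_cong (of_nat a / of_nat b) (- 1) 9 \<longleftrightarrow> 9 dvd int a + int b"
    using rat_cong_9_iff[of b a "- 1"] False by simp
  moreover have "\<not> 3 dvd int a" using False int_dvd_int_iff[of 3 a] by simp
  hence "9 dvd (int a)\<^sup>2 - (int b)\<^sup>2 \<longleftrightarrow> 9 dvd int a - int b \<or> 9 dvd int a + int b"
    by (rule nine_dvd_square_diff_iff)
  ultimately show ?thesis using False by (simp add: type_of_field_def radicand_eq ratio_eq tame_def)
qed

lemma type_of_field_iff: "type_of_field K = t \<longleftrightarrow> (t = TypeII \<longleftrightarrow> tame_pair a b)"
  unfolding type_of_field_eq tame_iff_tame_pair by (cases t) auto

lemma abs_discriminant: "\<bar>discriminant K\<bar> = int (disc_factor (type_of_field K) * (a * b)\<^sup>2)"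
  unfolding type_of_field_eq disc_factor_def
  by (simp add: discriminant_wild discriminant_tame abs_mult power_mult_distrib)

lemma shape_eq: "shape K = ray_point (type_of_field K) (root 3 (real a / real b))"
  by (simp add: shape_def ratio_eq of_rat_divide)

end

lemma good_iff:
  "good t a b \<longleftrightarrow> coprime a b \<and> squarefree a \<and> squarefree b \<and> (t = TypeII \<longleftrightarrow> tame_pair a b)"
proof -
  have "Factorial_Ring.prime (3::nat)" by simp
  hence "good t a b \<longleftrightarrow> (\<forall>p. Factorial_Ring.prime p \<longrightarrow> squarefree_at p a b) \<and> (t = TypeII \<longleftrightarrow> tame_pair a b)"
    unfolding good_def good_at_def by blast
  thus ?thesis unfolding squarefree_coprime_iff[symmetric] by blast
qed

section \<open>Parametrisation of the fields by pairs\<close>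

definition field_pairs :: "cubic_type \<Rightarrow> nat \<Rightarrow> (nat \<times> nat) set" where
  "field_pairs t N = {(a, b). 0 < b \<and> b < a \<and> good t a b \<and> disc_factor t * (a * b)\<^sup>2 \<le> N}"

definition pair_field :: "nat \<times> nat \<Rightarrow> real set" where
  "pair_field = (\<lambda>(a, b). Q_adjoin (root 3 (real (a * b\<^sup>2))))"

lemma field_pairs_cubic: "(a, b) \<in> field_pairs t N \<Longrightarrow> cubic_pair a b"
  by (simp add: field_pairs_def good_iff cubic_pair_def)

lemma finite_field_pairs: "finite (field_pairs t N)"
proof (rule finite_subset)
  show "field_pairs t N \<subseteq> {..N} \<times> {..N}"
  proof clarify
    fix a b assume ab: "(a, b) \<in> field_pairs t N"
    hence pos: "0 < b" "b < a" and le: "disc_factor t * (a * b)\<^sup>2 \<le> N" by (auto simp: field_pairs_def)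
    have "a * 1 \<le> a * b" using pos by (intro mult_le_mono2) simp
    also have "a * b \<le> (a * b)\<^sup>2" by (simp add: power2_eq_square)
    also have "1 * (a * b)\<^sup>2 \<le> disc_factor t * (a * b)\<^sup>2"
      by (intro mult_le_mono1) (simp add: disc_factor_def)
    finally show "a \<in> {..N} \<and> b \<in> {..N}" using le pos by simp
  qed
qed simp

lemma fields_eq_image:
  "{F \<in> pure_cubic_fields. type_of_field F = t \<and> \<bar>discriminant F\<bar> \<le> int N} = pair_field ` field_pairs t N"
proof (intro equalityI subsetI)
  fix F assume "F \<in> {F \<in> pure_cubic_fields. type_of_field F = t \<and> \<bar>discriminant F\<bar> \<le> int N}"
  then obtain a b where F: "F = Q_adjoin (root 3 (real (a * b\<^sup>2)))" and cp: "cubic_pair a b"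
    and t: "type_of_field F = t" and d: "\<bar>discriminant F\<bar> \<le> int N"
    unfolding pure_cubic_fields_eq by blast
  interpret cubic_pair a b by (fact cp)
  have K: "F = K" by (simp add: F \<alpha>_def)
  have "int (disc_factor t * (a * b)\<^sup>2) \<le> int N" using d t unfolding K abs_discriminant by (simp only:)
  hence "disc_factor t * (a * b)\<^sup>2 \<le> N" by (simp only: of_nat_le_iff)
  moreover have "good t a b"
    using t unfolding K type_of_field_iff good_iff using coprime squarefree_a squarefree_b by simp
  ultimately have "(a, b) \<in> field_pairs t N" using b_pos b_less_a by (simp add: field_pairs_def)
  thus "F \<in> pair_field ` field_pairs t N" by (rule rev_image_eqI) (simp add: pair_field_def F)
next
  fix F assume "F \<in> pair_field ` field_pairs t N"
  then obtain a b where ab: "(a, b) \<in> field_pairs t N" and F: "F = Q_adjoin (root 3 (real (a * b\<^sup>2)))"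
    by (auto simp: pair_field_def)
  interpret cubic_pair a b using ab by (rule field_pairs_cubic)
  have K: "F = K" by (simp add: F \<alpha>_def)
  have t: "type_of_field K = t" using ab unfolding type_of_field_iff by (simp add: field_pairs_def good_iff)
  moreover have "disc_factor t * (a * b)\<^sup>2 \<le> N" using ab by (simp add: field_pairs_def)
  hence "\<bar>discriminant K\<bar> \<le> int N" unfolding abs_discriminant t by (simp only: of_nat_le_iff)
  moreover have "F \<in> pure_cubic_fields" unfolding pure_cubic_fields_eq F using cubic_pair_axioms by blast
  ultimately show "F \<in> {F \<in> pure_cubic_fields. type_of_field F = t \<and> \<bar>discriminant F\<bar> \<le> int N}"
    unfolding K by simp
qed

lemma inj_pair_field: "inj_on pair_field (field_pairs t N)"
proof (rule inj_onI, clarify)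
  fix a b c d assume ab: "(a, b) \<in> field_pairs t N" and cd: "(c, d) \<in> field_pairs t N"
    and eq: "pair_field (a, b) = pair_field (c, d)"
  interpret cubic_pair a b using ab by (rule field_pairs_cubic)
  have "root 3 (real (c * d\<^sup>2)) \<in> K"
    using eq Q_adjoin_self[of "root 3 (real (c * d\<^sup>2))"] by (simp add: pair_field_def \<alpha>_def)
  thus "a = c \<and> b = d" by (rule param_unique_aux[OF field_pairs_cubic[OF cd]])
qed

lemma shape_pair_field:
  assumes "(a, b) \<in> field_pairs t N"
  shows "shape (pair_field (a, b)) = ray_point t (root 3 (real a / real b))"
proof -
  interpret cubic_pair a b using assms by (rule field_pairs_cubic)
  have "type_of_field K = t" using assms unfolding type_of_field_iff by (simp add: field_pairs_def good_iff)
  moreover have "pair_field (a, b) = K" by (simp add: pair_field_def \<alpha>_def)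
  ultimately show ?thesis using shape_eq by simp
qed

lemma iso_classes_image: "iso_classes t N = (\<lambda>p. {pair_field p}) ` field_pairs t N"
  unfolding iso_classes_eq fields_eq_image by (simp add: image_image)

lemma finite_iso_classes: "finite (iso_classes t N)"
  unfolding iso_classes_image using finite_field_pairs by (rule finite_imageI)

lemma class_shape_singleton [simp]: "class_shape {F} = shape F"
  by (simp add: class_shape_def)

lemma sum_iso_classes:
  "(\<Sum>c\<in>iso_classes t N. f (class_shape c)) = (\<Sum>(a, b)\<in>field_pairs t N. f (ray_point t (root 3 (real a / real b))))"
proof -
  have "inj_on (\<lambda>p. {pair_field p}) (field_pairs t N)"
    using inj_pair_field[of t N] by (auto simp: inj_on_def)
  hence "(\<Sum>c\<in>iso_classes t N. f (class_shape c)) = (\<Sum>p\<in>field_pairs t N. f (shape (pair_field p)))"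
    unfolding iso_classes_image by (subst sum.reindex) simp_all
  also have "\<dots> = (\<Sum>(a, b)\<in>field_pairs t N. f (ray_point t (root 3 (real a / real b))))"
    by (intro sum.cong refl) (auto simp: shape_pair_field)
  finally show ?thesis .
qed

lemma class_shape_in_space:
  assumes "c \<in> iso_classes t N" shows "class_shape c \<in> shape_space t"
proof -
  obtain a b where ab: "(a, b) \<in> field_pairs t N" and c: "c = {pair_field (a, b)}"
    using assms unfolding iso_classes_image by auto
  have "real a / real b \<ge> 1" using ab by (simp add: field_pairs_def)
  hence "root 3 (real a / real b) \<in> {1..}" by (simp add: real_root_ge_1_iff)
  thus ?thesis unfolding c class_shape_singleton shape_pair_field[OF ab] shape_space_def by (rule imageI)
qed

section \<open>Integrals against the empirical and the limit measure\<close>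

text \<open>Makes the scaled measure accessible to \<open>integral_density\<close>.\<close>

lemma scale_measure_eq_density: "scale_measure r M = density M (\<lambda>_. r)"
  by (rule measure_eqI) (auto simp: emeasure_density nn_integral_cmult_indicator)

lemma type_const_pos: "type_const t > 0"
  using density_const_pos by (cases t) simp_all

lemma Cc_measurable: "f \<in> Cc t \<Longrightarrow> f \<in> borel_measurable (shape_borel t)"
  unfolding shape_borel_def Cc_def by (auto intro: borel_measurable_continuous_on_restrict)

lemma integral_empirical_measure:
  assumes "f \<in> Cc t"
  shows "(\<integral>z. f z \<partial>empirical_measure t N) = shape_functional t N f"
proof -
  have [measurable]: "f \<in> borel_measurable (shape_borel t)" using assms by (rule Cc_measurable)
  have cs: "class_shape \<in> measurable (count_space (iso_classes t N)) (shape_borel t)"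
    by (simp add: shape_borel_def space_restrict_space class_shape_in_space)
  let ?r = "1 / (type_const t * sqrt (real N))"
  have r: "?r \<ge> 0" using type_const_pos[of t] by simp
  have "(\<integral>z. f z \<partial>empirical_measure t N) = (\<integral>z. ?r *\<^sub>R f z \<partial>distr (count_space (iso_classes t N)) (shape_borel t) class_shape)"
    unfolding empirical_measure_def scale_measure_eq_density using r
    by (intro integral_density) simp_all
  also have "\<dots> = ?r * (\<integral>z. f z \<partial>distr (count_space (iso_classes t N)) (shape_borel t) class_shape)"
    by (simp only: real_scaleR_def integral_mult_right_zero)
  also have "(\<integral>z. f z \<partial>distr (count_space (iso_classes t N)) (shape_borel t) class_shape)
      = (\<Sum>c\<in>iso_classes t N. f (class_shape c))"
    by (subst integral_distr[OF cs]) (simp_all add: lebesgue_integral_count_space_finite finite_iso_classes)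
  finally show ?thesis by (simp add: shape_functional_def)
qed

lemma continuous_ray_point: "continuous_on A (ray_point t)"
proof -
  have "ray_point TypeI = (\<lambda>y. \<i> * of_real y)" "ray_point TypeII = (\<lambda>y. (1 + \<i> * of_real y) / 3)"
    by (simp_all add: fun_eq_iff)
  thus ?thesis by (cases t) (auto intro!: continuous_intros)
qed

lemma integral_shape_measure:
  assumes "f \<in> Cc t"
  shows "(\<integral>z. f z \<partial>shape_measure t) = (LBINT y. indicator {1..} y * (f (ray_point t y) / y))"
proof -
  let ?L = "restrict_space lborel {1 :: real..}"
  have f: "f \<in> borel_measurable (shape_borel t)" using assms by (rule Cc_measurable)
  have rp: "ray_point t \<in> measurable ?L (shape_borel t)"
    unfolding shape_borel_def
  proof (rule measurable_restrict_space2)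
    show "ray_point t \<in> space ?L \<rightarrow> shape_space t" by (auto simp: space_restrict_space shape_space_def)
    have "ray_point t \<in> borel_measurable lborel"
      using continuous_ray_point[of UNIV t] by (simp add: borel_measurable_continuous_onI)
    thus "ray_point t \<in> borel_measurable ?L" by (rule measurable_restrict_space1)
  qed
  have comp: "(\<lambda>y. f (ray_point t y)) \<in> borel_measurable ?L" by (rule measurable_compose[OF rp f])
  have inv: "(\<lambda>y. 1 / y) \<in> borel_measurable ?L" by (rule measurable_restrict_space1) simp
  have "(\<integral>z. f z \<partial>shape_measure t) = (\<integral>y. f (ray_point t y) \<partial>density ?L (\<lambda>y. ennreal (1 / y)))"
    unfolding shape_measure_def using rp f by (intro integral_distr) simp_all
  also have "\<dots> = (\<integral>y. (1 / y) *\<^sub>R f (ray_point t y) \<partial>?L)"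
    using comp inv by (rule integral_density) (auto intro!: AE_I2 simp: space_restrict_space)
  also have "\<dots> = (LBINT y. indicator {1..} y *\<^sub>R ((1 / y) *\<^sub>R f (ray_point t y)))"
    by (rule integral_restrict_space) simp
  finally show ?thesis by (simp add: field_simps)
qed

lemma Cc_vanishes:
  assumes "f \<in> Cc t"
  obtains R where "R \<ge> 1" "\<And>y. y > R \<Longrightarrow> f (ray_point t y) = 0"
proof -
  obtain S where S: "compact S" "\<forall>z\<in>shape_space t - S. f z = 0" using assms by (auto simp: Cc_def)
  obtain B where B: "\<forall>z\<in>S. norm z \<le> B" using compact_imp_bounded[OF S(1)] bounded_iff by blast
  \<comment> \<open>The factor 3 compensates the division by 3 in the Type II ray.\<close>
  have im: "\<bar>y\<bar> \<le> 3 * norm (ray_point t y)" for y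
    using abs_Im_le_cmod[of "ray_point t y"] by (cases t) auto
  show thesis
  proof (rule that[of "max 1 (3 * B)"])
    fix y assume y: "y > max 1 (3 * B)"
    hence "norm (ray_point t y) > B" using im[of y] by simp
    hence "ray_point t y \<notin> S" using B by force
    moreover have "ray_point t y \<in> shape_space t" using y by (auto simp: shape_space_def)
    ultimately show "f (ray_point t y) = 0" using S(2) by blast
  qed simp
qed

section \<open>Passage to the limit\<close>

text \<open>The choice of \<open>T\<close> turns \<open>disc_factor t * (a * b)^2 \<le> N\<close>
  into \<open>u v \<le> 1\<close> for \<open>u = a / T\<close> and \<open>v = b / T\<close>. All
  pairs with a nonzero term have entries below \<open>J\<close>.\<close>

lemma sum_field_pairs:
  fixes g :: "real \<Rightarrow> real" and N J :: nat
  assumes T: "T > 0" "T\<^sup>2 = sqrt (real N / real (disc_factor t))"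
    and supp: "\<And>u v. ratio_kernel g (u, v) \<noteq> 0 \<Longrightarrow> 0 < u \<and> u \<le> M \<and> 0 < v \<and> v \<le> M"
    and J: "M * T < real J"
  shows "(\<Sum>(a, b)\<in>field_pairs t N. g (root 3 (real a / real b))) =
    (\<Sum>a<J. \<Sum>b<J. if good t a b then ratio_kernel g (real a / T, real b / T) else 0)"
proof -
  let ?h = "\<lambda>(a, b). if good t a b then ratio_kernel g (real a / T, real b / T) else 0"
  have m: "disc_factor t > 0" by (simp add: disc_factor_def)
  have prod_iff: "real a / T * (real b / T) \<le> 1 \<longleftrightarrow> disc_factor t * (a * b)\<^sup>2 \<le> N" for a b
  proof -
    have "real a / T * (real b / T) \<le> 1 \<longleftrightarrow> real (a * b) \<le> T\<^sup>2"
      using T(1) by (simp add: power2_eq_square divide_le_eq)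
    also have "\<dots> \<longleftrightarrow> sqrt ((real (a * b))\<^sup>2) \<le> sqrt (real N / real (disc_factor t))"
      unfolding T(2) by (simp only: real_sqrt_abs abs_of_nat)
    also have "\<dots> \<longleftrightarrow> (real (a * b))\<^sup>2 \<le> real N / real (disc_factor t)"
      by (rule real_sqrt_le_iff)
    also have "\<dots> \<longleftrightarrow> real (disc_factor t * (a * b)\<^sup>2) \<le> real N"
      using m by (simp add: le_divide_eq mult.commute)
    finally show ?thesis by (simp only: of_nat_le_iff)
  qed
  have val: "ratio_kernel g (real a / T, real b / T) =
      (if 0 < b \<and> b < a \<and> disc_factor t * (a * b)\<^sup>2 \<le> N then g (root 3 (real a / real b)) else 0)" for a b
  proof -
    have "real a / T / (real b / T) = real a / real b" using T(1) by simp
    thus ?thesis unfolding ratio_kernel_def case_prod_conv prod_iff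
      using T(1) by (cases "b = 0") (simp_all add: divide_less_cancel)
  qed
  have out: "?h (a, b) = 0" if "\<not> (a < J \<and> b < J)" for a b
  proof -
    have "M < real c / T" if "\<not> c < J" for c
      using J that T(1) by (simp add: less_divide_eq)
    hence "ratio_kernel g (real a / T, real b / T) = 0"
      using supp[of "real a / T" "real b / T"] that by (meson leD)
    thus ?thesis by simp
  qed
  have "(\<Sum>(a, b)\<in>field_pairs t N. g (root 3 (real a / real b))) = (\<Sum>p\<in>field_pairs t N. ?h p)"
    by (intro sum.cong refl) (auto simp: field_pairs_def val)
  also have "\<dots> = (\<Sum>p\<in>field_pairs t N \<inter> ({..<J} \<times> {..<J}). ?h p)"
  proof (rule sum.mono_neutral_right[OF finite_field_pairs])
    show "\<forall>p\<in>field_pairs t N - field_pairs t N \<inter> ({..<J} \<times> {..<J}). ?h p = 0"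
      using out by force
  qed simp
  also have "\<dots> = (\<Sum>p\<in>{..<J} \<times> {..<J}. ?h p)"
    by (rule sum.mono_neutral_left) (auto simp: field_pairs_def val split: if_splits)
  also have "\<dots> = (\<Sum>a<J. \<Sum>b<J. ?h (a, b))" by (simp add: sum.cartesian_product)
  finally show ?thesis by simp
qed

text \<open>Origin of the normalising constants: \<open>type_share t * density_const\<close> is the
  density of admissible pairs, \<open>3 / 2\<close> comes from the sector, and
  \<open>sqrt (disc_factor t)\<close> from \<open>T^2 = sqrt (N / disc_factor t)\<close>.\<close>

lemma type_const_eq: "type_const t * sqrt (real (disc_factor t)) = type_share t * density_const * (3 / 2)"
proof (cases t)
  case TypeI
  have "sqrt 27 = 3 * sqrt 3" by (rule real_sqrt_unique) (simp_all add: power_mult_distrib)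
  thus ?thesis using TypeI by (simp add: disc_factor_def type_share_def)
next
  case TypeII
  thus ?thesis by (simp add: disc_factor_def type_share_def)
qed

lemma shape_functional_tendsto:
  assumes f: "f \<in> Cc t"
  shows "(\<lambda>N. shape_functional t N f) \<longlonglongrightarrow> (\<integral>z. f z \<partial>shape_measure t)"
proof -
  define g where "g = (\<lambda>y. f (ray_point t y))"
  obtain R where R: "R \<ge> 1" "\<And>y. y > R \<Longrightarrow> g y = 0" using Cc_vanishes[OF f] unfolding g_def by metis
  have cont: "continuous_on {1..} g"
    unfolding g_def
  proof (rule continuous_on_compose2[OF _ continuous_ray_point])
    show "continuous_on (shape_space t) f" using f by (simp add: Cc_def)
  qed (simp add: shape_space_def)
  define F where "F = ratio_kernel g"
  define m where "m = real (disc_factor t)"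
  have m: "m > 0" by (simp add: m_def disc_factor_def)
  obtain B where B: "B \<ge> 0" "\<And>y. y \<ge> 1 \<Longrightarrow> \<bar>g y\<bar> \<le> B" using g_bounded[OF cont R] by blast
  have supp: "0 < u \<and> u \<le> R ^ 3 \<and> 0 < v \<and> v \<le> R ^ 3" if "F (u, v) \<noteq> 0" for u v
    using ratio_kernel_support(1)[OF cont R] that unfolding F_def by blast
  \<comment> \<open>The added 1 makes the inequality \<open>R^3 * T < J T\<close> strict.\<close>
  define J where "J = (\<lambda>T. nat \<lceil>R ^ 3 * T\<rceil> + 1)"
  have J1: "R ^ 3 * T < real (J T)" for T unfolding J_def by linarith
  have J2: "real (J T) \<le> (R ^ 3 + 2) * T" if "T \<ge> 1" for T
  proof -
    have "R ^ 3 * T \<ge> 0" using R that by simp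
    hence "real (J T) \<le> R ^ 3 * T + 2" unfolding J_def by linarith
    thus ?thesis using that by (simp add: distrib_right)
  qed
  define S where "S = (\<lambda>T. \<Sum>a<J T. \<Sum>b<J T. if good t a b then F (real a / T, real b / T) else 0)"
  have "((\<lambda>T. S T / T\<^sup>2) \<longlongrightarrow> type_share t * density_const * (\<integral>p. F p \<partial>lborel)) at_top"
    unfolding S_def
  proof (rule good_pairs_sum_tendsto)
    show "\<bar>F p\<bar> \<le> B" for p unfolding F_def using ratio_kernel_bounded[OF cont R B(2,1)] .
    show "F \<in> borel_measurable borel" unfolding F_def by (rule ratio_kernel_measurable[OF cont R])
    show "AE p in lborel. isCont F p" unfolding F_def by (rule ratio_kernel_continuous[OF cont R])
  qed (use supp J1 J2 in auto)
  moreover have "filterlim (\<lambda>N. sqrt (sqrt (real N / m))) at_top sequentially"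
    using m by real_asymp
  ultimately have lim: "(\<lambda>N. S (sqrt (sqrt (real N / m))) / (sqrt (sqrt (real N / m)))\<^sup>2)
      \<longlonglongrightarrow> type_share t * density_const * (\<integral>p. F p \<partial>lborel)"
    by (rule filterlim_compose)
  have "(\<lambda>N. S (sqrt (sqrt (real N / m))) / (sqrt (sqrt (real N / m)))\<^sup>2 / (type_const t * sqrt m))
      \<longlonglongrightarrow> type_share t * density_const * (\<integral>p. F p \<partial>lborel) / (type_const t * sqrt m)"
    using type_const_pos[of t] m by (intro tendsto_divide lim tendsto_const) simp
  also have "type_share t * density_const * (\<integral>p. F p \<partial>lborel) / (type_const t * sqrt m)
      = (\<integral>z. f z \<partial>shape_measure t)"
  proof -
    have "type_share t \<noteq> 0" "density_const \<noteq> 0"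
      using density_const_pos by (simp_all add: type_share_def)
    moreover have "(\<integral>p. F p \<partial>lborel) = 3 / 2 * (\<integral>z. f z \<partial>shape_measure t)"
      using ratio_kernel_integral[OF cont R] unfolding F_def integral_shape_measure[OF f] by (simp only: g_def)
    ultimately show ?thesis unfolding m_def type_const_eq by simp
  qed
  finally show ?thesis
  proof (rule Lim_transform_eventually)
    show "\<forall>\<^sub>F N in sequentially. S (sqrt (sqrt (real N / m))) / (sqrt (sqrt (real N / m)))\<^sup>2 / (type_const t * sqrt m)
        = shape_functional t N f"
      \<comment> \<open>For \<open>N = 0\<close> the scale \<open>T\<close> would be zero.\<close>
      using eventually_gt_at_top[of 0]
    proof eventually_elim
      case (elim N)
      define T where "T = sqrt (sqrt (real N / m))"
      have T: "T > 0" "T\<^sup>2 = sqrt (real N / real (disc_factor t))" using elim m by (simp_all add: T_def m_def)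
      have "(\<Sum>(a, b)\<in>field_pairs t N. g (root 3 (real a / real b))) = S T"
        unfolding S_def F_def
        by (rule sum_field_pairs[where M = "R ^ 3"]) (use T J1 supp in \<open>simp_all add: F_def\<close>)
      hence "shape_functional t N f = 1 / (type_const t * sqrt (real N)) * S T"
        unfolding shape_functional_def sum_iso_classes by (simp only: g_def)
      moreover have "sqrt (real N) = T\<^sup>2 * sqrt m"
        unfolding T(2) m_def[symmetric] using m by (simp flip: real_sqrt_mult)
      ultimately have "S T / T\<^sup>2 / (type_const t * sqrt m) = shape_functional t N f" by (simp add: mult_ac)
      thus ?case by (simp only: T_def)
    qed
  qed
qed

text \<open>The limit is proved for the functionals; the first conjunct, which identifies the
  explicit sum of Dirac measures as the Riesz representing measure, transfers it to
  integrals.\<close>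

theorem theorem3p1:
  fixes t :: cubic_type
  shows "(\<forall>N::nat. N > 0 \<longrightarrow> (\<forall>f\<in>Cc t. (\<integral>z. f z \<partial>empirical_measure t N) = shape_functional t N f)) \<and>
    (\<forall>f\<in>Cc t.
      (\<lambda>N. \<integral>z. f z \<partial>empirical_measure t N) \<longlonglongrightarrow> (\<integral>z. f z \<partial>shape_measure t))"
  using integral_empirical_measure shape_functional_tendsto by simp

end
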